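(* The assignments $$\big((\mathcal{C},\mathsf{M})\xrightarrow{(K,(F_o,F_m))}(\mathcal{C}',\mathsf{M}')\big)\mapsto\big(P_{\mathsf{M}}\xrightarrow{([K,(F_o,F_m)],\,K/F_o)}P_{\mathsf{M}'}\big)$$ and $$\big((\mathcal{C},\mathsf{M})\xrightarrow{(K,(F_o,F_m))}(\mathcal{C}',\mathsf{M}')\big)\mapsto\big(Q_{\mathsf{M}}\xrightarrow{(\{K,(F_o,F_m)\},\,K/F_o)}Q_{\mathsf{M}'}\big)$$ define functors $P,Q\colon\mathrm{IntCat}\to\mathrm{DFib}$, and the functors $P$ and $Q$ are naturally isomorphic.
   Context: Spans. Let $\mathcal{C}$ be finitely complete and locally small. For an object $O$ of $\mathcal{C}$, $\mathcal{C}_O$ is the monoidal category whose objects are spans $\bar X=(O\xleftarrow{x}X\xrightarrow{x'}O)$ and whose morphisms (2-cells) $\bar X\to\bar Z=(O\xleftarrow{z}Z\xrightarrow{z'}O)$ are $\mathcal{C}$-morphisms $t\colon X\to Z$ with $z\circ t=x$, $z'\circ t=x'$. For $\bar Y=(O\xleftarrow{y}Y\xrightarrow{y'}O)$, the underlying object of $\bar Y\otimes\bar X$ is the pullback of $x'$ and $y$; its left leg is $x\circ p_X$ and its right leg is $y'\circ p_Y$ ($p_X,p_Y$ the projections). On 2-cells $\otimes$ is induced by the pullback property. The unit is $\bar O=(O\xleftarrow{\mathrm{id}}O\xrightarrow{\mathrm{id}}O)$. For $f\colon A\to O$ write $\mathsf{f}_A=(O\xleftarrow{f}A\xrightarrow{f}O)$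 (for a composite such as $F\circ h\colon A\to O$ write $(F\circ h)_A$). Internal categories. An internal category $\mathsf{M}=(O,M,d,c,\eta,\mu)$ in $\mathcal{C}$ (domain $d$, codomain $c$, identities $\eta$, composition $\mu$) is the same as a monoid $(\bar M,\eta,\mu)$ in $\mathcal{C}_O$ with $\bar M=(O\xleftarrow{d}M\xrightarrow{c}O)$. An internal functor $\mathsf{M}\to\mathsf{M}'$ is a pair $(F_o\colon O\to O',F_m\colon M\to M')$ with $d'F_m=F_od$, $c'F_m=F_oc$, $F_m\eta=\eta'F_o$, $F_m\mu=\mu'(F_m\times F_m)$. The underlying object of $\mathsf{f}_A\otimes\bar M$ is the pullback of $f$ and $c$, with projections $\pi_A,\pi_M$, left leg $d\pi_M$, right leg $f\pi_A$. For 2-cells $\xi\colon\mathsf{f}_A\to\mathsf{f}_A$, $\upsilon\colon\mathsf{f}_A\to\bar M$, $\langle\xi,\upsilon\rangle\colon\mathsf{f}_A\to\mathsf{f}_A\otimes\bar M$ is the 2-cell with components $\xi,\upsilon$. The discrete fibrations. $\mathrm{Conv}_{\mathsf{M}}$ has as objects all 2-cells $\alpha\colon\mathsf{f}_A\to\bar M$ ($f\colon A\to O$), and as morphisms $\alpha\to(\beta\colon\mathsf{g}_B\to\bar M)$ all 2-cells $\phi\colon\mathsf{f}_A\to\mathsf{g}_B$ with $\beta\phi=\alpha$; $P_{\mathsf{M}}\colon\mathrm{Conv}_{\mathsf{M}}\to\mathcal{C}/O$ sends $\alpha$ to $(f\colon A\to O)$ and $\phi$ to $\phi$. ${}^{sp}\mathrm{End}_{\mathsf{M}}$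 has as objects all 2-cells $\mathsf{f}_A\to\mathsf{f}_A\otimes\bar M$ of the form $\langle\mathrm{id},\alpha\rangle$ with a 2-cell $\alpha\colon\mathsf{f}_A\to\bar M$, and as morphisms $\langle\mathrm{id},\alpha\rangle\to\langle\mathrm{id},\beta\rangle$ (with $\beta\colon\mathsf{g}_B\to\bar M$) all pairs $(\sigma,\tau)$ of 2-cells $\mathsf{f}_A\to\mathsf{g}_B$ with $\langle\mathrm{id},\beta\rangle\circ\sigma=(\tau\otimes\mathrm{id}_{\bar M})\circ\langle\mathrm{id},\alpha\rangle$; necessarily $\sigma=\tau$, so a morphism is denoted simply by $\sigma$. $Q_{\mathsf{M}}\colon{}^{sp}\mathrm{End}_{\mathsf{M}}\to\mathcal{C}/O$ sends $\langle\mathrm{id},\alpha\rangle$ to $(f\colon A\to O)$ and $\sigma$ to $\sigma$. Both $P_{\mathsf{M}}$ and $Q_{\mathsf{M}}$ are discrete fibrations (functors $P\colon\mathcal{E}\to\mathcal{A}$ with small fibres such that each $A'\to PX$ has a unique lift with codomain $X$). $\mathrm{IntCat}$: objects are pairs $(\mathcal{C},\mathsf{M})$ with $\mathcal{C}$ a finitely complete locally small category and $\mathsf{M}$ an internal category in $\mathcal{C}$. A morphism $(\mathcal{C},\mathsf{M})\to(\mathcal{C}',\mathsf{M}')$ is a pair $(K,(F_o,F_m))$ with $K\colon\mathcal{C}\to\mathcal{C}'$ a finite limit preserving functor and $(F_o,F_m)\colon K(\mathsf{M})\to\mathsf{M}'$ an internal functor in $\mathcal{C}'$, where $K(\mathsf{M})$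 is the image internal category. Composition is that of the Grothendieck construction: $(K',(F'_o,F'_m))\circ(K,(F_o,F_m))=(K'K,(F'_o\circ K'(F_o),F'_m\circ K'(F_m)))$. $\mathrm{DFib}$: objects are discrete fibrations between locally small categories; a morphism from $P\colon\mathcal{A}\to\mathcal{C}$ to $Q\colon\mathcal{B}\to\mathcal{D}$ is a pair of functors $(F\colon\mathcal{A}\to\mathcal{B},G\colon\mathcal{C}\to\mathcal{D})$ with $Q\circ F=G\circ P$. ($\mathrm{IntCat}$ and $\mathrm{DFib}$ are very large categories, not assumed locally small.) Action on morphisms, for $(K,(F_o,F_m))\colon(\mathcal{C},\mathsf{M})\to(\mathcal{C}',\mathsf{M}')$: the functor $K/F_o\colon\mathcal{C}/O\to\mathcal{C}'/O'$ sends $(f\colon C\to O)$ to $F_o\circ K(f)\colon K(C)\to O'$ and a morphism $\alpha$ to $K(\alpha)$. The functor $[K,(F_o,F_m)]\colon\mathrm{Conv}_{\mathsf{M}}\to\mathrm{Conv}_{\mathsf{M}'}$ sends $(\alpha\colon\mathsf{f}_A\to\bar M)$ to $F_m\circ K(\alpha)\colon(F_o\circ K(f))_{K(A)}\to\bar M'$ and $\sigma$ to $K(\sigma)$. The functor $\{K,(F_o,F_m)\}\colon{}^{sp}\mathrm{End}_{\mathsf{M}}\to{}^{sp}\mathrm{End}_{\mathsf{M}'}$ sends $\langle\mathrm{id},\alpha\rangle\colon\mathsf{f}_A\to\mathsf{f}_A\otimes\bar M$ to $\langle\mathrm{id},F_m\circ K(\alpha)\rangle\colon(F_o\circ K(f))_{K(A)}\to(F_o\circ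 K(f))_{K(A)}\otimes\bar M'$ and $\sigma$ to $K(\sigma)$. *)

theory Defs
  imports "HOL-Library.FuncSet" "HOL-Library.Equipollence"
begin

section \<open>Categories, functors, natural isomorphisms\<close>

text \<open>
  The selectors of a category are relevant only on its objects and arrows. Functors, in contrast,
  are extensional (equal to \<open>undefined\<close> off the carriers), so that equality of functors is HOL
  equality; this is needed because functors occur as arrows of other categories below.
\<close>

record ('o, 'm) category =
  Obj :: "'o set"
  Arr :: "'m set"
  Dom :: "'m \<Rightarrow> 'o"
  Cod :: "'m \<Rightarrow> 'o"
  Ident :: "'o \<Rightarrow> 'm"
  Comp :: "'m \<Rightarrow> 'm \<Rightarrow> 'm"  (infixl "\<cdot>\<index>" 70)

definition hom :: "('o, 'm) category \<Rightarrow> 'o \<Rightarrow> 'o \<Rightarrow> 'm set" where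
  "hom C a b = {f \<in> Arr C. Dom C f = a \<and> Cod C f = b}"

definition is_category :: "('o, 'm) category \<Rightarrow> bool" where
  "is_category C \<longleftrightarrow>
     (\<forall>f \<in> Arr C. Dom C f \<in> Obj C \<and> Cod C f \<in> Obj C) \<and>
     (\<forall>a \<in> Obj C. Ident C a \<in> hom C a a) \<and>
     (\<forall>f \<in> Arr C. \<forall>g \<in> Arr C. Dom C g = Cod C f \<longrightarrow> g \<cdot>\<^bsub>C\<^esub> f \<in> hom C (Dom C f) (Cod C g)) \<and>
     (\<forall>f \<in> Arr C. f \<cdot>\<^bsub>C\<^esub> Ident C (Dom C f) = f \<and> Ident C (Cod C f) \<cdot>\<^bsub>C\<^esub> f = f) \<and>
     (\<forall>f \<in> Arr C. \<forall>g \<in> Arr C. \<forall>h \<in> Arr C. Dom C g = Cod C f \<and> Dom C h = Cod C g \<longrightarrow>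
        (h \<cdot>\<^bsub>C\<^esub> g) \<cdot>\<^bsub>C\<^esub> f = h \<cdot>\<^bsub>C\<^esub> (g \<cdot>\<^bsub>C\<^esub> f))"

record ('o, 'm, 'p, 'n) functr =
  Fob :: "'o \<Rightarrow> 'p"
  Far :: "'m \<Rightarrow> 'n"

definition is_functor ::
    "('o, 'm) category \<Rightarrow> ('p, 'n) category \<Rightarrow> ('o, 'm, 'p, 'n) functr \<Rightarrow> bool" where
  "is_functor C D F \<longleftrightarrow>
     is_category C \<and> is_category D \<and>
     Fob F \<in> Obj C \<rightarrow>\<^sub>E Obj D \<and> Far F \<in> Arr C \<rightarrow>\<^sub>E Arr D \<and>
     (\<forall>f \<in> Arr C. Dom D (Far F f) = Fob F (Dom C f) \<and> Cod D (Far F f) = Fob F (Cod C f)) \<and>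
     (\<forall>a \<in> Obj C. Far F (Ident C a) = Ident D (Fob F a)) \<and>
     (\<forall>f \<in> Arr C. \<forall>g \<in> Arr C. Dom C g = Cod C f \<longrightarrow>
        Far F (g \<cdot>\<^bsub>C\<^esub> f) = Far F g \<cdot>\<^bsub>D\<^esub> Far F f)"

definition id_functor :: "('o, 'm) category \<Rightarrow> ('o, 'm, 'o, 'm) functr" where
  "id_functor C = \<lparr>Fob = (\<lambda>a \<in> Obj C. a), Far = (\<lambda>f \<in> Arr C. f)\<rparr>"

text \<open>\<open>comp_functor C G F\<close> is \<open>G \<circ> F\<close>, where \<open>C\<close> is the source of \<open>F\<close>.\<close>

definition comp_functor ::
    "('o, 'm) category \<Rightarrow> ('p, 'n, 'q, 'k) functr \<Rightarrow> ('o, 'm, 'p, 'n) functr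
      \<Rightarrow> ('o, 'm, 'q, 'k) functr" where
  "comp_functor C G F =
     \<lparr>Fob = compose (Obj C) (Fob G) (Fob F), Far = compose (Arr C) (Far G) (Far F)\<rparr>"

definition is_iso :: "('o, 'm) category \<Rightarrow> 'm \<Rightarrow> bool" where
  "is_iso C f \<longleftrightarrow> f \<in> Arr C \<and>
     (\<exists>g \<in> hom C (Cod C f) (Dom C f).
        g \<cdot>\<^bsub>C\<^esub> f = Ident C (Dom C f) \<and> f \<cdot>\<^bsub>C\<^esub> g = Ident C (Cod C f))"

definition is_nat_iso ::
    "('o, 'm) category \<Rightarrow> ('p, 'n) category \<Rightarrow> ('o, 'm, 'p, 'n) functr \<Rightarrow> ('o, 'm, 'p, 'n) functr
      \<Rightarrow> ('o \<Rightarrow> 'n) \<Rightarrow> bool" where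
  "is_nat_iso C D F G \<theta> \<longleftrightarrow>
     is_functor C D F \<and> is_functor C D G \<and>
     (\<forall>a \<in> Obj C. \<theta> a \<in> hom D (Fob F a) (Fob G a) \<and> is_iso D (\<theta> a)) \<and>
     (\<forall>f \<in> Arr C. \<theta> (Cod C f) \<cdot>\<^bsub>D\<^esub> Far F f = Far G f \<cdot>\<^bsub>D\<^esub> \<theta> (Dom C f))"

definition naturally_isomorphic ::
    "('o, 'm) category \<Rightarrow> ('p, 'n) category \<Rightarrow> ('o, 'm, 'p, 'n) functr \<Rightarrow> ('o, 'm, 'p, 'n) functr
      \<Rightarrow> bool" where
  "naturally_isomorphic C D F G \<longleftrightarrow> (\<exists>\<theta>. is_nat_iso C D F G \<theta>)"

text \<open>
  Categories whose arrows are data \<open>und t \<in> H a b\<close> tagged with source \<open>a\<close> and target \<open>b\<close>.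
  In \<open>tagged_category A H i k\<close>, \<open>i a\<close> is the identity datum on \<open>a\<close>, and \<open>k a c v u\<close> is the datum
  of the composite from \<open>a\<close> to \<open>c\<close> of \<open>u\<close> followed by \<open>v\<close>.
\<close>

record ('x, 'y) tagged =
  src :: 'x
  tgt :: 'x
  und :: 'y

definition tagged_category ::
    "'x set \<Rightarrow> ('x \<Rightarrow> 'x \<Rightarrow> 'y set) \<Rightarrow> ('x \<Rightarrow> 'y) \<Rightarrow> ('x \<Rightarrow> 'x \<Rightarrow> 'y \<Rightarrow> 'y \<Rightarrow> 'y)
      \<Rightarrow> ('x, ('x, 'y) tagged) category" where
  "tagged_category A H i k =
     \<lparr>Obj = A,
      Arr = {t. src t \<in> A \<and> tgt t \<in> A \<and> und t \<in> H (src t) (tgt t)},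
      Dom = src,
      Cod = tgt,
      Ident = (\<lambda>a. \<lparr>src = a, tgt = a, und = i a\<rparr>),
      Comp = (\<lambda>t s. \<lparr>src = src s, tgt = tgt t, und = k (src s) (tgt t) (und t) (und s)\<rparr>)\<rparr>"


section \<open>Smallness, discrete fibrations\<close>

text \<open>
  Size is measured against a set \<open>U\<close>, playing the role of a universe: a set is small if it has
  strictly smaller cardinality than \<open>U\<close>. For \<open>U = V\<^sub>\<kappa>\<close> with \<open>\<kappa>\<close> inaccessible these are
  exactly the sets equipotent to an element of \<open>U\<close>. No closure property of \<open>U\<close> is imposed.
\<close>

definition small :: "'u set \<Rightarrow> 'a set \<Rightarrow> bool" where
  "small U X \<longleftrightarrow> X \<prec> U"

definition locally_small :: "'u set \<Rightarrow> ('o, 'm) category \<Rightarrow> bool" where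
  "locally_small U C \<longleftrightarrow> (\<forall>a \<in> Obj C. \<forall>b \<in> Obj C. small U (hom C a b))"

definition discrete_fibration ::
    "'u set \<Rightarrow> ('x, 'y) category \<Rightarrow> ('z, 'w) category \<Rightarrow> ('x, 'y, 'z, 'w) functr \<Rightarrow> bool" where
  "discrete_fibration U E B P \<longleftrightarrow>
     is_functor E B P \<and>
     (\<forall>b \<in> Obj B. small U {x \<in> Obj E. Fob P x = b}) \<and>
     (\<forall>x \<in> Obj E. \<forall>u \<in> Arr B. Cod B u = Fob P x \<longrightarrow>
        (\<exists>!e. e \<in> Arr E \<and> Cod E e = x \<and> Far P e = u))"

record ('x, 'y, 'z, 'w) dfib =
  Tot :: "('x, 'y) category"
  Base :: "('z, 'w) category"
  Proj :: "('x, 'y, 'z, 'w) functr"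

record ('x, 'y, 'z, 'w) dfib_mor =
  TotF :: "('x, 'y, 'x, 'y) functr"
  BaseF :: "('z, 'w, 'z, 'w) functr"

definition DFib ::
    "'u set \<Rightarrow> (('x, 'y, 'z, 'w) dfib,
       (('x, 'y, 'z, 'w) dfib, ('x, 'y, 'z, 'w) dfib_mor) tagged) category" where
  "DFib U = tagged_category
     {P. locally_small U (Tot P) \<and> locally_small U (Base P) \<and>
         discrete_fibration U (Tot P) (Base P) (Proj P)}
     (\<lambda>P Q. {m. is_functor (Tot P) (Tot Q) (TotF m) \<and> is_functor (Base P) (Base Q) (BaseF m) \<and>
         comp_functor (Tot P) (Proj Q) (TotF m) = comp_functor (Tot P) (BaseF m) (Proj P)})
     (\<lambda>P. \<lparr>TotF = id_functor (Tot P), BaseF = id_functor (Base P)\<rparr>)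
     (\<lambda>P _ n m. \<lparr>TotF = comp_functor (Tot P) (TotF n) (TotF m),
               BaseF = comp_functor (Base P) (BaseF n) (BaseF m)\<rparr>)"


section \<open>Finite limits and pullbacks\<close>

definition is_cone ::
    "('j, 'i) category \<Rightarrow> ('o, 'm) category \<Rightarrow> ('j, 'i, 'o, 'm) functr \<Rightarrow> 'o \<Rightarrow> ('j \<Rightarrow> 'm) \<Rightarrow> bool" where
  "is_cone J C D a \<gamma> \<longleftrightarrow>
     a \<in> Obj C \<and> (\<forall>j \<in> Obj J. \<gamma> j \<in> hom C a (Fob D j)) \<and>
     (\<forall>u \<in> Arr J. Far D u \<cdot>\<^bsub>C\<^esub> \<gamma> (Dom J u) = \<gamma> (Cod J u))"

definition is_limit ::
    "('j, 'i) category \<Rightarrow> ('o, 'm) category \<Rightarrow> ('j, 'i, 'o, 'm) functr \<Rightarrow> 'o \<Rightarrow> ('j \<Rightarrow> 'm) \<Rightarrow> bool" where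
  "is_limit J C D a \<gamma> \<longleftrightarrow>
     is_cone J C D a \<gamma> \<and>
     (\<forall>b \<delta>. is_cone J C D b \<delta> \<longrightarrow>
        (\<exists>!t. t \<in> hom C b a \<and> (\<forall>j \<in> Obj J. \<gamma> j \<cdot>\<^bsub>C\<^esub> t = \<delta> j)))"

text \<open>Every finite category is isomorphic to one whose objects and arrows are natural numbers.\<close>

definition finite_category :: "(nat, nat) category \<Rightarrow> bool" where
  "finite_category J \<longleftrightarrow> is_category J \<and> finite (Obj J) \<and> finite (Arr J)"

definition finitely_complete :: "('o, 'm) category \<Rightarrow> bool" where
  "finitely_complete C \<longleftrightarrow>
     is_category C \<and>
     (\<forall>J D. finite_category J \<and> is_functor J C D \<longrightarrow> (\<exists>a \<gamma>. is_limit J C D a \<gamma>))"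

definition preserves_finite_limits ::
    "('o, 'm) category \<Rightarrow> ('p, 'n) category \<Rightarrow> ('o, 'm, 'p, 'n) functr \<Rightarrow> bool" where
  "preserves_finite_limits C C' K \<longleftrightarrow>
     (\<forall>J D a \<gamma>. finite_category J \<and> is_functor J C D \<and> is_limit J C D a \<gamma> \<longrightarrow>
        is_limit J C' (comp_functor J K D) (Fob K a) (\<lambda>j. Far K (\<gamma> j)))"

definition is_pullback :: "('o, 'm) category \<Rightarrow> 'm \<Rightarrow> 'm \<Rightarrow> 'm \<Rightarrow> 'm \<Rightarrow> bool" where
  "is_pullback C f g p q \<longleftrightarrow>
     f \<in> Arr C \<and> g \<in> Arr C \<and> Cod C f = Cod C g \<and>
     p \<in> Arr C \<and> q \<in> Arr C \<and> Dom C p = Dom C q \<and> Cod C p = Dom C f \<and> Cod C q = Dom C g \<and>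
     f \<cdot>\<^bsub>C\<^esub> p = g \<cdot>\<^bsub>C\<^esub> q \<and>
     (\<forall>u \<in> Arr C. \<forall>v \<in> Arr C.
        Dom C u = Dom C v \<and> Cod C u = Dom C f \<and> Cod C v = Dom C g \<and> f \<cdot>\<^bsub>C\<^esub> u = g \<cdot>\<^bsub>C\<^esub> v \<longrightarrow>
        (\<exists>!t. t \<in> hom C (Dom C u) (Dom C p) \<and> p \<cdot>\<^bsub>C\<^esub> t = u \<and> q \<cdot>\<^bsub>C\<^esub> t = v))"

text \<open>The tensor product of spans refers to a fixed choice of pullbacks.\<close>

definition pb :: "('o, 'm) category \<Rightarrow> 'm \<Rightarrow> 'm \<Rightarrow> 'm \<times> 'm" where
  "pb C f g = (SOME pq. is_pullback C f g (fst pq) (snd pq))"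

definition pr1 :: "('o, 'm) category \<Rightarrow> 'm \<Rightarrow> 'm \<Rightarrow> 'm" where
  "pr1 C f g = fst (pb C f g)"

definition pr2 :: "('o, 'm) category \<Rightarrow> 'm \<Rightarrow> 'm \<Rightarrow> 'm" where
  "pr2 C f g = snd (pb C f g)"

definition lift :: "('o, 'm) category \<Rightarrow> 'm \<Rightarrow> 'm \<Rightarrow> 'm \<Rightarrow> 'm \<Rightarrow> 'm" where
  "lift C p q u v = (THE t. t \<in> hom C (Dom C u) (Dom C p) \<and> p \<cdot>\<^bsub>C\<^esub> t = u \<and> q \<cdot>\<^bsub>C\<^esub> t = v)"

definition pb_pair :: "('o, 'm) category \<Rightarrow> 'm \<Rightarrow> 'm \<Rightarrow> 'm \<Rightarrow> 'm \<Rightarrow> 'm" where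
  "pb_pair C f g u v = lift C (pr1 C f g) (pr2 C f g) u v"


section \<open>The monoidal category of spans over an object\<close>

record 'm span =
  lleg :: 'm
  rleg :: 'm

type_synonym 'm cell = "('m span, 'm) tagged"

definition SpanCat :: "('o, 'm) category \<Rightarrow> 'o \<Rightarrow> ('m span, 'm cell) category" where
  "SpanCat C ob = tagged_category
     {X. lleg X \<in> Arr C \<and> rleg X \<in> Arr C \<and> Dom C (lleg X) = Dom C (rleg X) \<and>
         Cod C (lleg X) = ob \<and> Cod C (rleg X) = ob}
     (\<lambda>X Z. {t \<in> hom C (Dom C (lleg X)) (Dom C (lleg Z)).
         lleg Z \<cdot>\<^bsub>C\<^esub> t = lleg X \<and> rleg Z \<cdot>\<^bsub>C\<^esub> t = rleg X})
     (\<lambda>X. Ident C (Dom C (lleg X)))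
     (\<lambda>_ _ t s. t \<cdot>\<^bsub>C\<^esub> s)"

definition unit_span :: "('o, 'm) category \<Rightarrow> 'o \<Rightarrow> 'm span" where
  "unit_span C ob = \<lparr>lleg = Ident C ob, rleg = Ident C ob\<rparr>"

definition diag_span :: "'m \<Rightarrow> 'm span" where
  "diag_span f = \<lparr>lleg = f, rleg = f\<rparr>"

text \<open>
  \<open>tensor C Y X\<close> is \<open>Y \<otimes> X\<close>: the projection to \<open>X\<close> is the first one, the projection to \<open>Y\<close>
  the second one.
\<close>

definition tensor :: "('o, 'm) category \<Rightarrow> 'm span \<Rightarrow> 'm span \<Rightarrow> 'm span" where
  "tensor C Y X =
     \<lparr>lleg = lleg X \<cdot>\<^bsub>C\<^esub> pr1 C (rleg X) (lleg Y),
      rleg = rleg Y \<cdot>\<^bsub>C\<^esub> pr2 C (rleg X) (lleg Y)\<rparr>"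

definition tensor_cell :: "('o, 'm) category \<Rightarrow> 'm cell \<Rightarrow> 'm cell \<Rightarrow> 'm cell" where
  "tensor_cell C s t =
     \<lparr>src = tensor C (src s) (src t),
      tgt = tensor C (tgt s) (tgt t),
      und = pb_pair C (rleg (tgt t)) (lleg (tgt s))
              (und t \<cdot>\<^bsub>C\<^esub> pr1 C (rleg (src t)) (lleg (src s)))
              (und s \<cdot>\<^bsub>C\<^esub> pr2 C (rleg (src t)) (lleg (src s)))\<rparr>"

text \<open>The associator \<open>(Z \<otimes> Y) \<otimes> X \<rightarrow> Z \<otimes> (Y \<otimes> X)\<close>, which on generalized elements is
  \<open>(x, (y, z)) \<mapsto> ((x, y), z)\<close>, and the unitors \<open>O \<otimes> X \<rightarrow> X\<close> and \<open>X \<otimes> O \<rightarrow> X\<close>.\<close>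

definition associator :: "('o, 'm) category \<Rightarrow> 'm span \<Rightarrow> 'm span \<Rightarrow> 'm span \<Rightarrow> 'm cell" where
  "associator C Z Y X =
     (let ZY = tensor C Z Y; YX = tensor C Y X;
          pX = pr1 C (rleg X) (lleg ZY);
          pZY = pr2 C (rleg X) (lleg ZY);
          pY = pr1 C (rleg Y) (lleg Z) \<cdot>\<^bsub>C\<^esub> pZY;
          pZ = pr2 C (rleg Y) (lleg Z) \<cdot>\<^bsub>C\<^esub> pZY
      in \<lparr>src = tensor C ZY X,
          tgt = tensor C Z YX,
          und = pb_pair C (rleg YX) (lleg Z) (pb_pair C (rleg X) (lleg Y) pX pY) pZ\<rparr>)"

definition lunitor :: "('o, 'm) category \<Rightarrow> 'o \<Rightarrow> 'm span \<Rightarrow> 'm cell" where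
  "lunitor C ob X =
     \<lparr>src = tensor C (unit_span C ob) X, tgt = X, und = pr1 C (rleg X) (Ident C ob)\<rparr>"

definition runitor :: "('o, 'm) category \<Rightarrow> 'o \<Rightarrow> 'm span \<Rightarrow> 'm cell" where
  "runitor C ob X =
     \<lparr>src = tensor C X (unit_span C ob), tgt = X, und = pr2 C (Ident C ob) (lleg X)\<rparr>"

text \<open>For \<open>\<xi> : V \<rightarrow> Y\<close> and \<open>\<upsilon> : V \<rightarrow> X\<close>, \<open>cell_pair C \<xi> \<upsilon>\<close> is \<open>\<langle>\<xi>, \<upsilon>\<rangle> : V \<rightarrow> Y \<otimes> X\<close>.\<close>

definition cell_pair :: "('o, 'm) category \<Rightarrow> 'm cell \<Rightarrow> 'm cell \<Rightarrow> 'm cell" where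
  "cell_pair C \<xi> \<upsilon> =
     \<lparr>src = src \<xi>,
      tgt = tensor C (tgt \<xi>) (tgt \<upsilon>),
      und = pb_pair C (rleg (tgt \<upsilon>)) (lleg (tgt \<xi>)) (und \<upsilon>) (und \<xi>)\<rparr>"

definition is_monoid ::
    "('o, 'm) category \<Rightarrow> 'o \<Rightarrow> 'm span \<Rightarrow> 'm cell \<Rightarrow> 'm cell \<Rightarrow> bool" where
  "is_monoid C ob X e m \<longleftrightarrow>
     (let S = SpanCat C ob; i = Ident S X in
        X \<in> Obj S \<and> e \<in> hom S (unit_span C ob) X \<and> m \<in> hom S (tensor C X X) X \<and>
        m \<cdot>\<^bsub>S\<^esub> tensor_cell C m i = m \<cdot>\<^bsub>S\<^esub> (tensor_cell C i m \<cdot>\<^bsub>S\<^esub> associator C X X X) \<and>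
        m \<cdot>\<^bsub>S\<^esub> tensor_cell C e i = lunitor C ob X \<and>
        m \<cdot>\<^bsub>S\<^esub> tensor_cell C i e = runitor C ob X)"


section \<open>Internal categories and internal functors\<close>

record ('o, 'm) internal_cat =
  iobj :: 'o
  imor :: 'o
  idom :: 'm
  icod :: 'm
  iunit :: 'm
  imult :: 'm

definition ispan :: "('o, 'm) internal_cat \<Rightarrow> 'm span" where
  "ispan M = \<lparr>lleg = idom M, rleg = icod M\<rparr>"

definition internal_category :: "('o, 'm) category \<Rightarrow> ('o, 'm) internal_cat \<Rightarrow> bool" where
  "internal_category C M \<longleftrightarrow>
     iobj M \<in> Obj C \<and> imor M \<in> Obj C \<and>
     idom M \<in> hom C (imor M) (iobj M) \<and> icod M \<in> hom C (imor M) (iobj M) \<and>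
     is_monoid C (iobj M) (ispan M)
       \<lparr>src = unit_span C (iobj M), tgt = ispan M, und = iunit M\<rparr>
       \<lparr>src = tensor C (ispan M) (ispan M), tgt = ispan M, und = imult M\<rparr>"

definition internal_functor ::
    "('o, 'm) category \<Rightarrow> ('o, 'm) internal_cat \<Rightarrow> ('o, 'm) internal_cat \<Rightarrow> 'm \<Rightarrow> 'm \<Rightarrow> bool" where
  "internal_functor C M M' Fo Fm \<longleftrightarrow>
     Fo \<in> hom C (iobj M) (iobj M') \<and> Fm \<in> hom C (imor M) (imor M') \<and>
     idom M' \<cdot>\<^bsub>C\<^esub> Fm = Fo \<cdot>\<^bsub>C\<^esub> idom M \<and> icod M' \<cdot>\<^bsub>C\<^esub> Fm = Fo \<cdot>\<^bsub>C\<^esub> icod M \<and>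
     Fm \<cdot>\<^bsub>C\<^esub> iunit M = iunit M' \<cdot>\<^bsub>C\<^esub> Fo \<and>
     Fm \<cdot>\<^bsub>C\<^esub> imult M = imult M' \<cdot>\<^bsub>C\<^esub>
       pb_pair C (icod M') (idom M')
         (Fm \<cdot>\<^bsub>C\<^esub> pr1 C (icod M) (idom M)) (Fm \<cdot>\<^bsub>C\<^esub> pr2 C (icod M) (idom M))"

text \<open>
  The image of an internal category under a pullback preserving functor \<open>K\<close>. As \<open>K\<close> need not
  preserve the chosen pullbacks, \<open>K\<close> applied to the composition of \<open>M\<close> is precomposed with the
  comparison isomorphism from the chosen pullback in \<open>C'\<close> to the image of the one chosen in \<open>C\<close>.
\<close>

definition image_icat ::
    "('o, 'm) category \<Rightarrow> ('o, 'm) category \<Rightarrow> ('o, 'm, 'o, 'm) functr \<Rightarrow> ('o, 'm) internal_cat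
      \<Rightarrow> ('o, 'm) internal_cat" where
  "image_icat C C' K M =
     \<lparr>iobj = Fob K (iobj M),
      imor = Fob K (imor M),
      idom = Far K (idom M),
      icod = Far K (icod M),
      iunit = Far K (iunit M),
      imult = Far K (imult M) \<cdot>\<^bsub>C'\<^esub>
        lift C' (Far K (pr1 C (icod M) (idom M))) (Far K (pr2 C (icod M) (idom M)))
          (pr1 C' (Far K (icod M)) (Far K (idom M))) (pr2 C' (Far K (icod M)) (Far K (idom M)))\<rparr>"

record ('o, 'm) int_obj =
  amb :: "('o, 'm) category"
  icat :: "('o, 'm) internal_cat"

record ('o, 'm) int_mor =
  ifun :: "('o, 'm, 'o, 'm) functr"
  iFo :: 'm
  iFm :: 'm

type_synonym ('o, 'm) int_arr = "(('o, 'm) int_obj, ('o, 'm) int_mor) tagged"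

definition IntCat :: "'u set \<Rightarrow> (('o, 'm) int_obj, ('o, 'm) int_arr) category" where
  "IntCat U = tagged_category
     {X. finitely_complete (amb X) \<and> locally_small U (amb X) \<and> internal_category (amb X) (icat X)}
     (\<lambda>X Y. {k. is_functor (amb X) (amb Y) (ifun k) \<and>
         preserves_finite_limits (amb X) (amb Y) (ifun k) \<and>
         internal_functor (amb Y) (image_icat (amb X) (amb Y) (ifun k) (icat X)) (icat Y)
           (iFo k) (iFm k)})
     (\<lambda>X. \<lparr>ifun = id_functor (amb X),
           iFo = Ident (amb X) (iobj (icat X)), iFm = Ident (amb X) (imor (icat X))\<rparr>)
     (\<lambda>X Z l k. \<lparr>ifun = comp_functor (amb X) (ifun l) (ifun k),
           iFo = iFo l \<cdot>\<^bsub>amb Z\<^esub> Far (ifun l) (iFo k),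
           iFm = iFm l \<cdot>\<^bsub>amb Z\<^esub> Far (ifun l) (iFm k)\<rparr>)"


section \<open>The discrete fibrations of an internal category\<close>

definition Slice :: "('o, 'm) category \<Rightarrow> 'o \<Rightarrow> ('m, ('m, 'm) tagged) category" where
  "Slice C ob = tagged_category
     {f \<in> Arr C. Cod C f = ob}
     (\<lambda>f g. {t \<in> hom C (Dom C f) (Dom C g). g \<cdot>\<^bsub>C\<^esub> t = f})
     (\<lambda>f. Ident C (Dom C f))
     (\<lambda>_ _ t s. t \<cdot>\<^bsub>C\<^esub> s)"

definition Conv ::
    "('o, 'm) category \<Rightarrow> ('o, 'm) internal_cat \<Rightarrow> ('m cell, ('m cell, 'm cell) tagged) category" where
  "Conv C M = (let S = SpanCat C (iobj M) in tagged_category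
     {\<alpha>. \<exists>f \<in> Obj (Slice C (iobj M)). \<alpha> \<in> hom S (diag_span f) (ispan M)}
     (\<lambda>\<alpha> \<beta>. {\<phi> \<in> hom S (src \<alpha>) (src \<beta>). \<beta> \<cdot>\<^bsub>S\<^esub> \<phi> = \<alpha>})
     (\<lambda>\<alpha>. Ident S (src \<alpha>))
     (\<lambda>_ _ \<psi> \<phi>. \<psi> \<cdot>\<^bsub>S\<^esub> \<phi>))"

definition sp_cell :: "('o, 'm) category \<Rightarrow> ('o, 'm) internal_cat \<Rightarrow> 'm cell \<Rightarrow> 'm cell" where
  "sp_cell C M \<alpha> = cell_pair C (Ident (SpanCat C (iobj M)) (src \<alpha>)) \<alpha>"

text \<open>
  A morphism of \<open>SpEnd\<close> is a pair \<open>(\<sigma>, \<tau>)\<close> of 2-cells making a square commute. Composing the square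
  with the first projection gives \<open>\<sigma> = \<tau>\<close>, so the pair is represented by \<open>\<sigma>\<close>.
\<close>

definition SpEnd ::
    "('o, 'm) category \<Rightarrow> ('o, 'm) internal_cat \<Rightarrow> ('m cell, ('m cell, 'm cell) tagged) category" where
  "SpEnd C M = (let S = SpanCat C (iobj M) in tagged_category
     {e. \<exists>f \<in> Obj (Slice C (iobj M)). \<exists>\<alpha> \<in> hom S (diag_span f) (ispan M). e = sp_cell C M \<alpha>}
     (\<lambda>e e'. {\<sigma> \<in> hom S (src e) (src e'). \<exists>\<tau> \<in> hom S (src e) (src e').
        e' \<cdot>\<^bsub>S\<^esub> \<sigma> = tensor_cell C \<tau> (Ident S (ispan M)) \<cdot>\<^bsub>S\<^esub> e})
     (\<lambda>e. Ident S (src e))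
     (\<lambda>_ _ \<rho> \<sigma>. \<rho> \<cdot>\<^bsub>S\<^esub> \<sigma>))"

text \<open>The object \<open>f\<close> of the slice is recovered from the span \<open>diag_span f\<close> as its left leg.\<close>

definition slice_proj ::
    "('m cell, ('m cell, 'm cell) tagged) category
      \<Rightarrow> ('m cell, ('m cell, 'm cell) tagged, 'm, ('m, 'm) tagged) functr" where
  "slice_proj E =
     \<lparr>Fob = (\<lambda>\<alpha> \<in> Obj E. lleg (src \<alpha>)),
      Far = (\<lambda>t \<in> Arr E.
        \<lparr>src = lleg (src (und t)), tgt = lleg (tgt (und t)), und = und (und t)\<rparr>)\<rparr>"

type_synonym 'm cell_dfib =
  "('m cell, ('m cell, 'm cell) tagged, 'm, ('m, 'm) tagged) dfib"

type_synonym 'm cell_dfib_mor =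
  "('m cell, ('m cell, 'm cell) tagged, 'm, ('m, 'm) tagged) dfib_mor"

definition P_dfib :: "('o, 'm) category \<Rightarrow> ('o, 'm) internal_cat \<Rightarrow> 'm cell_dfib" where
  "P_dfib C M =
     \<lparr>Tot = Conv C M, Base = Slice C (iobj M), Proj = slice_proj (Conv C M)\<rparr>"

definition Q_dfib :: "('o, 'm) category \<Rightarrow> ('o, 'm) internal_cat \<Rightarrow> 'm cell_dfib" where
  "Q_dfib C M =
     \<lparr>Tot = SpEnd C M, Base = Slice C (iobj M), Proj = slice_proj (SpEnd C M)\<rparr>"


section \<open>Action on morphisms\<close>

definition slice_ob :: "('o, 'm) int_arr \<Rightarrow> 'm \<Rightarrow> 'm" where
  "slice_ob k f = iFo (und k) \<cdot>\<^bsub>amb (tgt k)\<^esub> Far (ifun (und k)) f"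

definition slice_map ::
    "('o, 'm) int_arr \<Rightarrow> ('m, ('m, 'm) tagged, 'm, ('m, 'm) tagged) functr" where
  "slice_map k = (let A = Slice (amb (src k)) (iobj (icat (src k))) in
     \<lparr>Fob = (\<lambda>f \<in> Obj A. slice_ob k f),
      Far = (\<lambda>t \<in> Arr A. \<lparr>src = slice_ob k (src t), tgt = slice_ob k (tgt t),
        und = Far (ifun (und k)) (und t)\<rparr>)\<rparr>)"

text \<open>The 2-cell \<open>K \<sigma>\<close> between the images of spans of the form \<open>diag_span f\<close>.\<close>

definition diag_cell_map :: "('o, 'm) int_arr \<Rightarrow> 'm cell \<Rightarrow> 'm cell" where
  "diag_cell_map k \<sigma> =
     \<lparr>src = diag_span (slice_ob k (lleg (src \<sigma>))),
      tgt = diag_span (slice_ob k (lleg (tgt \<sigma>))),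
      und = Far (ifun (und k)) (und \<sigma>)\<rparr>"

definition conv_ob :: "('o, 'm) int_arr \<Rightarrow> 'm cell \<Rightarrow> 'm cell" where
  "conv_ob k \<alpha> =
     \<lparr>src = diag_span (slice_ob k (lleg (src \<alpha>))),
      tgt = ispan (icat (tgt k)),
      und = iFm (und k) \<cdot>\<^bsub>amb (tgt k)\<^esub> Far (ifun (und k)) (und \<alpha>)\<rparr>"

definition conv_map ::
    "('o, 'm) int_arr
      \<Rightarrow> ('m cell, ('m cell, 'm cell) tagged, 'm cell, ('m cell, 'm cell) tagged) functr" where
  "conv_map k = (let E = Conv (amb (src k)) (icat (src k)) in
     \<lparr>Fob = (\<lambda>\<alpha> \<in> Obj E. conv_ob k \<alpha>),
      Far = (\<lambda>t \<in> Arr E. \<lparr>src = conv_ob k (src t), tgt = conv_ob k (tgt t),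
        und = diag_cell_map k (und t)\<rparr>)\<rparr>)"

definition sp_end_ob :: "('o, 'm) int_arr \<Rightarrow> 'm cell \<Rightarrow> 'm cell" where
  "sp_end_ob k e = sp_cell (amb (tgt k)) (icat (tgt k))
     (conv_ob k (THE \<alpha>. \<alpha> \<in> Obj (Conv (amb (src k)) (icat (src k))) \<and>
        e = sp_cell (amb (src k)) (icat (src k)) \<alpha>))"

definition sp_end_map ::
    "('o, 'm) int_arr
      \<Rightarrow> ('m cell, ('m cell, 'm cell) tagged, 'm cell, ('m cell, 'm cell) tagged) functr" where
  "sp_end_map k = (let E = SpEnd (amb (src k)) (icat (src k)) in
     \<lparr>Fob = (\<lambda>e \<in> Obj E. sp_end_ob k e),
      Far = (\<lambda>t \<in> Arr E. \<lparr>src = sp_end_ob k (src t), tgt = sp_end_ob k (tgt t),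
        und = diag_cell_map k (und t)\<rparr>)\<rparr>)"

definition P_functor ::
    "'u set \<Rightarrow> (('o, 'm) int_obj, ('o, 'm) int_arr,
       'm cell_dfib, ('m cell_dfib, 'm cell_dfib_mor) tagged) functr" where
  "P_functor U =
     \<lparr>Fob = (\<lambda>X \<in> Obj (IntCat U). P_dfib (amb X) (icat X)),
      Far = (\<lambda>k \<in> Arr (IntCat U).
        \<lparr>src = P_dfib (amb (src k)) (icat (src k)), tgt = P_dfib (amb (tgt k)) (icat (tgt k)),
         und = \<lparr>TotF = conv_map k, BaseF = slice_map k\<rparr>\<rparr>)\<rparr>"

definition Q_functor ::
    "'u set \<Rightarrow> (('o, 'm) int_obj, ('o, 'm) int_arr,
       'm cell_dfib, ('m cell_dfib, 'm cell_dfib_mor) tagged) functr" where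
  "Q_functor U =
     \<lparr>Fob = (\<lambda>X \<in> Obj (IntCat U). Q_dfib (amb X) (icat X)),
      Far = (\<lambda>k \<in> Arr (IntCat U).
        \<lparr>src = Q_dfib (amb (src k)) (icat (src k)), tgt = Q_dfib (amb (tgt k)) (icat (tgt k)),
         und = \<lparr>TotF = sp_end_map k, BaseF = slice_map k\<rparr>\<rparr>)\<rparr>"

end

theory Submission
  imports Defs
begin

text \<open>
  An object of \<open>SpEnd\<close> is \<open>\<langle>id, \<alpha>\<rangle>\<close> for a 2-cell \<open>\<alpha>\<close> from
  some \<open>diag_span f\<close> to \<open>M\<close>, and \<open>\<alpha>\<close> is recovered from it by a pullback projection. So
  \<open>\<alpha> \<mapsto> \<langle>id, \<alpha>\<rangle>\<close> is a bijection on objects from \<open>Conv\<close> to \<open>SpEnd\<close>. It keeps the source of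
  \<open>\<alpha>\<close>, and \<open>sp_square_iff\<close> shows that a 2-cell between sources is a morphism of \<open>SpEnd\<close>
  exactly if it is one of \<open>Conv\<close>. Hence \<open>Conv\<close> and \<open>SpEnd\<close> are isomorphic over the slice.

  The action of \<open>Q\<close> on arrows is by definition that of \<open>P\<close> conjugated by these isomorphisms
  (\<open>Q_functor_conjugate\<close>). Thus, by \<open>transported_functor\<close>, functoriality of \<open>Q\<close> and naturality
  of the isomorphisms both follow from functoriality of \<open>P\<close>, and only \<open>P\<close> has to be examined
  directly. That \<open>P\<close> takes values in discrete fibrations (\<open>discrete_fibration_Conv\<close>) holds because
  \<open>Conv\<close> consists of the maps into \<open>M\<close> equalized by domain and codomain: the lift of \<open>u\<close>
  with codomain \<open>\<beta>\<close> starts at \<open>\<beta> u\<close>. Its fibres and homs are small since they embed into homs of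
  the ambient category.

  The remaining work is that \<open>IntCat\<close> and \<open>DFib\<close> are categories. For \<open>IntCat\<close> the point is that
  internal functors out of an image internal category compose, although the composition of the image
  involves a comparison between two choices of pullbacks. This comparison is invertible, because a
  finite limit preserving functor preserves pullbacks (\<open>preserves_pullback\<close>), and it cancels
  (\<open>internal_functor_image_iff\<close>); what is left is pasting of commutative squares.
\<close>

section \<open>Elementary laws of categories and functors\<close>

lemma hom_obj:
  assumes "is_category C" "f \<in> hom C a b"
  shows "a \<in> Obj C" "b \<in> Obj C"
  using assms unfolding is_category_def hom_def by auto

lemma hom_arr:
  assumes "f \<in> hom C a b"
  shows "f \<in> Arr C" "Dom C f = a" "Cod C f = b"
  using assms unfolding hom_def by auto

lemma ident_hom: "is_category C \<Longrightarrow> a \<in> Obj C \<Longrightarrow> Ident C a \<in> hom C a a"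
  unfolding is_category_def by auto

lemma comp_hom:
  "is_category C \<Longrightarrow> f \<in> hom C a b \<Longrightarrow> g \<in> hom C b c \<Longrightarrow> g \<cdot>\<^bsub>C\<^esub> f \<in> hom C a c"
  unfolding is_category_def hom_def by auto

lemma comp_ident:
  assumes "is_category C" "f \<in> hom C a b"
  shows "f \<cdot>\<^bsub>C\<^esub> Ident C a = f" "Ident C b \<cdot>\<^bsub>C\<^esub> f = f"
  using assms unfolding is_category_def hom_def by auto

lemma comp_assoc:
  "is_category C \<Longrightarrow> f \<in> hom C a b \<Longrightarrow> g \<in> hom C b c \<Longrightarrow> h \<in> hom C c d
    \<Longrightarrow> (h \<cdot>\<^bsub>C\<^esub> g) \<cdot>\<^bsub>C\<^esub> f = h \<cdot>\<^bsub>C\<^esub> (g \<cdot>\<^bsub>C\<^esub> f)"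
  unfolding is_category_def hom_def by auto

lemma functor_cats:
  assumes "is_functor C D F"
  shows "is_category C" "is_category D"
  using assms unfolding is_functor_def by auto

lemma functor_ob: "is_functor C D F \<Longrightarrow> a \<in> Obj C \<Longrightarrow> Fob F a \<in> Obj D"
  unfolding is_functor_def by auto

lemma functor_arr: "is_functor C D F \<Longrightarrow> f \<in> Arr C \<Longrightarrow> Far F f \<in> Arr D"
  unfolding is_functor_def by auto

lemma functor_hom:
  "is_functor C D F \<Longrightarrow> f \<in> hom C a b \<Longrightarrow> Far F f \<in> hom D (Fob F a) (Fob F b)"
  unfolding is_functor_def hom_def by auto

lemma functor_ident: "is_functor C D F \<Longrightarrow> a \<in> Obj C \<Longrightarrow> Far F (Ident C a) = Ident D (Fob F a)"
  unfolding is_functor_def by auto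

lemma functor_comp:
  "is_functor C D F \<Longrightarrow> f \<in> hom C a b \<Longrightarrow> g \<in> hom C b c
    \<Longrightarrow> Far F (g \<cdot>\<^bsub>C\<^esub> f) = Far F g \<cdot>\<^bsub>D\<^esub> Far F f"
  unfolding is_functor_def hom_def by auto

lemma functor_eqI:
  assumes "is_functor C D F" "is_functor C D G"
    and "\<And>a. a \<in> Obj C \<Longrightarrow> Fob F a = Fob G a"
    and "\<And>f. f \<in> Arr C \<Longrightarrow> Far F f = Far G f"
  shows "F = G"
proof -
  have "Fob F = Fob G" "Far F = Far G"
    using assms unfolding is_functor_def by (auto intro: PiE_ext)
  then show ?thesis by simp
qed

lemma id_functor_apply [simp]:
  "a \<in> Obj C \<Longrightarrow> Fob (id_functor C) a = a"
  "f \<in> Arr C \<Longrightarrow> Far (id_functor C) f = f"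
  by (auto simp: id_functor_def)

lemma comp_functor_apply [simp]:
  "a \<in> Obj C \<Longrightarrow> Fob (comp_functor C G F) a = Fob G (Fob F a)"
  "f \<in> Arr C \<Longrightarrow> Far (comp_functor C G F) f = Far G (Far F f)"
  by (auto simp: comp_functor_def compose_def)

lemma id_functor: "is_category C \<Longrightarrow> is_functor C C (id_functor C)"
  unfolding is_functor_def
  by (auto simp: id_functor_def is_category_def hom_def)

lemma comp_functor:
  assumes F: "is_functor C D F" and G: "is_functor D E G"
  shows "is_functor C E (comp_functor C G F)"
proof -
  have "Fob (comp_functor C G F) \<in> Obj C \<rightarrow>\<^sub>E Obj E" "Far (comp_functor C G F) \<in> Arr C \<rightarrow>\<^sub>E Arr E"
    using F G unfolding is_functor_def comp_functor_def by (auto simp: compose_def)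
  moreover have "\<forall>f\<in>Arr C. Dom E (Far (comp_functor C G F) f) = Fob (comp_functor C G F) (Dom C f)
      \<and> Cod E (Far (comp_functor C G F) f) = Fob (comp_functor C G F) (Cod C f)"
    using F G unfolding is_functor_def is_category_def by (auto dest: PiE_mem)
  moreover have "\<forall>a\<in>Obj C. Far (comp_functor C G F) (Ident C a) = Ident E (Fob (comp_functor C G F) a)"
    using functor_ident[OF F] functor_ident[OF G] functor_ob[OF F]
      hom_arr(1)[OF ident_hom[OF functor_cats(1)[OF F]]] by simp
  moreover have "\<forall>f\<in>Arr C. \<forall>g\<in>Arr C. Dom C g = Cod C f \<longrightarrow>
      Far (comp_functor C G F) (g \<cdot>\<^bsub>C\<^esub> f)
        = Far (comp_functor C G F) g \<cdot>\<^bsub>E\<^esub> Far (comp_functor C G F) f"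
  proof (intro ballI impI)
    fix f g assume "f \<in> Arr C" "g \<in> Arr C" "Dom C g = Cod C f"
    then have f: "f \<in> hom C (Dom C f) (Dom C g)" and g: "g \<in> hom C (Dom C g) (Cod C g)"
      by (auto simp: hom_def)
    show "Far (comp_functor C G F) (g \<cdot>\<^bsub>C\<^esub> f)
        = Far (comp_functor C G F) g \<cdot>\<^bsub>E\<^esub> Far (comp_functor C G F) f"
      using functor_comp[OF F f g] functor_comp[OF G functor_hom[OF F f] functor_hom[OF F g]]
        hom_arr(1)[OF comp_hom[OF functor_cats(1)[OF F] f g]] hom_arr(1)[OF f] hom_arr(1)[OF g]
      by simp
  qed
  ultimately show ?thesis
    using functor_cats[OF F] functor_cats[OF G] unfolding is_functor_def by blast
qed

lemma comp_functor_id: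
  assumes "is_functor C D F"
  shows "comp_functor C F (id_functor C) = F" "comp_functor C (id_functor D) F = F"
proof -
  note C = functor_cats(1)[OF assms] and D = functor_cats(2)[OF assms]
  show "comp_functor C F (id_functor C) = F"
    by (rule functor_eqI[OF comp_functor[OF id_functor[OF C] assms] assms]) auto
  show "comp_functor C (id_functor D) F = F"
    by (rule functor_eqI[OF comp_functor[OF assms id_functor[OF D]] assms])
      (auto simp: functor_ob[OF assms] functor_arr[OF assms])
qed

lemma comp_functor_assoc:
  assumes F: "is_functor C D F" and G: "is_functor D E G" and H: "is_functor E B H"
  shows "comp_functor C (comp_functor D H G) F = comp_functor C H (comp_functor C G F)"
  by (rule functor_eqI[OF comp_functor[OF F comp_functor[OF G H]] comp_functor[OF comp_functor[OF F G] H]])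
    (auto simp: functor_ob[OF F] functor_arr[OF F])

text \<open>
  Transport of structure. In a composite of conjugates the inner isomorphisms cancel, which gives
  functoriality of the conjugated action, and the family is natural by construction.
\<close>

lemma transported_functor:
  assumes F: "is_functor C D F"
    and Fob: "Fob G \<in> extensional (Obj C)" and Far: "Far G \<in> extensional (Arr C)"
    and t: "\<And>a. a \<in> Obj C \<Longrightarrow> t a \<in> hom D (Fob F a) (Fob G a)"
    and s: "\<And>a. a \<in> Obj C \<Longrightarrow> s a \<in> hom D (Fob G a) (Fob F a)"
    and st: "\<And>a. a \<in> Obj C \<Longrightarrow> s a \<cdot>\<^bsub>D\<^esub> t a = Ident D (Fob F a)"
    and ts: "\<And>a. a \<in> Obj C \<Longrightarrow> t a \<cdot>\<^bsub>D\<^esub> s a = Ident D (Fob G a)"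
    and G: "\<And>f. f \<in> Arr C \<Longrightarrow> Far G f = t (Cod C f) \<cdot>\<^bsub>D\<^esub> (Far F f \<cdot>\<^bsub>D\<^esub> s (Dom C f))"
  shows "is_functor C D G" "is_nat_iso C D F G t"
proof -
  note C = functor_cats(1)[OF F] and D = functor_cats(2)[OF F]
  have Ghom: "Far G f \<in> hom D (Fob G a) (Fob G b)" if f: "f \<in> hom C a b" for f a b
    using G[of f] comp_hom[OF D comp_hom[OF D s functor_hom[OF F f]] t] hom_obj[OF C f] hom_arr[OF f]
    by auto
  have Garr: "Far G f \<in> Arr D \<and> Dom D (Far G f) = Fob G (Dom C f) \<and> Cod D (Far G f) = Fob G (Cod C f)"
    if "f \<in> Arr C" for f
    using Ghom[of f "Dom C f" "Cod C f"] that by (auto simp: hom_def)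
  have Gob: "Fob G a \<in> Obj D" if "a \<in> Obj C" for a
    using hom_obj(2)[OF D t[OF that]] .
  have nat: "t b \<cdot>\<^bsub>D\<^esub> Far F f = Far G f \<cdot>\<^bsub>D\<^esub> t a" if f: "f \<in> hom C a b" for f a b
  proof -
    note a = hom_obj(1)[OF C f] and b = hom_obj(2)[OF C f] and Ff = functor_hom[OF F f]
    have "Far G f \<cdot>\<^bsub>D\<^esub> t a = (t b \<cdot>\<^bsub>D\<^esub> (Far F f \<cdot>\<^bsub>D\<^esub> s a)) \<cdot>\<^bsub>D\<^esub> t a"
      using G[of f] hom_arr[OF f] by simp
    also have "\<dots> = t b \<cdot>\<^bsub>D\<^esub> ((Far F f \<cdot>\<^bsub>D\<^esub> s a) \<cdot>\<^bsub>D\<^esub> t a)"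
      by (rule comp_assoc[OF D t[OF a] comp_hom[OF D s[OF a] Ff] t[OF b]])
    also have "(Far F f \<cdot>\<^bsub>D\<^esub> s a) \<cdot>\<^bsub>D\<^esub> t a = Far F f"
      using comp_assoc[OF D t[OF a] s[OF a] Ff] st[OF a] comp_ident(1)[OF D Ff] by simp
    finally show ?thesis by simp
  qed
  have Gid: "Far G (Ident C a) = Ident D (Fob G a)" if a: "a \<in> Obj C" for a
  proof -
    note i = ident_hom[OF C a]
    show ?thesis
      using G[OF hom_arr(1)[OF i]] hom_arr[OF i] functor_ident[OF F a] comp_ident(2)[OF D s[OF a]] ts[OF a]
      by simp
  qed
  have Gcomp: "Far G (g \<cdot>\<^bsub>C\<^esub> f) = Far G g \<cdot>\<^bsub>D\<^esub> Far G f" if f: "f \<in> hom C a b" and g: "g \<in> hom C b c" for f g a b c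
  proof -
    note a = hom_obj(1)[OF C f] and b = hom_obj(2)[OF C f] and c = hom_obj(2)[OF C g]
      and Ff = functor_hom[OF F f] and Fg = functor_hom[OF F g] and gf = comp_hom[OF C f g]
    have "Far G g \<cdot>\<^bsub>D\<^esub> Far G f = Far G g \<cdot>\<^bsub>D\<^esub> (t b \<cdot>\<^bsub>D\<^esub> (Far F f \<cdot>\<^bsub>D\<^esub> s a))"
      using G[of f] hom_arr[OF f] by simp
    also have "\<dots> = (Far G g \<cdot>\<^bsub>D\<^esub> t b) \<cdot>\<^bsub>D\<^esub> (Far F f \<cdot>\<^bsub>D\<^esub> s a)"
      by (rule comp_assoc[OF D comp_hom[OF D s[OF a] Ff] t[OF b] Ghom[OF g], symmetric])
    also have "\<dots> = (t c \<cdot>\<^bsub>D\<^esub> Far F g) \<cdot>\<^bsub>D\<^esub> (Far F f \<cdot>\<^bsub>D\<^esub> s a)"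
      by (simp add: nat[OF g])
    also have "\<dots> = t c \<cdot>\<^bsub>D\<^esub> (Far F g \<cdot>\<^bsub>D\<^esub> (Far F f \<cdot>\<^bsub>D\<^esub> s a))"
      by (rule comp_assoc[OF D comp_hom[OF D s[OF a] Ff] Fg t[OF c]])
    also have "\<dots> = t c \<cdot>\<^bsub>D\<^esub> (Far F (g \<cdot>\<^bsub>C\<^esub> f) \<cdot>\<^bsub>D\<^esub> s a)"
      by (simp add: functor_comp[OF F f g] comp_assoc[OF D s[OF a] Ff Fg])
    also have "\<dots> = Far G (g \<cdot>\<^bsub>C\<^esub> f)"
      using G[of "g \<cdot>\<^bsub>C\<^esub> f"] hom_arr[OF gf] by simp
    finally show ?thesis by simp
  qed
  show GF: "is_functor C D G"
    unfolding is_functor_def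
  proof (intro conjI ballI impI)
    show "Fob G \<in> Obj C \<rightarrow>\<^sub>E Obj D" "Far G \<in> Arr C \<rightarrow>\<^sub>E Arr D"
      using Fob Far Gob Garr by (auto simp: PiE_def)
    fix f g assume "f \<in> Arr C" "g \<in> Arr C" "Dom C g = Cod C f"
    then show "Far G (g \<cdot>\<^bsub>C\<^esub> f) = Far G g \<cdot>\<^bsub>D\<^esub> Far G f"
      by (intro Gcomp) (auto simp: hom_def)
  qed (use C D Garr Gid in auto)
  show "is_nat_iso C D F G t"
    unfolding is_nat_iso_def is_iso_def
  proof (intro conjI ballI)
    fix a assume a: "a \<in> Obj C"
    show "\<exists>g\<in>hom D (Cod D (t a)) (Dom D (t a)). g \<cdot>\<^bsub>D\<^esub> t a = Ident D (Dom D (t a))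
        \<and> t a \<cdot>\<^bsub>D\<^esub> g = Ident D (Cod D (t a))"
      using s[OF a] st[OF a] ts[OF a] hom_arr[OF t[OF a]] by auto
  next
    fix f assume "f \<in> Arr C"
    then show "t (Cod C f) \<cdot>\<^bsub>D\<^esub> Far F f = Far G f \<cdot>\<^bsub>D\<^esub> t (Dom C f)"
      by (intro nat) (auto simp: hom_def)
  qed (use F GF t hom_arr(1)[OF t] in auto)
qed

section \<open>Categories of tagged arrows\<close>

lemma tagged_category_simps [simp]:
  "Obj (tagged_category A H i k) = A"
  "t \<in> Arr (tagged_category A H i k) \<longleftrightarrow> src t \<in> A \<and> tgt t \<in> A \<and> und t \<in> H (src t) (tgt t)"
  "Dom (tagged_category A H i k) = src"
  "Cod (tagged_category A H i k) = tgt"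
  "Ident (tagged_category A H i k) a = \<lparr>src = a, tgt = a, und = i a\<rparr>"
  "t \<cdot>\<^bsub>tagged_category A H i k\<^esub> s
     = \<lparr>src = src s, tgt = tgt t, und = k (src s) (tgt t) (und t) (und s)\<rparr>"
  by (auto simp: tagged_category_def)

lemma tagged_eqI: "src t = src s \<Longrightarrow> tgt t = tgt s \<Longrightarrow> und t = und s \<Longrightarrow> t = (s :: ('x, 'y) tagged)"
  by simp

lemma in_hom_tagged [simp]:
  "t \<in> hom (tagged_category A H i k) a b \<longleftrightarrow>
     a \<in> A \<and> b \<in> A \<and> src t = a \<and> tgt t = b \<and> und t \<in> H a b"
  by (auto simp: hom_def)

lemma tagged_category:
  assumes "\<And>a. a \<in> A \<Longrightarrow> i a \<in> H a a"
    and "\<And>a b c u v. a \<in> A \<Longrightarrow> b \<in> A \<Longrightarrow> c \<in> A \<Longrightarrow> u \<in> H a b \<Longrightarrow> v \<in> H b c \<Longrightarrow> k a c v u \<in> H a c"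
    and "\<And>a b u. a \<in> A \<Longrightarrow> b \<in> A \<Longrightarrow> u \<in> H a b \<Longrightarrow> k a b u (i a) = u"
    and "\<And>a b u. a \<in> A \<Longrightarrow> b \<in> A \<Longrightarrow> u \<in> H a b \<Longrightarrow> k a b (i b) u = u"
    and "\<And>a b c d u v w. a \<in> A \<Longrightarrow> b \<in> A \<Longrightarrow> c \<in> A \<Longrightarrow> d \<in> A \<Longrightarrow> u \<in> H a b \<Longrightarrow> v \<in> H b c \<Longrightarrow> w \<in> H c d
      \<Longrightarrow> k a d (k b d w v) u = k a d w (k a c v u)"
  shows "is_category (tagged_category A H i k)"
  unfolding is_category_def using assms by (auto simp: hom_def)

text \<open>
  The functors between tagged categories met below all have this form, so that each of them is
  known to be a functor once its action on the data is seen to respect identities and composition.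
\<close>

definition tagged_functor ::
    "('x, ('x, 'y) tagged) category \<Rightarrow> ('x \<Rightarrow> 'z) \<Rightarrow> (('x, 'y) tagged \<Rightarrow> 'w)
      \<Rightarrow> ('x, ('x, 'y) tagged, 'z, ('z, 'w) tagged) functr" where
  "tagged_functor E f m =
     \<lparr>Fob = (\<lambda>a \<in> Obj E. f a),
      Far = (\<lambda>t \<in> Arr E. \<lparr>src = f (src t), tgt = f (tgt t), und = m t\<rparr>)\<rparr>"

lemma tagged_functor_apply [simp]:
  "a \<in> Obj E \<Longrightarrow> Fob (tagged_functor E f m) a = f a"
  "t \<in> Arr E \<Longrightarrow> Far (tagged_functor E f m) t = \<lparr>src = f (src t), tgt = f (tgt t), und = m t\<rparr>"
  by (auto simp: tagged_functor_def)

lemma tagged_functor: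
  assumes C: "C = tagged_category A H i k" and D: "D = tagged_category A' H' i' k'"
    and "is_category C" "is_category D"
    and "\<And>a. a \<in> A \<Longrightarrow> f a \<in> A'"
    and "\<And>a b u. a \<in> A \<Longrightarrow> b \<in> A \<Longrightarrow> u \<in> H a b \<Longrightarrow> m \<lparr>src = a, tgt = b, und = u\<rparr> \<in> H' (f a) (f b)"
    and "\<And>a. a \<in> A \<Longrightarrow> m \<lparr>src = a, tgt = a, und = i a\<rparr> = i' (f a)"
    and "\<And>a b c u v. a \<in> A \<Longrightarrow> b \<in> A \<Longrightarrow> c \<in> A \<Longrightarrow> u \<in> H a b \<Longrightarrow> v \<in> H b c
      \<Longrightarrow> m \<lparr>src = a, tgt = c, und = k a c v u\<rparr>
        = k' (f a) (f c) (m \<lparr>src = b, tgt = c, und = v\<rparr>) (m \<lparr>src = a, tgt = b, und = u\<rparr>)"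
  shows "is_functor C D (tagged_functor C f m)"
proof -
  have m: "m t \<in> H' (f (src t)) (f (tgt t))" if "src t \<in> A" "tgt t \<in> A" "und t \<in> H (src t) (tgt t)" for t
    using assms(6)[OF that] by (cases t) simp
  have 1: "Fob (tagged_functor C f m) \<in> Obj C \<rightarrow>\<^sub>E Obj D"
    using assms(5) by (auto simp: tagged_functor_def C D)
  have 2: "Far (tagged_functor C f m) \<in> Arr C \<rightarrow>\<^sub>E Arr D"
    using assms(5) m unfolding tagged_functor_def C D by auto
  have 3: "\<forall>a\<in>Obj C. Far (tagged_functor C f m) (Ident C a) = Ident D (Fob (tagged_functor C f m) a)"
    using assms(5,7) hom_arr(1)[OF ident_hom[OF assms(3)]] by (simp add: C D)
  have 4: "\<forall>t\<in>Arr C. \<forall>s\<in>Arr C. Dom C s = Cod C t \<longrightarrow>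
      Far (tagged_functor C f m) (s \<cdot>\<^bsub>C\<^esub> t) = Far (tagged_functor C f m) s \<cdot>\<^bsub>D\<^esub> Far (tagged_functor C f m) t"
  proof (intro ballI impI)
    fix t s assume ts: "t \<in> Arr C" "s \<in> Arr C" "Dom C s = Cod C t"
    have "s \<cdot>\<^bsub>C\<^esub> t \<in> Arr C"
      using comp_hom[OF assms(3), of t "src t" "tgt t" s "tgt s"] ts by (auto simp: C hom_def)
    then have "Far (tagged_functor C f m) (s \<cdot>\<^bsub>C\<^esub> t)
        = \<lparr>src = f (src t), tgt = f (tgt s), und = m \<lparr>src = src t, tgt = tgt s, und = k (src t) (tgt s) (und s) (und t)\<rparr>\<rparr>"
      by (simp add: C)
    also have "m \<lparr>src = src t, tgt = tgt s, und = k (src t) (tgt s) (und s) (und t)\<rparr>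
        = k' (f (src t)) (f (tgt s)) (m \<lparr>src = tgt t, tgt = tgt s, und = und s\<rparr>) (m \<lparr>src = src t, tgt = tgt t, und = und t\<rparr>)"
      using ts by (intro assms(8)) (auto simp: C)
    also have "\<lparr>src = tgt t, tgt = tgt s, und = und s\<rparr> = s"
      using ts by (auto simp: C intro: tagged_eqI)
    also have "\<lparr>src = src t, tgt = tgt t, und = und t\<rparr> = t"
      by (cases t) simp
    finally show "Far (tagged_functor C f m) (s \<cdot>\<^bsub>C\<^esub> t) = Far (tagged_functor C f m) s \<cdot>\<^bsub>D\<^esub> Far (tagged_functor C f m) t"
      using ts by (simp add: D)
  qed
  show ?thesis
    unfolding is_functor_def using assms(3,4) 1 2 3 4 by (simp add: C D)
qed

section \<open>Pullbacks as finite limits\<close>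

text \<open>
  The shape \<open>0 \<rightarrow> 2 \<leftarrow> 1\<close>, with identities \<open>0, 1, 2\<close> and legs \<open>3, 4\<close>. Every
  composable pair contains an identity, and identities have smaller numbers than legs, so the maximum
  is the composite.
\<close>

definition cospan :: "(nat, nat) category" where
  "cospan =
     \<lparr>Obj = {0, 1, 2}, Arr = {0, 1, 2, 3, 4},
      Dom = (\<lambda>n. if n = 3 then 0 else if n = 4 then 1 else n),
      Cod = (\<lambda>n. if n = 3 \<or> n = 4 then 2 else n),
      Ident = (\<lambda>n. n), Comp = max\<rparr>"

definition cospan_diagram :: "('o, 'm) category \<Rightarrow> 'm \<Rightarrow> 'm \<Rightarrow> (nat, nat, 'o, 'm) functr" where
  "cospan_diagram C f g =
     \<lparr>Fob = (\<lambda>j \<in> {0, 1, 2}. if j = 0 then Dom C f else if j = 1 then Dom C g else Cod C f),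
      Far = (\<lambda>j \<in> {0, 1, 2, 3, 4}. if j = 3 then f else if j = 4 then g
        else Ident C (if j = 0 then Dom C f else if j = 1 then Dom C g else Cod C f))\<rparr>"

lemma finite_category_cospan: "finite_category cospan"
  unfolding finite_category_def is_category_def hom_def cospan_def by auto

lemma cospan_diagram_functor:
  assumes C: "is_category C" and f: "f \<in> hom C a c" and g: "g \<in> hom C b c"
  shows "is_functor cospan C (cospan_diagram C f g)"
proof -
  note ident = ident_hom[OF C hom_obj(1)[OF C f]] ident_hom[OF C hom_obj(1)[OF C g]]
    ident_hom[OF C hom_obj(2)[OF C f]]
  note laws = comp_ident[OF C f] comp_ident[OF C g] comp_ident(1)[OF C ident(1)]
    comp_ident(1)[OF C ident(2)] comp_ident(1)[OF C ident(3)]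
  show ?thesis
    using finite_category_cospan C hom_obj[OF C f] hom_obj[OF C g] hom_arr[OF f] hom_arr[OF g] laws
      hom_arr[OF ident(1)] hom_arr[OF ident(2)] hom_arr[OF ident(3)]
    unfolding is_functor_def finite_category_def
    by (auto simp: cospan_def cospan_diagram_def)
qed

lemma is_cone_cospan:
  assumes C: "is_category C" and f: "f \<in> hom C a c" and g: "g \<in> hom C b c"
  shows "is_cone cospan C (cospan_diagram C f g) x \<gamma> \<longleftrightarrow>
    \<gamma> 0 \<in> hom C x a \<and> \<gamma> 1 \<in> hom C x b \<and> \<gamma> 2 = f \<cdot>\<^bsub>C\<^esub> \<gamma> 0 \<and> f \<cdot>\<^bsub>C\<^esub> \<gamma> 0 = g \<cdot>\<^bsub>C\<^esub> \<gamma> 1"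
proof -
  have "is_cone cospan C (cospan_diagram C f g) x \<gamma> \<longleftrightarrow>
      x \<in> Obj C \<and> \<gamma> 0 \<in> hom C x a \<and> \<gamma> 1 \<in> hom C x b \<and> \<gamma> 2 \<in> hom C x c
      \<and> Ident C a \<cdot>\<^bsub>C\<^esub> \<gamma> 0 = \<gamma> 0 \<and> Ident C b \<cdot>\<^bsub>C\<^esub> \<gamma> 1 = \<gamma> 1 \<and> Ident C c \<cdot>\<^bsub>C\<^esub> \<gamma> 2 = \<gamma> 2
      \<and> f \<cdot>\<^bsub>C\<^esub> \<gamma> 0 = \<gamma> 2 \<and> g \<cdot>\<^bsub>C\<^esub> \<gamma> 1 = \<gamma> 2"
    unfolding is_cone_def using hom_arr[OF f] hom_arr[OF g]
    by (auto simp: cospan_def cospan_diagram_def)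
  then show ?thesis
    using comp_ident(2)[OF C] comp_hom[OF C _ f] comp_hom[OF C _ g] hom_obj(1)[OF C] by metis
qed

lemma pullback_ex1:
  assumes "is_pullback C f g p q" "u \<in> hom C x (Dom C f)" "v \<in> hom C x (Dom C g)"
    "f \<cdot>\<^bsub>C\<^esub> u = g \<cdot>\<^bsub>C\<^esub> v"
  shows "\<exists>!t. t \<in> hom C x (Dom C p) \<and> p \<cdot>\<^bsub>C\<^esub> t = u \<and> q \<cdot>\<^bsub>C\<^esub> t = v"
proof -
  have "\<And>u v. u \<in> Arr C \<Longrightarrow> v \<in> Arr C \<Longrightarrow> Dom C u = Dom C v \<Longrightarrow> Cod C u = Dom C f \<Longrightarrow> Cod C v = Dom C g
      \<Longrightarrow> f \<cdot>\<^bsub>C\<^esub> u = g \<cdot>\<^bsub>C\<^esub> v \<Longrightarrow> \<exists>!t. t \<in> hom C (Dom C u) (Dom C p) \<and> p \<cdot>\<^bsub>C\<^esub> t = u \<and> q \<cdot>\<^bsub>C\<^esub> t = v"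
    using assms(1) unfolding is_pullback_def by blast
  from this[of u v] show ?thesis
    using hom_arr[OF assms(2)] hom_arr[OF assms(3)] assms(4) by simp
qed

text \<open>
  A limit cone over a cospan has a third leg, to the vertex \<open>2\<close>, which is forced to be the diagonal
  of the square; forgetting it turns limits into pullbacks.
\<close>

lemma is_limit_cospan:
  assumes C: "is_category C" and f: "f \<in> hom C a c" and g: "g \<in> hom C b c"
  shows "is_limit cospan C (cospan_diagram C f g) x \<gamma> \<longleftrightarrow>
    is_pullback C f g (\<gamma> 0) (\<gamma> 1) \<and> x = Dom C (\<gamma> 0) \<and> \<gamma> 2 = f \<cdot>\<^bsub>C\<^esub> \<gamma> 0"
    (is "?L \<longleftrightarrow> ?R")
proof -
  note cone = is_cone_cospan[OF C f g]
  have leg2: "(\<forall>j\<in>Obj cospan. \<gamma> j \<cdot>\<^bsub>C\<^esub> t = \<delta> j) \<longleftrightarrow> \<gamma> 0 \<cdot>\<^bsub>C\<^esub> t = \<delta> 0 \<and> \<gamma> 1 \<cdot>\<^bsub>C\<^esub> t = \<delta> 1"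
    if \<gamma>: "is_cone cospan C (cospan_diagram C f g) y \<gamma>"
      and \<delta>: "is_cone cospan C (cospan_diagram C f g) z \<delta>" and t: "t \<in> hom C z y" for y z t \<delta>
  proof -
    have "\<gamma> 0 \<in> hom C y a" "\<gamma> 2 = f \<cdot>\<^bsub>C\<^esub> \<gamma> 0"
      using \<gamma> unfolding cone by blast+
    then have "\<gamma> 2 \<cdot>\<^bsub>C\<^esub> t = f \<cdot>\<^bsub>C\<^esub> (\<gamma> 0 \<cdot>\<^bsub>C\<^esub> t)"
      using comp_assoc[OF C t _ f] by simp
    then show ?thesis
      using \<delta> cone by (auto simp: cospan_def)
  qed
  show ?thesis
  proof
    assume L: ?L
    then have \<gamma>: "is_cone cospan C (cospan_diagram C f g) x \<gamma>"
      unfolding is_limit_def by blast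
    have "\<exists>!t. t \<in> hom C (Dom C u) (Dom C (\<gamma> 0)) \<and> \<gamma> 0 \<cdot>\<^bsub>C\<^esub> t = u \<and> \<gamma> 1 \<cdot>\<^bsub>C\<^esub> t = v"
      if uv: "u \<in> Arr C" "v \<in> Arr C" "Dom C u = Dom C v" "Cod C u = Dom C f" "Cod C v = Dom C g"
        "f \<cdot>\<^bsub>C\<^esub> u = g \<cdot>\<^bsub>C\<^esub> v" for u v
    proof -
      define \<delta> where "\<delta> j = (if j = 0 then u else if j = 1 then v else f \<cdot>\<^bsub>C\<^esub> u)" for j :: nat
      have \<delta>: "is_cone cospan C (cospan_diagram C f g) (Dom C u) \<delta>"
        using uv hom_arr[OF f] hom_arr[OF g] unfolding cone by (auto simp: \<delta>_def hom_def)
      then have "\<exists>!t. t \<in> hom C (Dom C u) x \<and> (\<forall>j\<in>Obj cospan. \<gamma> j \<cdot>\<^bsub>C\<^esub> t = \<delta> j)"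
        using L unfolding is_limit_def by blast
      moreover have \<delta>01: "\<delta> 0 = u" "\<delta> 1 = v" and x: "Dom C (\<gamma> 0) = x"
        using \<gamma> unfolding cone by (auto simp: \<delta>_def hom_def)
      have "t \<in> hom C (Dom C u) x \<and> (\<forall>j\<in>Obj cospan. \<gamma> j \<cdot>\<^bsub>C\<^esub> t = \<delta> j) \<longleftrightarrow>
          t \<in> hom C (Dom C u) (Dom C (\<gamma> 0)) \<and> \<gamma> 0 \<cdot>\<^bsub>C\<^esub> t = u \<and> \<gamma> 1 \<cdot>\<^bsub>C\<^esub> t = v" for t
        using leg2[OF \<gamma> \<delta>, of t] unfolding x \<delta>01 by blast
      ultimately show ?thesis by simp
    qed
    then show ?R
      using \<gamma> hom_arr[OF f] hom_arr[OF g] unfolding cone is_pullback_def by (auto simp: hom_def)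
  next
    assume R: ?R
    then have \<gamma>: "is_cone cospan C (cospan_diagram C f g) x \<gamma>"
      unfolding cone is_pullback_def using hom_arr[OF f] hom_arr[OF g] by (auto simp: hom_def)
    have "\<exists>!t. t \<in> hom C z x \<and> (\<forall>j\<in>Obj cospan. \<gamma> j \<cdot>\<^bsub>C\<^esub> t = \<delta> j)"
      if \<delta>: "is_cone cospan C (cospan_diagram C f g) z \<delta>" for z \<delta>
    proof -
      have "\<exists>!t. t \<in> hom C z (Dom C (\<gamma> 0)) \<and> \<gamma> 0 \<cdot>\<^bsub>C\<^esub> t = \<delta> 0 \<and> \<gamma> 1 \<cdot>\<^bsub>C\<^esub> t = \<delta> 1"
        using R \<delta> hom_arr[OF f] hom_arr[OF g] unfolding cone by (intro pullback_ex1) auto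
      moreover have x: "Dom C (\<gamma> 0) = x"
        using R by simp
      have "t \<in> hom C z x \<and> (\<forall>j\<in>Obj cospan. \<gamma> j \<cdot>\<^bsub>C\<^esub> t = \<delta> j) \<longleftrightarrow>
          t \<in> hom C z (Dom C (\<gamma> 0)) \<and> \<gamma> 0 \<cdot>\<^bsub>C\<^esub> t = \<delta> 0 \<and> \<gamma> 1 \<cdot>\<^bsub>C\<^esub> t = \<delta> 1" for t
        using leg2[OF \<gamma> \<delta>, of t] unfolding x by blast
      ultimately show ?thesis by simp
    qed
    then show ?L
      using \<gamma> unfolding is_limit_def by blast
  qed
qed

lemma pr_pullback:
  assumes fc: "finitely_complete C" and f: "f \<in> hom C a c" and g: "g \<in> hom C b c"
  shows "is_pullback C f g (pr1 C f g) (pr2 C f g)"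
proof -
  have C: "is_category C"
    using fc unfolding finitely_complete_def by blast
  obtain x \<gamma> where "is_limit cospan C (cospan_diagram C f g) x \<gamma>"
    using fc finite_category_cospan cospan_diagram_functor[OF C f g]
    unfolding finitely_complete_def by blast
  then have "is_pullback C f g (fst (\<gamma> 0, \<gamma> 1)) (snd (\<gamma> 0, \<gamma> 1))"
    unfolding is_limit_cospan[OF C f g] by simp
  then show ?thesis
    unfolding pr1_def pr2_def pb_def by (rule someI)
qed

lemma preserves_pullback:
  assumes K: "is_functor C D K" and pres: "preserves_finite_limits C D K"
    and pb: "is_pullback C f g p q"
  shows "is_pullback D (Far K f) (Far K g) (Far K p) (Far K q)"
proof -
  note C = functor_cats(1)[OF K] and D = functor_cats(2)[OF K]
  have f: "f \<in> hom C (Dom C f) (Cod C f)" and g: "g \<in> hom C (Dom C g) (Cod C f)"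
    using pb unfolding is_pullback_def hom_def by auto
  note Kf = functor_hom[OF K f] and Kg = functor_hom[OF K g]
  define \<gamma> where "\<gamma> j = (if j = 0 then p else if j = 1 then q else f \<cdot>\<^bsub>C\<^esub> p)" for j :: nat
  have "is_limit cospan C (cospan_diagram C f g) (Dom C p) \<gamma>"
    unfolding is_limit_cospan[OF C f g] using pb by (simp add: \<gamma>_def)
  then have "is_limit cospan D (comp_functor cospan K (cospan_diagram C f g)) (Fob K (Dom C p)) (\<lambda>j. Far K (\<gamma> j))"
    using pres finite_category_cospan cospan_diagram_functor[OF C f g]
    unfolding preserves_finite_limits_def by blast
  moreover have "comp_functor cospan K (cospan_diagram C f g) = cospan_diagram D (Far K f) (Far K g)"
  proof (rule functor_eqI[OF comp_functor[OF cospan_diagram_functor[OF C f g] K] cospan_diagram_functor[OF D Kf Kg]])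
    fix j assume "j \<in> Obj cospan"
    then show "Fob (comp_functor cospan K (cospan_diagram C f g)) j = Fob (cospan_diagram D (Far K f) (Far K g)) j"
      using hom_arr[OF Kf] hom_arr[OF Kg] by (auto simp: cospan_def cospan_diagram_def)
  next
    fix j assume "j \<in> Arr cospan"
    then show "Far (comp_functor cospan K (cospan_diagram C f g)) j = Far (cospan_diagram D (Far K f) (Far K g)) j"
      using hom_arr[OF Kf] hom_arr[OF Kg] hom_obj[OF C f] hom_obj[OF C g]
      by (auto simp: cospan_def cospan_diagram_def functor_ident[OF K])
  qed
  ultimately show ?thesis
    by (simp add: is_limit_cospan[OF D Kf Kg] \<gamma>_def)
qed

lemma pullback_homs:
  assumes "is_pullback C f g p q"
  shows "p \<in> hom C (Dom C p) (Dom C f)" "q \<in> hom C (Dom C p) (Dom C g)" "f \<cdot>\<^bsub>C\<^esub> p = g \<cdot>\<^bsub>C\<^esub> q"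
    "f \<in> hom C (Dom C f) (Cod C f)" "g \<in> hom C (Dom C g) (Cod C f)"
  using assms unfolding is_pullback_def hom_def by auto

lemma pullback_lift:
  assumes pb: "is_pullback C f g p q" and u: "u \<in> hom C x (Dom C f)" and v: "v \<in> hom C x (Dom C g)"
    and eq: "f \<cdot>\<^bsub>C\<^esub> u = g \<cdot>\<^bsub>C\<^esub> v"
  shows "lift C p q u v \<in> hom C x (Dom C p)" "p \<cdot>\<^bsub>C\<^esub> lift C p q u v = u" "q \<cdot>\<^bsub>C\<^esub> lift C p q u v = v"
proof -
  from theI'[OF pullback_ex1[OF assms]] show "lift C p q u v \<in> hom C x (Dom C p)" "p \<cdot>\<^bsub>C\<^esub> lift C p q u v = u" "q \<cdot>\<^bsub>C\<^esub> lift C p q u v = v"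
    using hom_arr[OF u] unfolding lift_def by auto
qed

lemma pullback_eqI:
  assumes C: "is_category C" and pb: "is_pullback C f g p q"
    and s: "s \<in> hom C x (Dom C p)" and t: "t \<in> hom C x (Dom C p)"
    and eq: "p \<cdot>\<^bsub>C\<^esub> s = p \<cdot>\<^bsub>C\<^esub> t" "q \<cdot>\<^bsub>C\<^esub> s = q \<cdot>\<^bsub>C\<^esub> t"
  shows "s = t"
proof -
  note h = pullback_homs[OF pb]
  have pt: "p \<cdot>\<^bsub>C\<^esub> t \<in> hom C x (Dom C f)" and qt: "q \<cdot>\<^bsub>C\<^esub> t \<in> hom C x (Dom C g)"
    using comp_hom[OF C t] h by auto
  have "f \<cdot>\<^bsub>C\<^esub> (p \<cdot>\<^bsub>C\<^esub> t) = g \<cdot>\<^bsub>C\<^esub> (q \<cdot>\<^bsub>C\<^esub> t)"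
    using comp_assoc[OF C t h(1,4)] comp_assoc[OF C t h(2,5)] h(3) by simp
  from pullback_ex1[OF pb pt qt this] show ?thesis
    using s t eq by blast
qed

lemma lift_comp:
  assumes C: "is_category C" and pb: "is_pullback C f g p q"
    and u: "u \<in> hom C x (Dom C f)" and v: "v \<in> hom C x (Dom C g)" and eq: "f \<cdot>\<^bsub>C\<^esub> u = g \<cdot>\<^bsub>C\<^esub> v"
    and t: "t \<in> hom C y x"
  shows "lift C p q u v \<cdot>\<^bsub>C\<^esub> t = lift C p q (u \<cdot>\<^bsub>C\<^esub> t) (v \<cdot>\<^bsub>C\<^esub> t)"
proof -
  note h = pullback_homs[OF pb] and l = pullback_lift[OF pb u v eq]
  have ut: "u \<cdot>\<^bsub>C\<^esub> t \<in> hom C y (Dom C f)" and vt: "v \<cdot>\<^bsub>C\<^esub> t \<in> hom C y (Dom C g)"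
    using comp_hom[OF C t] u v by auto
  have "f \<cdot>\<^bsub>C\<^esub> (u \<cdot>\<^bsub>C\<^esub> t) = g \<cdot>\<^bsub>C\<^esub> (v \<cdot>\<^bsub>C\<^esub> t)"
    using comp_assoc[OF C t u h(4)] comp_assoc[OF C t v h(5)] eq by simp
  note l' = pullback_lift[OF pb ut vt this]
  show ?thesis
    by (rule pullback_eqI[OF C pb comp_hom[OF C t l(1)] l'(1)])
      (use comp_assoc[OF C t l(1) h(1)] comp_assoc[OF C t l(1) h(2)] l l' in simp_all)
qed

section \<open>The category of internal categories\<close>

lemma internal_category_homs:
  assumes fc: "finitely_complete C" and M: "internal_category C M"
  shows "idom M \<in> hom C (imor M) (iobj M)" "icod M \<in> hom C (imor M) (iobj M)"
    "iunit M \<in> hom C (iobj M) (imor M)"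
    "imult M \<in> hom C (Dom C (pr1 C (icod M) (idom M))) (imor M)"
    "iobj M \<in> Obj C" "imor M \<in> Obj C"
proof -
  have C: "is_category C"
    using fc unfolding finitely_complete_def by blast
  show d: "idom M \<in> hom C (imor M) (iobj M)" and c: "icod M \<in> hom C (imor M) (iobj M)"
    and o: "iobj M \<in> Obj C" and "imor M \<in> Obj C"
    using M unfolding internal_category_def by auto
  note pb = pr_pullback[OF fc c d]
  have "pr1 C (icod M) (idom M) \<in> hom C (Dom C (pr1 C (icod M) (idom M))) (imor M)"
    using pullback_homs(1)[OF pb] hom_arr[OF c] by simp
  note dp = comp_hom[OF C this d]
  show "iunit M \<in> hom C (iobj M) (imor M)"
    "imult M \<in> hom C (Dom C (pr1 C (icod M) (idom M))) (imor M)"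
    using M hom_arr[OF ident_hom[OF C o]] hom_arr[OF d] hom_arr[OF dp]
    unfolding internal_category_def is_monoid_def Let_def SpanCat_def
    by (auto simp: unit_span_def ispan_def tensor_def)
qed

lemma split_epi_cancel:
  assumes C: "is_category C" and j: "j \<in> hom C x y" and j': "j' \<in> hom C y x"
    and jj': "j \<cdot>\<^bsub>C\<^esub> j' = Ident C y" and s: "s \<in> hom C y z" and t: "t \<in> hom C y z"
    and eq: "s \<cdot>\<^bsub>C\<^esub> j = t \<cdot>\<^bsub>C\<^esub> j"
  shows "s = t"
proof -
  have "s \<cdot>\<^bsub>C\<^esub> (j \<cdot>\<^bsub>C\<^esub> j') = t \<cdot>\<^bsub>C\<^esub> (j \<cdot>\<^bsub>C\<^esub> j')"
    unfolding comp_assoc[OF C j' j s, symmetric] comp_assoc[OF C j' j t, symmetric] eq ..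
  then show ?thesis
    unfolding jj' comp_ident(1)[OF C s] comp_ident(1)[OF C t] .
qed

text \<open>
  The comparison isomorphism in the composition of the image internal category can be cancelled:
  compatibility with composition may be tested on the image of the chosen pullback instead of the
  chosen pullback of the images. In this form the condition is visibly stable under composition.
\<close>

lemma internal_functor_image_iff:
  assumes fc: "finitely_complete C" and fc': "finitely_complete C'"
    and K: "is_functor C C' K" and pres: "preserves_finite_limits C C' K"
    and M: "internal_category C M" and M': "internal_category C' M'"
  shows "internal_functor C' (image_icat C C' K M) M' Fo Fm \<longleftrightarrow>
     Fo \<in> hom C' (Fob K (iobj M)) (iobj M') \<and> Fm \<in> hom C' (Fob K (imor M)) (imor M') \<and>
     idom M' \<cdot>\<^bsub>C'\<^esub> Fm = Fo \<cdot>\<^bsub>C'\<^esub> Far K (idom M) \<and> icod M' \<cdot>\<^bsub>C'\<^esub> Fm = Fo \<cdot>\<^bsub>C'\<^esub> Far K (icod M) \<and>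
     Fm \<cdot>\<^bsub>C'\<^esub> Far K (iunit M) = iunit M' \<cdot>\<^bsub>C'\<^esub> Fo \<and>
     Fm \<cdot>\<^bsub>C'\<^esub> Far K (imult M) = imult M' \<cdot>\<^bsub>C'\<^esub>
       pb_pair C' (icod M') (idom M')
         (Fm \<cdot>\<^bsub>C'\<^esub> Far K (pr1 C (icod M) (idom M))) (Fm \<cdot>\<^bsub>C'\<^esub> Far K (pr2 C (icod M) (idom M)))"
proof -
  note C = functor_cats(1)[OF K] and C' = functor_cats(2)[OF K]
  note m = internal_category_homs[OF fc M] and m' = internal_category_homs[OF fc' M']
  let ?p = "Far K (pr1 C (icod M) (idom M))" and ?q = "Far K (pr2 C (icod M) (idom M))"
  let ?p' = "pr1 C' (Far K (icod M)) (Far K (idom M))" and ?q' = "pr2 C' (Far K (icod M)) (Far K (idom M))"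
  \<comment> \<open>the comparison of the chosen pullback with the image of the chosen pullback, and its inverse\<close>
  let ?j = "lift C' ?p ?q ?p' ?q'" and ?j' = "lift C' ?p' ?q' ?p ?q"
  note Kd = functor_hom[OF K m(1)] and Kc = functor_hom[OF K m(2)] and Km = functor_hom[OF K m(4)]
  note pb = preserves_pullback[OF K pres pr_pullback[OF fc m(2,1)]]
  note pb' = pr_pullback[OF fc' Kc Kd]
  note pbM' = pr_pullback[OF fc' m'(2,1)]
  have dom: "Dom C' ?p = Fob K (Dom C (pr1 C (icod M) (idom M)))"
    using hom_arr[OF functor_hom[OF K pullback_homs(1)[OF pr_pullback[OF fc m(2,1)]]]] by simp
  note h = pullback_homs(1-3)[OF pb, unfolded hom_arr[OF Kc] hom_arr[OF Kd]]
  note j = pullback_lift[OF pb pullback_homs(1-3)[OF pb']]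
    and j' = pullback_lift[OF pb' pullback_homs(1-3)[OF pb]]
  have jj': "?j \<cdot>\<^bsub>C'\<^esub> ?j' = Ident C' (Dom C' ?p)"
  proof (rule pullback_eqI[OF C' pb comp_hom[OF C' j'(1) j(1)]])
    show "Ident C' (Dom C' ?p) \<in> hom C' (Dom C' ?p) (Dom C' ?p)"
      using ident_hom[OF C' hom_obj(1)[OF C' h(1)]] .
    show "?p \<cdot>\<^bsub>C'\<^esub> (?j \<cdot>\<^bsub>C'\<^esub> ?j') = ?p \<cdot>\<^bsub>C'\<^esub> Ident C' (Dom C' ?p)"
      using comp_assoc[OF C' j'(1) j(1) h(1)] j(2) j'(2) comp_ident(1)[OF C' h(1)] by simp
    show "?q \<cdot>\<^bsub>C'\<^esub> (?j \<cdot>\<^bsub>C'\<^esub> ?j') = ?q \<cdot>\<^bsub>C'\<^esub> Ident C' (Dom C' ?p)"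
      using comp_assoc[OF C' j'(1) j(1) h(2)] j(3) j'(3) comp_ident(1)[OF C' h(2)] by simp
  qed
  have mult_iff: "Fm \<cdot>\<^bsub>C'\<^esub> (Far K (imult M) \<cdot>\<^bsub>C'\<^esub> ?j) = imult M' \<cdot>\<^bsub>C'\<^esub>
        pb_pair C' (icod M') (idom M') (Fm \<cdot>\<^bsub>C'\<^esub> ?p') (Fm \<cdot>\<^bsub>C'\<^esub> ?q') \<longleftrightarrow>
      Fm \<cdot>\<^bsub>C'\<^esub> Far K (imult M) = imult M' \<cdot>\<^bsub>C'\<^esub>
        pb_pair C' (icod M') (idom M') (Fm \<cdot>\<^bsub>C'\<^esub> ?p) (Fm \<cdot>\<^bsub>C'\<^esub> ?q)"
    if Fo: "Fo \<in> hom C' (Fob K (iobj M)) (iobj M')" and Fm: "Fm \<in> hom C' (Fob K (imor M)) (imor M')"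
      and d: "idom M' \<cdot>\<^bsub>C'\<^esub> Fm = Fo \<cdot>\<^bsub>C'\<^esub> Far K (idom M)"
      and c: "icod M' \<cdot>\<^bsub>C'\<^esub> Fm = Fo \<cdot>\<^bsub>C'\<^esub> Far K (icod M)"
  proof -
    let ?r = "pb_pair C' (icod M') (idom M') (Fm \<cdot>\<^bsub>C'\<^esub> ?p) (Fm \<cdot>\<^bsub>C'\<^esub> ?q)"
    note Fp = comp_hom[OF C' h(1) Fm] and Fq = comp_hom[OF C' h(2) Fm]
    have eq: "icod M' \<cdot>\<^bsub>C'\<^esub> (Fm \<cdot>\<^bsub>C'\<^esub> ?p) = idom M' \<cdot>\<^bsub>C'\<^esub> (Fm \<cdot>\<^bsub>C'\<^esub> ?q)"
      using comp_assoc[OF C' h(1) Fm m'(2)] comp_assoc[OF C' h(2) Fm m'(1)] c d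
        comp_assoc[OF C' h(1) Kc Fo] comp_assoc[OF C' h(2) Kd Fo] h(3) by simp
    have r: "?r \<in> hom C' (Dom C' ?p) (Dom C' (pr1 C' (icod M') (idom M')))"
      unfolding pb_pair_def
      using pullback_lift(1)[OF pbM' _ _ eq] Fp Fq hom_arr[OF m'(1)] hom_arr[OF m'(2)] by simp
    have "?r \<cdot>\<^bsub>C'\<^esub> ?j = pb_pair C' (icod M') (idom M') (Fm \<cdot>\<^bsub>C'\<^esub> ?p') (Fm \<cdot>\<^bsub>C'\<^esub> ?q')"
      unfolding pb_pair_def
      using lift_comp[OF C' pbM' _ _ eq j(1)] Fp Fq hom_arr[OF m'(1)] hom_arr[OF m'(2)]
        comp_assoc[OF C' j(1) h(1) Fm] comp_assoc[OF C' j(1) h(2) Fm] j(2,3) by simp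
    then have 1: "imult M' \<cdot>\<^bsub>C'\<^esub> pb_pair C' (icod M') (idom M') (Fm \<cdot>\<^bsub>C'\<^esub> ?p') (Fm \<cdot>\<^bsub>C'\<^esub> ?q')
        = (imult M' \<cdot>\<^bsub>C'\<^esub> ?r) \<cdot>\<^bsub>C'\<^esub> ?j"
      using comp_assoc[OF C' j(1) r m'(4)] by simp
    have Km': "Far K (imult M) \<in> hom C' (Dom C' ?p) (Fob K (imor M))"
      using Km dom by simp
    have 2: "Fm \<cdot>\<^bsub>C'\<^esub> (Far K (imult M) \<cdot>\<^bsub>C'\<^esub> ?j) = (Fm \<cdot>\<^bsub>C'\<^esub> Far K (imult M)) \<cdot>\<^bsub>C'\<^esub> ?j"
      using comp_assoc[OF C' j(1) Km' Fm] by simp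
    show ?thesis
      unfolding 1 2
      using split_epi_cancel[OF C' j(1) j'(1) jj' comp_hom[OF C' Km' Fm] comp_hom[OF C' r m'(4)]] by metis
  qed
  show ?thesis
    unfolding internal_functor_def image_icat_def internal_cat.simps
    by (intro conj_cong refl mult_iff)
qed

lemma is_limit_cong:
  assumes "\<And>j. j \<in> Obj J \<Longrightarrow> \<gamma> j = \<delta> j" and "is_category J"
  shows "is_limit J C D a \<gamma> \<longleftrightarrow> is_limit J C D a \<delta>"
proof -
  have "Dom J u \<in> Obj J \<and> Cod J u \<in> Obj J" if "u \<in> Arr J" for u
    using assms(2) that unfolding is_category_def by blast
  then show ?thesis
    using assms(1) unfolding is_limit_def is_cone_def by simp
qed

lemma preserves_finite_limits_id: "preserves_finite_limits C C (id_functor C)"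
  unfolding preserves_finite_limits_def
proof (intro allI impI, elim conjE)
  fix J D a \<gamma>
  assume J: "finite_category J" and D: "is_functor J C D" and lim: "is_limit J C D a \<gamma>"
  have "a \<in> Obj C" "\<And>j. j \<in> Obj J \<Longrightarrow> \<gamma> j \<in> Arr C"
    using lim unfolding is_limit_def is_cone_def hom_def by auto
  then show "is_limit J C (comp_functor J (id_functor C) D) (Fob (id_functor C) a) (\<lambda>j. Far (id_functor C) (\<gamma> j))"
    using lim is_limit_cong[OF _ functor_cats(1)[OF D], of "\<lambda>j. Far (id_functor C) (\<gamma> j)" \<gamma> C D a]
    by (simp add: comp_functor_id(2)[OF D])
qed

lemma preserves_finite_limits_comp:
  assumes K: "is_functor C C' K" and L: "is_functor C' C'' L"
    and presK: "preserves_finite_limits C C' K" and presL: "preserves_finite_limits C' C'' L"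
  shows "preserves_finite_limits C C'' (comp_functor C L K)"
  unfolding preserves_finite_limits_def
proof (intro allI impI, elim conjE)
  fix J D a \<gamma>
  assume J: "finite_category J" and D: "is_functor J C D" and lim: "is_limit J C D a \<gamma>"
  have "a \<in> Obj C" "\<And>j. j \<in> Obj J \<Longrightarrow> \<gamma> j \<in> Arr C"
    using lim unfolding is_limit_def is_cone_def hom_def by auto
  moreover have "is_limit J C'' (comp_functor J L (comp_functor J K D)) (Fob L (Fob K a)) (\<lambda>j. Far L (Far K (\<gamma> j)))"
    using presK presL J D lim comp_functor[OF D K] unfolding preserves_finite_limits_def by blast
  ultimately show "is_limit J C'' (comp_functor J (comp_functor C L K) D) (Fob (comp_functor C L K) a)
      (\<lambda>j. Far (comp_functor C L K) (\<gamma> j))"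
    using is_limit_cong[OF _ functor_cats(1)[OF D], of "\<lambda>j. Far (comp_functor C L K) (\<gamma> j)"
        "\<lambda>j. Far L (Far K (\<gamma> j))" C'' "comp_functor J L (comp_functor J K D)" "Fob L (Fob K a)"]
    by (simp add: comp_functor_assoc[OF D K L])
qed

lemma internal_functor_id:
  assumes fc: "finitely_complete C" and M: "internal_category C M"
  shows "internal_functor C (image_icat C C (id_functor C) M) M (Ident C (iobj M)) (Ident C (imor M))"
proof -
  have C: "is_category C"
    using fc unfolding finitely_complete_def by blast
  note m = internal_category_homs[OF fc M]
  note pb = pr_pullback[OF fc m(2,1)]
  note h = pullback_homs(1-3)[OF pb, unfolded hom_arr[OF m(1)] hom_arr[OF m(2)]]
  let ?p = "pr1 C (icod M) (idom M)" and ?q = "pr2 C (icod M) (idom M)"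
  note i = ident_hom[OF C hom_obj(1)[OF C h(1)]]
  have "pb_pair C (icod M) (idom M) ?p ?q = Ident C (Dom C ?p)"
    unfolding pb_pair_def
    using pullback_lift[OF pb pullback_homs(1-3)[OF pb]] comp_ident(1)[OF C h(1)] comp_ident(1)[OF C h(2)]
    by (intro pullback_eqI[OF C pb _ i]) simp_all
  then show ?thesis
    unfolding internal_functor_image_iff[OF fc fc id_functor[OF C] preserves_finite_limits_id M M]
    using m(5,6) hom_arr(1)[OF m(1)] hom_arr(1)[OF m(2)] hom_arr(1)[OF m(3)] hom_arr(1)[OF m(4)]
      hom_arr(1)[OF h(1)] hom_arr(1)[OF h(2)] ident_hom[OF C m(5)] ident_hom[OF C m(6)]
      comp_ident[OF C m(1)] comp_ident[OF C m(2)] comp_ident[OF C m(3)] comp_ident[OF C m(4)]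
      comp_ident(2)[OF C h(1)] comp_ident(2)[OF C h(2)]
    by simp
qed

text \<open>
  Each equation in the definition of an internal functor is a commutative square. For a composite in
  \<open>IntCat\<close> it is the image under \<open>L\<close> of the square of the first factor pasted to the square of the
  second.
\<close>

lemma paste_squares:
  assumes L: "is_functor C D L"
    and u: "u \<in> hom C x y" and s: "s \<in> hom C x x'" and t: "t \<in> hom C y y'" and v: "v \<in> hom C x' y'"
    and s': "s' \<in> hom D (Fob L x') x''" and t': "t' \<in> hom D (Fob L y') y''" and w: "w \<in> hom D x'' y''"
    and eq: "v \<cdot>\<^bsub>C\<^esub> s = t \<cdot>\<^bsub>C\<^esub> u" and eq': "w \<cdot>\<^bsub>D\<^esub> s' = t' \<cdot>\<^bsub>D\<^esub> Far L v"
  shows "w \<cdot>\<^bsub>D\<^esub> (s' \<cdot>\<^bsub>D\<^esub> Far L s) = (t' \<cdot>\<^bsub>D\<^esub> Far L t) \<cdot>\<^bsub>D\<^esub> Far L u"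
proof -
  note D = functor_cats(2)[OF L] and Lhom = functor_hom[OF L]
  have "w \<cdot>\<^bsub>D\<^esub> (s' \<cdot>\<^bsub>D\<^esub> Far L s) = (t' \<cdot>\<^bsub>D\<^esub> Far L v) \<cdot>\<^bsub>D\<^esub> Far L s"
    using comp_assoc[OF D Lhom[OF s] s' w] eq' by simp
  also have "\<dots> = t' \<cdot>\<^bsub>D\<^esub> Far L (v \<cdot>\<^bsub>C\<^esub> s)"
    using comp_assoc[OF D Lhom[OF s] Lhom[OF v] t'] functor_comp[OF L s v] by simp
  also have "\<dots> = (t' \<cdot>\<^bsub>D\<^esub> Far L t) \<cdot>\<^bsub>D\<^esub> Far L u"
    using comp_assoc[OF D Lhom[OF u] Lhom[OF t] t'] functor_comp[OF L u t] eq by simp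
  finally show ?thesis .
qed

lemma internal_functor_comp:
  assumes fc: "finitely_complete C" and fc': "finitely_complete C'" and fc'': "finitely_complete C''"
    and K: "is_functor C C' K" and presK: "preserves_finite_limits C C' K"
    and L: "is_functor C' C'' L" and presL: "preserves_finite_limits C' C'' L"
    and M: "internal_category C M" and M': "internal_category C' M'" and M'': "internal_category C'' M''"
    and F: "internal_functor C' (image_icat C C' K M) M' Fo Fm"
    and G: "internal_functor C'' (image_icat C' C'' L M') M'' Go Gm"
  shows "internal_functor C'' (image_icat C C'' (comp_functor C L K) M) M''
    (Go \<cdot>\<^bsub>C''\<^esub> Far L Fo) (Gm \<cdot>\<^bsub>C''\<^esub> Far L Fm)"
proof -
  note C' = functor_cats(1)[OF L] and C'' = functor_cats(2)[OF L]
  note m = internal_category_homs[OF fc M] and m' = internal_category_homs[OF fc' M']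
    and m'' = internal_category_homs[OF fc'' M'']
  note F = F[unfolded internal_functor_image_iff[OF fc fc' K presK M M']]
    and G = G[unfolded internal_functor_image_iff[OF fc' fc'' L presL M' M'']]
  have Fo: "Fo \<in> hom C' (Fob K (iobj M)) (iobj M')" and Fm: "Fm \<in> hom C' (Fob K (imor M)) (imor M')"
    and Fd: "idom M' \<cdot>\<^bsub>C'\<^esub> Fm = Fo \<cdot>\<^bsub>C'\<^esub> Far K (idom M)" and Fc: "icod M' \<cdot>\<^bsub>C'\<^esub> Fm = Fo \<cdot>\<^bsub>C'\<^esub> Far K (icod M)"
    and Fu: "iunit M' \<cdot>\<^bsub>C'\<^esub> Fo = Fm \<cdot>\<^bsub>C'\<^esub> Far K (iunit M)"
    using F by auto
  have Go: "Go \<in> hom C'' (Fob L (iobj M')) (iobj M'')" and Gm: "Gm \<in> hom C'' (Fob L (imor M')) (imor M'')"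
    and Gd: "idom M'' \<cdot>\<^bsub>C''\<^esub> Gm = Go \<cdot>\<^bsub>C''\<^esub> Far L (idom M')" and Gc: "icod M'' \<cdot>\<^bsub>C''\<^esub> Gm = Go \<cdot>\<^bsub>C''\<^esub> Far L (icod M')"
    and Gu: "iunit M'' \<cdot>\<^bsub>C''\<^esub> Go = Gm \<cdot>\<^bsub>C''\<^esub> Far L (iunit M')"
    using G by auto
  note Kd = functor_hom[OF K m(1)] and Kc = functor_hom[OF K m(2)] and Ku = functor_hom[OF K m(3)]
    and Km = functor_hom[OF K m(4)]
  note pb = pr_pullback[OF fc m(2,1)] and pb' = pr_pullback[OF fc' m'(2,1)] and pb'' = pr_pullback[OF fc'' m''(2,1)]
  note h = pullback_homs(1-3)[OF pb, unfolded hom_arr[OF m(1)] hom_arr[OF m(2)]]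
    and h' = pullback_homs(1-3)[OF pb', unfolded hom_arr[OF m'(1)] hom_arr[OF m'(2)]]
  let ?x = "Dom C (pr1 C (icod M) (idom M))" and ?x' = "Dom C' (pr1 C' (icod M') (idom M'))"
  let ?p = "Far K (pr1 C (icod M) (idom M))" and ?q = "Far K (pr2 C (icod M) (idom M))"
  let ?p' = "pr1 C' (icod M') (idom M')" and ?q' = "pr2 C' (icod M') (idom M')"
  note Kp = functor_hom[OF K h(1)] and Kq = functor_hom[OF K h(2)]
  note Lp = functor_hom[OF L h'(1)] and Lq = functor_hom[OF L h'(2)]
  \<comment> \<open>the maps that \<open>(K, F)\<close> and \<open>(L, G)\<close> induce on composable pairs\<close>
  let ?r = "pb_pair C' (icod M') (idom M') (Fm \<cdot>\<^bsub>C'\<^esub> ?p) (Fm \<cdot>\<^bsub>C'\<^esub> ?q)"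
  let ?s = "pb_pair C'' (icod M'') (idom M'') (Gm \<cdot>\<^bsub>C''\<^esub> Far L ?p') (Gm \<cdot>\<^bsub>C''\<^esub> Far L ?q')"
  have Kpq: "Far K (icod M) \<cdot>\<^bsub>C'\<^esub> ?p = Far K (idom M) \<cdot>\<^bsub>C'\<^esub> ?q"
    using functor_comp[OF K h(1) m(2)] functor_comp[OF K h(2) m(1)] h(3) by simp
  have eq: "icod M' \<cdot>\<^bsub>C'\<^esub> (Fm \<cdot>\<^bsub>C'\<^esub> ?p) = idom M' \<cdot>\<^bsub>C'\<^esub> (Fm \<cdot>\<^bsub>C'\<^esub> ?q)"
    using comp_assoc[OF C' Kp Fm m'(2)] comp_assoc[OF C' Kq Fm m'(1)] Fc Fd
      comp_assoc[OF C' Kp Kc Fo] comp_assoc[OF C' Kq Kd Fo] Kpq by simp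
  have Lpq: "Far L (icod M') \<cdot>\<^bsub>C''\<^esub> Far L ?p' = Far L (idom M') \<cdot>\<^bsub>C''\<^esub> Far L ?q'"
    using functor_comp[OF L h'(1) m'(2)] functor_comp[OF L h'(2) m'(1)] h'(3) by simp
  have eq': "icod M'' \<cdot>\<^bsub>C''\<^esub> (Gm \<cdot>\<^bsub>C''\<^esub> Far L ?p') = idom M'' \<cdot>\<^bsub>C''\<^esub> (Gm \<cdot>\<^bsub>C''\<^esub> Far L ?q')"
    using comp_assoc[OF C'' Lp Gm m''(2)] comp_assoc[OF C'' Lq Gm m''(1)] Gc Gd
      comp_assoc[OF C'' Lp functor_hom[OF L m'(2)] Go] comp_assoc[OF C'' Lq functor_hom[OF L m'(1)] Go] Lpq by simp
  have Fp: "Fm \<cdot>\<^bsub>C'\<^esub> ?p \<in> hom C' (Fob K ?x) (Dom C' (icod M'))"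
    and Fq: "Fm \<cdot>\<^bsub>C'\<^esub> ?q \<in> hom C' (Fob K ?x) (Dom C' (idom M'))"
    using comp_hom[OF C' Kp Fm] comp_hom[OF C' Kq Fm] hom_arr[OF m'(1)] hom_arr[OF m'(2)] by auto
  have Gp: "Gm \<cdot>\<^bsub>C''\<^esub> Far L ?p' \<in> hom C'' (Fob L ?x') (Dom C'' (icod M''))"
    and Gq: "Gm \<cdot>\<^bsub>C''\<^esub> Far L ?q' \<in> hom C'' (Fob L ?x') (Dom C'' (idom M''))"
    using comp_hom[OF C'' Lp Gm] comp_hom[OF C'' Lq Gm] hom_arr[OF m''(1)] hom_arr[OF m''(2)] by auto
  note r = pullback_lift[OF pb' Fp Fq eq, folded pb_pair_def]
  note s = pullback_lift[OF pb'' Gp Gq eq', folded pb_pair_def]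
  have "(Gm \<cdot>\<^bsub>C''\<^esub> Far L ?p') \<cdot>\<^bsub>C''\<^esub> Far L ?r = (Gm \<cdot>\<^bsub>C''\<^esub> Far L Fm) \<cdot>\<^bsub>C''\<^esub> Far L ?p"
    using comp_assoc[OF C'' functor_hom[OF L r(1)] Lp Gm] functor_comp[OF L r(1) h'(1)] r(2)
      functor_comp[OF L Kp Fm] comp_assoc[OF C'' functor_hom[OF L Kp] functor_hom[OF L Fm] Gm] by simp
  moreover have "(Gm \<cdot>\<^bsub>C''\<^esub> Far L ?q') \<cdot>\<^bsub>C''\<^esub> Far L ?r = (Gm \<cdot>\<^bsub>C''\<^esub> Far L Fm) \<cdot>\<^bsub>C''\<^esub> Far L ?q"
    using comp_assoc[OF C'' functor_hom[OF L r(1)] Lq Gm] functor_comp[OF L r(1) h'(2)] r(3)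
      functor_comp[OF L Kq Fm] comp_assoc[OF C'' functor_hom[OF L Kq] functor_hom[OF L Fm] Gm] by simp
  ultimately have "?s \<cdot>\<^bsub>C''\<^esub> Far L ?r = pb_pair C'' (icod M'') (idom M'')
      ((Gm \<cdot>\<^bsub>C''\<^esub> Far L Fm) \<cdot>\<^bsub>C''\<^esub> Far L ?p) ((Gm \<cdot>\<^bsub>C''\<^esub> Far L Fm) \<cdot>\<^bsub>C''\<^esub> Far L ?q)"
    using lift_comp[OF C'' pb'' Gp Gq eq' functor_hom[OF L r(1)]] by (simp add: pb_pair_def)
  moreover have "imult M'' \<cdot>\<^bsub>C''\<^esub> (?s \<cdot>\<^bsub>C''\<^esub> Far L ?r) = (Gm \<cdot>\<^bsub>C''\<^esub> Far L Fm) \<cdot>\<^bsub>C''\<^esub> Far L (Far K (imult M))"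
    by (rule paste_squares[OF L Km r(1) Fm m'(4) s(1) Gm m''(4)]) (use F G in auto)
  ultimately show ?thesis
    unfolding internal_functor_image_iff[OF fc fc'' comp_functor[OF K L]
        preserves_finite_limits_comp[OF K L presK presL] M M'']
    using m(5,6) hom_arr(1)[OF m(1)] hom_arr(1)[OF m(2)] hom_arr(1)[OF m(3)] hom_arr(1)[OF m(4)]
      hom_arr(1)[OF h(1)] hom_arr(1)[OF h(2)]
      comp_hom[OF C'' functor_hom[OF L Fo] Go] comp_hom[OF C'' functor_hom[OF L Fm] Gm]
      paste_squares[OF L Kd Fm Fo m'(1) Gm Go m''(1) Fd Gd]
      paste_squares[OF L Kc Fm Fo m'(2) Gm Go m''(2) Fc Gc]
      paste_squares[OF L Ku Fo Fm m'(3) Go Gm m''(3) Fu Gu]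
    by simp
qed

lemma IntCat_obj:
  assumes "X \<in> Obj (IntCat U)"
  shows "finitely_complete (amb X)" "is_category (amb X)" "locally_small U (amb X)"
    "internal_category (amb X) (icat X)"
  using assms unfolding IntCat_def finitely_complete_def by auto

lemma comp_functor_whisker:
  assumes K: "is_functor B C K" and L: "is_functor C D L"
    and e: "e \<in> hom B x y" and f: "f \<in> hom C (Fob K y) z" and g: "g \<in> hom D (Fob L z) z'"
  shows "(g \<cdot>\<^bsub>D\<^esub> Far L f) \<cdot>\<^bsub>D\<^esub> Far (comp_functor B L K) e = g \<cdot>\<^bsub>D\<^esub> Far L (f \<cdot>\<^bsub>C\<^esub> Far K e)"
  using comp_assoc[OF functor_cats(2)[OF L] functor_hom[OF L functor_hom[OF K e]] functor_hom[OF L f] g]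
    functor_comp[OF L functor_hom[OF K e] f] hom_arr(1)[OF e] by simp

lemma internal_functor_image_homs:
  assumes "internal_functor C' (image_icat C C' K M) M' Fo Fm"
  shows "Fo \<in> hom C' (Fob K (iobj M)) (iobj M')" "Fm \<in> hom C' (Fob K (imor M)) (imor M')"
    "idom M' \<cdot>\<^bsub>C'\<^esub> Fm = Fo \<cdot>\<^bsub>C'\<^esub> Far K (idom M)" "icod M' \<cdot>\<^bsub>C'\<^esub> Fm = Fo \<cdot>\<^bsub>C'\<^esub> Far K (icod M)"
  using assms unfolding internal_functor_def image_icat_def by auto

lemma is_category_IntCat: "is_category (IntCat U)"
  unfolding IntCat_def
proof (rule tagged_category, goal_cases)
  case (1 a)
  then have "is_category (amb a)"
    unfolding finitely_complete_def by blast
  with 1 show ?case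
    by (simp add: id_functor preserves_finite_limits_id internal_functor_id)
next
  case (2 a b c u v)
  then show ?case
    using comp_functor[of "amb a" "amb b" "ifun u" "amb c" "ifun v"]
      preserves_finite_limits_comp[of "amb a" "amb b" "ifun u" "amb c" "ifun v"]
      internal_functor_comp[of "amb a" "amb b" "amb c" "ifun u" "ifun v" "icat a" "icat b" "icat c"]
    by simp
next
  case (3 a b u)
  then have u: "is_functor (amb a) (amb b) (ifun u)" "iFo u \<in> hom (amb b) (Fob (ifun u) (iobj (icat a))) (iobj (icat b))"
    "iFm u \<in> hom (amb b) (Fob (ifun u) (imor (icat a))) (imor (icat b))"
    "iobj (icat a) \<in> Obj (amb a)" "imor (icat a) \<in> Obj (amb a)"
    by (auto dest: internal_functor_image_homs internal_category_homs)
  then show ?case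
    using comp_ident(1)[OF functor_cats(2)[OF u(1)] u(2)] comp_ident(1)[OF functor_cats(2)[OF u(1)] u(3)]
    by (simp add: comp_functor_id(1)[OF u(1)] functor_ident[OF u(1)])
next
  case (4 a b u)
  then have u: "is_functor (amb a) (amb b) (ifun u)" "iFo u \<in> hom (amb b) (Fob (ifun u) (iobj (icat a))) (iobj (icat b))"
    "iFm u \<in> hom (amb b) (Fob (ifun u) (imor (icat a))) (imor (icat b))"
    by (auto dest: internal_functor_image_homs)
  then show ?case
    using comp_ident(2)[OF functor_cats(2)[OF u(1)] u(2)] comp_ident(2)[OF functor_cats(2)[OF u(1)] u(3)]
      hom_arr(1)[OF u(2)] hom_arr(1)[OF u(3)]
    by (simp add: comp_functor_id(2)[OF u(1)])
next
  case (5 a b c d u v w)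
  then have u: "is_functor (amb a) (amb b) (ifun u)" "iFo u \<in> hom (amb b) (Fob (ifun u) (iobj (icat a))) (iobj (icat b))"
    "iFm u \<in> hom (amb b) (Fob (ifun u) (imor (icat a))) (imor (icat b))"
    and v: "is_functor (amb b) (amb c) (ifun v)" "iFo v \<in> hom (amb c) (Fob (ifun v) (iobj (icat b))) (iobj (icat c))"
    "iFm v \<in> hom (amb c) (Fob (ifun v) (imor (icat b))) (imor (icat c))"
    and w: "is_functor (amb c) (amb d) (ifun w)" "iFo w \<in> hom (amb d) (Fob (ifun w) (iobj (icat c))) (iobj (icat d))"
    "iFm w \<in> hom (amb d) (Fob (ifun w) (imor (icat c))) (imor (icat d))"
    by (auto dest: internal_functor_image_homs)
  show ?case
    using comp_functor_whisker[OF v(1) w(1) u(2) v(2) w(2)] comp_functor_whisker[OF v(1) w(1) u(3) v(3) w(3)]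
    by (simp add: comp_functor_assoc[OF u(1) v(1) w(1)])
qed

section \<open>The category of discrete fibrations\<close>

lemma is_category_DFib: "is_category (DFib U)"
  unfolding DFib_def
proof (rule tagged_category, goal_cases)
  case (1 a)
  then have P: "is_functor (Tot a) (Base a) (Proj a)"
    unfolding discrete_fibration_def by simp
  show ?case
    using comp_functor_id[OF P] id_functor[OF functor_cats(1)[OF P]] id_functor[OF functor_cats(2)[OF P]]
    by simp
next
  case (2 a b c u v)
  then have P: "is_functor (Tot a) (Base a) (Proj a)" "is_functor (Tot b) (Base b) (Proj b)" "is_functor (Tot c) (Base c) (Proj c)"
    and u: "is_functor (Tot a) (Tot b) (TotF u)" "is_functor (Base a) (Base b) (BaseF u)"
      "comp_functor (Tot a) (Proj b) (TotF u) = comp_functor (Tot a) (BaseF u) (Proj a)"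
    and v: "is_functor (Tot b) (Tot c) (TotF v)" "is_functor (Base b) (Base c) (BaseF v)"
      "comp_functor (Tot b) (Proj c) (TotF v) = comp_functor (Tot b) (BaseF v) (Proj b)"
    unfolding discrete_fibration_def by auto
  have "comp_functor (Tot a) (Proj c) (comp_functor (Tot a) (TotF v) (TotF u))
      = comp_functor (Tot a) (comp_functor (Tot b) (Proj c) (TotF v)) (TotF u)"
    by (rule comp_functor_assoc[OF u(1) v(1) P(3), symmetric])
  also have "\<dots> = comp_functor (Tot a) (BaseF v) (comp_functor (Tot a) (Proj b) (TotF u))"
    unfolding v(3) by (rule comp_functor_assoc[OF u(1) P(2) v(2)])
  also have "\<dots> = comp_functor (Tot a) (comp_functor (Base a) (BaseF v) (BaseF u)) (Proj a)"
    unfolding u(3) by (rule comp_functor_assoc[OF P(1) u(2) v(2), symmetric])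
  finally show ?case
    using comp_functor[OF u(1) v(1)] comp_functor[OF u(2) v(2)] by simp
next
  case (3 a b u)
  then show ?case
    using comp_functor_id(1)[of "Tot a" "Tot b" "TotF u"] comp_functor_id(1)[of "Base a" "Base b" "BaseF u"]
    by simp
next
  case (4 a b u)
  then show ?case
    using comp_functor_id(2)[of "Tot a" "Tot b" "TotF u"] comp_functor_id(2)[of "Base a" "Base b" "BaseF u"]
    by simp
next
  case (5 a b c d u v w)
  then show ?case
    using comp_functor_assoc[of "Tot a" "Tot b" "TotF u" "Tot c" "TotF v" "Tot d" "TotF w"]
      comp_functor_assoc[of "Base a" "Base b" "BaseF u" "Base c" "BaseF v" "Base d" "BaseF w"]
    by simp
qed
lemma small_inj:
  assumes "small U Y" "inj_on f X" "f ` X \<subseteq> Y"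
  shows "small U X"
  using assms lesspoll_trans1[of X Y U] unfolding small_def lepoll_def by blast

text \<open>
  Lets \<open>SpEnd\<close> inherit unique lifts and smallness from \<open>Conv\<close>: a lift is computed on the other
  side of the isomorphism.
\<close>

lemma discrete_fibration_iso_total:
  assumes P: "discrete_fibration U E B P" and E: "locally_small U E"
    and F: "is_functor E E' F" and G: "is_functor E' E G"
    and GF: "comp_functor E G F = id_functor E" and FG: "comp_functor E' F G = id_functor E'"
  shows "discrete_fibration U E' B (comp_functor E' P G)" "locally_small U E'"
proof -
  have PF: "is_functor E B P"
    using P unfolding discrete_fibration_def by blast
  have FG_ob: "Fob F (Fob G a) = a" if "a \<in> Obj E'" for a
    using that arg_cong[OF FG, of "\<lambda>H. Fob H a"] by simp
  have FG_arr: "Far F (Far G t) = t" if "t \<in> Arr E'" for t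
    using that arg_cong[OF FG, of "\<lambda>H. Far H t"] by simp
  have GF_arr: "Far G (Far F t) = t" if "t \<in> Arr E" for t
    using that arg_cong[OF GF, of "\<lambda>H. Far H t"] by simp
  have inj_ob: "inj_on (Fob G) (Obj E')" and inj_arr: "inj_on (Far G) (Arr E')"
    by (rule inj_on_inverseI, erule FG_ob, rule inj_on_inverseI, erule FG_arr)
  show "locally_small U E'"
    unfolding locally_small_def
  proof (intro ballI)
    fix a b assume a: "a \<in> Obj E'" and b: "b \<in> Obj E'"
    show "small U (hom E' a b)"
    proof (rule small_inj)
      show "small U (hom E (Fob G a) (Fob G b))"
        using E functor_ob[OF G a] functor_ob[OF G b] unfolding locally_small_def by blast
      show "inj_on (Far G) (hom E' a b)"
        using inj_arr by (rule inj_on_subset) (auto simp: hom_def)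
      show "Far G ` hom E' a b \<subseteq> hom E (Fob G a) (Fob G b)"
        using functor_hom[OF G] by auto
    qed
  qed
  show "discrete_fibration U E' B (comp_functor E' P G)"
    unfolding discrete_fibration_def
  proof (intro conjI ballI impI)
    show "is_functor E' B (comp_functor E' P G)"
      by (rule comp_functor[OF G PF])
  next
    fix b assume b: "b \<in> Obj B"
    show "small U {x \<in> Obj E'. Fob (comp_functor E' P G) x = b}"
    proof (rule small_inj)
      show "small U {x \<in> Obj E. Fob P x = b}"
        using P b unfolding discrete_fibration_def by blast
      show "inj_on (Fob G) {x \<in> Obj E'. Fob (comp_functor E' P G) x = b}"
        using inj_ob by (rule inj_on_subset) auto
      show "Fob G ` {x \<in> Obj E'. Fob (comp_functor E' P G) x = b} \<subseteq> {x \<in> Obj E. Fob P x = b}"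
        using functor_ob[OF G] by auto
    qed
  next
    fix x u assume x: "x \<in> Obj E'" and u: "u \<in> Arr B" "Cod B u = Fob (comp_functor E' P G) x"
    then have ex1: "\<exists>!e. e \<in> Arr E \<and> Cod E e = Fob G x \<and> Far P e = u"
      using P functor_ob[OF G x] unfolding discrete_fibration_def by simp
    then obtain e where e: "e \<in> Arr E" "Cod E e = Fob G x" "Far P e = u"
      by blast
    show "\<exists>!e. e \<in> Arr E' \<and> Cod E' e = x \<and> Far (comp_functor E' P G) e = u"
    proof (rule ex1I)
      have "Cod E' (Far F e) = x"
        using F e(1,2) FG_ob[OF x] unfolding is_functor_def by auto
      then show "Far F e \<in> Arr E' \<and> Cod E' (Far F e) = x \<and> Far (comp_functor E' P G) (Far F e) = u"
        using functor_arr[OF F e(1)] GF_arr[OF e(1)] e(3) by simp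
    next
      fix e' assume e': "e' \<in> Arr E' \<and> Cod E' e' = x \<and> Far (comp_functor E' P G) e' = u"
      then have "Cod E (Far G e') = Fob G x"
        using G unfolding is_functor_def by auto
      then have "Far G e' = e"
        using e' ex1 e functor_arr[OF G, of e'] by auto
      then show "e' = Far F e"
        using FG_arr[of e'] e' by simp
    qed
  qed
qed

section \<open>Slices, spans and the fibration of 2-cells\<close>

lemma is_category_Slice:
  assumes C: "is_category C"
  shows "is_category (Slice C ob)"
  unfolding Slice_def
proof (rule tagged_category, goal_cases)
  case (1 f)
  then have "f \<in> hom C (Dom C f) ob"
    by (simp add: hom_def)
  then show ?case
    using ident_hom[OF C hom_obj(1)[OF C]] comp_ident(1)[OF C] by simp
next
  case (2 f g h s t)
  then have h: "h \<in> hom C (Dom C h) ob" and s: "s \<in> hom C (Dom C f) (Dom C g)"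
    and t: "t \<in> hom C (Dom C g) (Dom C h)" and eq: "g \<cdot>\<^bsub>C\<^esub> s = f" "h \<cdot>\<^bsub>C\<^esub> t = g"
    by (simp_all add: hom_def)
  then show ?case
    using comp_hom[OF C s t] comp_assoc[OF C s t h] by simp
next
  case (3 f g t)
  then show ?case
    by (auto intro: comp_ident[OF C])
next
  case (4 f g t)
  then show ?case
    by (auto intro: comp_ident[OF C])
next
  case (5 f g h k s t u)
  then show ?case
    by (auto intro: comp_assoc[OF C])
qed

lemma is_category_SpanCat:
  assumes C: "is_category C"
  shows "is_category (SpanCat C ob)"
  unfolding SpanCat_def
proof (rule tagged_category, goal_cases)
  case (1 X)
  then have "lleg X \<in> hom C (Dom C (lleg X)) ob" "rleg X \<in> hom C (Dom C (lleg X)) ob"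
    by (simp_all add: hom_def)
  then show ?case
    using ident_hom[OF C hom_obj(1)[OF C]] comp_ident(1)[OF C] by simp
next
  case (2 X Y Z s t)
  then have Z: "lleg Z \<in> hom C (Dom C (lleg Z)) ob" "rleg Z \<in> hom C (Dom C (lleg Z)) ob"
    and s: "s \<in> hom C (Dom C (lleg X)) (Dom C (lleg Y))" and t: "t \<in> hom C (Dom C (lleg Y)) (Dom C (lleg Z))"
    by (simp_all add: hom_def)
  then show ?case
    using 2 comp_hom[OF C s t] comp_assoc[OF C s t Z(1)] comp_assoc[OF C s t Z(2)] by simp
next
  case (3 X Y t)
  then show ?case
    by (auto intro: comp_ident[OF C])
next
  case (4 X Y t)
  then show ?case
    by (auto intro: comp_ident[OF C])
next
  case (5 X Y Z W s t u)
  then show ?case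
    by (auto intro: comp_assoc[OF C])
qed

text \<open>
  Shared by \<open>Conv\<close> and \<open>SpEnd\<close>: their arrows are 2-cells between the sources of their objects,
  composed as in \<open>S\<close>, so only closure under identities and composition depends on the case.
\<close>

lemma is_category_over_sources:
  assumes S: "is_category S"
    and hom: "\<And>a b. a \<in> A \<Longrightarrow> b \<in> A \<Longrightarrow> H a b \<subseteq> hom S (src a) (src b)"
    and ident: "\<And>a. a \<in> A \<Longrightarrow> Ident S (src a) \<in> H a a"
    and comp: "\<And>a b c u v. a \<in> A \<Longrightarrow> b \<in> A \<Longrightarrow> c \<in> A \<Longrightarrow> u \<in> H a b \<Longrightarrow> v \<in> H b c \<Longrightarrow> v \<cdot>\<^bsub>S\<^esub> u \<in> H a c"
  shows "is_category (tagged_category A H (\<lambda>a. Ident S (src a)) (\<lambda>_ _ v u. v \<cdot>\<^bsub>S\<^esub> u))"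
proof (rule tagged_category, goal_cases)
  case (3 a b u)
  then show ?case
    using hom[of a b] comp_ident(1)[OF S, of u "src a" "src b"] by auto
next
  case (4 a b u)
  then show ?case
    using hom[of a b] comp_ident(2)[OF S, of u "src a" "src b"] by auto
next
  case (5 a b c d u v w)
  then show ?case
    using hom[of a b] hom[of b c] hom[of c d]
      comp_assoc[OF S, of u "src a" "src b" v "src c" w "src d"] by auto
qed (use ident comp in auto)

text \<open>
  An object of \<open>Conv\<close> is a map into the object of arrows on which domain and codomain agree, that is,
  a generalized endomorphism; this is a construction on internal graphs.
\<close>

locale internal_graph =
  fixes C :: "('o, 'm) category" and M :: "('o, 'm) internal_cat"
  assumes C: "is_category C"
    and d: "idom M \<in> hom C (imor M) (iobj M)"
    and c: "icod M \<in> hom C (imor M) (iobj M)"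
begin

abbreviation S :: "('m span, 'm cell) category" where
  "S \<equiv> SpanCat C (iobj M)"

lemma S: "is_category S"
  by (rule is_category_SpanCat[OF C])

lemma Conv_obj_iff:
  "\<alpha> \<in> Obj (Conv C M) \<longleftrightarrow>
     lleg (src \<alpha>) \<in> hom C (Dom C (lleg (src \<alpha>))) (iobj M) \<and>
     src \<alpha> = diag_span (lleg (src \<alpha>)) \<and> tgt \<alpha> = ispan M \<and>
     und \<alpha> \<in> hom C (Dom C (lleg (src \<alpha>))) (imor M) \<and>
     idom M \<cdot>\<^bsub>C\<^esub> und \<alpha> = lleg (src \<alpha>) \<and> icod M \<cdot>\<^bsub>C\<^esub> und \<alpha> = lleg (src \<alpha>)"
proof -
  have span: "lleg (diag_span f) = f" "rleg (diag_span f) = f" for f :: 'm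
    by (simp_all add: diag_span_def)
  have diag: "X = diag_span (lleg X) \<longleftrightarrow> rleg X = lleg X" for X :: "'m span"
    by (cases X) (auto simp: diag_span_def)
  show ?thesis
    using hom_arr[OF d] hom_arr[OF c]
    by (auto simp: Conv_def Slice_def SpanCat_def span diag ispan_def hom_def)
qed

lemma Conv_obj:
  assumes "\<alpha> \<in> Obj (Conv C M)"
  shows "lleg (src \<alpha>) \<in> hom C (Dom C (lleg (src \<alpha>))) (iobj M)"
    "src \<alpha> = diag_span (lleg (src \<alpha>))" "tgt \<alpha> = ispan M"
    "und \<alpha> \<in> hom C (Dom C (lleg (src \<alpha>))) (imor M)"
    "idom M \<cdot>\<^bsub>C\<^esub> und \<alpha> = lleg (src \<alpha>)" "icod M \<cdot>\<^bsub>C\<^esub> und \<alpha> = lleg (src \<alpha>)"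
  using assms Conv_obj_iff by auto

lemma Conv_obj_hom:
  assumes "\<alpha> \<in> Obj (Conv C M)"
  shows "\<alpha> \<in> hom S (src \<alpha>) (ispan M)" "src \<alpha> \<in> Obj S"
proof -
  obtain f where f: "\<alpha> \<in> hom S (diag_span f) (ispan M)"
    using assms by (auto simp: Conv_def Let_def)
  then have "src \<alpha> = diag_span f"
    by (simp add: SpanCat_def)
  with f show "\<alpha> \<in> hom S (src \<alpha>) (ispan M)"
    by simp
  then show "src \<alpha> \<in> Obj S"
    by (rule hom_obj(1)[OF S])
qed

lemma Conv_eq:
  "Conv C M = tagged_category (Obj (Conv C M)) (\<lambda>\<alpha> \<beta>. {\<phi> \<in> hom S (src \<alpha>) (src \<beta>). \<beta> \<cdot>\<^bsub>S\<^esub> \<phi> = \<alpha>})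
     (\<lambda>\<alpha>. Ident S (src \<alpha>)) (\<lambda>_ _ \<psi> \<phi>. \<psi> \<cdot>\<^bsub>S\<^esub> \<phi>)"
  by (simp add: Conv_def Let_def)

lemma Conv_hom_iff:
  assumes \<alpha>: "\<alpha> \<in> Obj (Conv C M)" and \<beta>: "\<beta> \<in> Obj (Conv C M)"
  shows "\<phi> \<in> hom S (src \<alpha>) (src \<beta>) \<and> \<beta> \<cdot>\<^bsub>S\<^esub> \<phi> = \<alpha> \<longleftrightarrow>
    src \<phi> = src \<alpha> \<and> tgt \<phi> = src \<beta> \<and>
    und \<phi> \<in> hom C (Dom C (lleg (src \<alpha>))) (Dom C (lleg (src \<beta>))) \<and>
    lleg (src \<beta>) \<cdot>\<^bsub>C\<^esub> und \<phi> = lleg (src \<alpha>) \<and> und \<beta> \<cdot>\<^bsub>C\<^esub> und \<phi> = und \<alpha>"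
proof -
  note a = Conv_obj[OF \<alpha>] and b = Conv_obj[OF \<beta>]
  have "rleg (src \<alpha>) = lleg (src \<alpha>)" "rleg (src \<beta>) = lleg (src \<beta>)"
    by (subst a(2) b(2), simp add: diag_span_def)+
  moreover have "src \<alpha> \<in> Obj S" "src \<beta> \<in> Obj S"
    using Conv_obj_hom \<alpha> \<beta> by auto
  moreover have "\<beta> \<cdot>\<^bsub>S\<^esub> \<phi> = \<alpha> \<longleftrightarrow> src \<phi> = src \<alpha> \<and> und \<beta> \<cdot>\<^bsub>C\<^esub> und \<phi> = und \<alpha>"
    using a(3) b(3) by (cases \<alpha>) (auto simp: SpanCat_def)
  ultimately show ?thesis
    by (auto simp: SpanCat_def)
qed

lemma Conv_arr_iff:
  "t \<in> Arr (Conv C M) \<longleftrightarrow> src t \<in> Obj (Conv C M) \<and> tgt t \<in> Obj (Conv C M) \<and>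
    und t \<in> hom S (src (src t)) (src (tgt t)) \<and> tgt t \<cdot>\<^bsub>S\<^esub> und t = src t"
  by (subst Conv_eq) simp

lemma is_category_Conv: "is_category (Conv C M)"
proof (subst Conv_eq, rule is_category_over_sources[OF S], goal_cases)
  case (2 \<alpha>)
  then show ?case
    using Conv_obj_hom comp_ident(1)[OF S Conv_obj_hom(1)[of \<alpha>]] ident_hom[OF S] by simp
next
  case (3 \<alpha> \<beta> \<gamma> \<phi> \<psi>)
  then have \<phi>: "\<phi> \<in> hom S (src \<alpha>) (src \<beta>)" "\<beta> \<cdot>\<^bsub>S\<^esub> \<phi> = \<alpha>" and \<psi>: "\<psi> \<in> hom S (src \<beta>) (src \<gamma>)" "\<gamma> \<cdot>\<^bsub>S\<^esub> \<psi> = \<beta>"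
    by auto
  then show ?case
    using comp_hom[OF S \<phi>(1) \<psi>(1)] comp_assoc[OF S \<phi>(1) \<psi>(1) Conv_obj_hom(1)[of \<gamma>]] 3 by simp
qed auto

lemma slice_proj_Conv:
  "slice_proj (Conv C M) = tagged_functor (Conv C M) (\<lambda>\<alpha>. lleg (src \<alpha>)) (\<lambda>t. und (und t))"
proof -
  have "src (und t) = src (src t) \<and> tgt (und t) = src (tgt t)" if "t \<in> Arr (Conv C M)" for t
    using that unfolding Conv_arr_iff by (simp add: SpanCat_def)
  then show ?thesis
    unfolding slice_proj_def tagged_functor_def by (auto intro!: restrict_ext)
qed

lemma slice_proj_Conv_functor: "is_functor (Conv C M) (Slice C (iobj M)) (slice_proj (Conv C M))"
  unfolding slice_proj_Conv
proof (rule tagged_functor[OF Conv_eq Slice_def is_category_Conv is_category_Slice[OF C]], goal_cases)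
  case (1 \<alpha>)
  then show ?case
    using Conv_obj(1)[of \<alpha>] by (auto simp: hom_def)
next
  case (2 \<alpha> \<beta> \<phi>)
  then show ?case
    using Conv_hom_iff[of \<alpha> \<beta> \<phi>] by simp
qed (simp_all add: SpanCat_def)

text \<open>
  A morphism into \<open>\<beta>\<close> over \<open>u\<close> must have \<open>\<beta> u\<close> as its source, which makes lifts unique; the legs of
  \<open>\<beta> u\<close> agree because those of \<open>\<beta>\<close> do, which makes them exist. Fibres are small because an object
  over \<open>f\<close> is determined by its underlying arrow.
\<close>

lemma discrete_fibration_Conv:
  assumes small: "locally_small U C"
  shows "discrete_fibration U (Conv C M) (Slice C (iobj M)) (slice_proj (Conv C M))"
  unfolding discrete_fibration_def
proof (intro conjI ballI impI)
  show "is_functor (Conv C M) (Slice C (iobj M)) (slice_proj (Conv C M))"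
    by (rule slice_proj_Conv_functor)
next
  fix f assume "f \<in> Obj (Slice C (iobj M))"
  then have f: "f \<in> hom C (Dom C f) (iobj M)"
    by (auto simp: Slice_def hom_def)
  show "small U {\<alpha> \<in> Obj (Conv C M). Fob (slice_proj (Conv C M)) \<alpha> = f}"
  proof (rule small_inj)
    show "small U (hom C (Dom C f) (imor M))"
      using small hom_obj(1)[OF C f] hom_obj(1)[OF C d] unfolding locally_small_def by blast
    show "und ` {\<alpha> \<in> Obj (Conv C M). Fob (slice_proj (Conv C M)) \<alpha> = f} \<subseteq> hom C (Dom C f) (imor M)"
      using Conv_obj(4) by (auto simp: slice_proj_Conv)
    show "inj_on und {\<alpha> \<in> Obj (Conv C M). Fob (slice_proj (Conv C M)) \<alpha> = f}"
    proof (rule inj_onI)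
      fix \<alpha> \<beta> assume "\<alpha> \<in> {\<alpha> \<in> Obj (Conv C M). Fob (slice_proj (Conv C M)) \<alpha> = f}"
        "\<beta> \<in> {\<alpha> \<in> Obj (Conv C M). Fob (slice_proj (Conv C M)) \<alpha> = f}" "und \<alpha> = und \<beta>"
      then show "\<alpha> = \<beta>"
        using Conv_obj(2,3)[of \<alpha>] Conv_obj(2,3)[of \<beta>] by (auto simp: slice_proj_Conv intro!: tagged_eqI)
    qed
  qed
next
  fix \<beta> u assume \<beta>: "\<beta> \<in> Obj (Conv C M)" and u: "u \<in> Arr (Slice C (iobj M))"
    and cod: "Cod (Slice C (iobj M)) u = Fob (slice_proj (Conv C M)) \<beta>"
  note b = Conv_obj[OF \<beta>]
  have tgt: "tgt u = lleg (src \<beta>)"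
    using cod \<beta> by (simp add: slice_proj_Conv Slice_def)
  have f: "src u \<in> hom C (Dom C (src u)) (iobj M)" and t: "und u \<in> hom C (Dom C (src u)) (Dom C (lleg (src \<beta>)))"
    and eq: "lleg (src \<beta>) \<cdot>\<^bsub>C\<^esub> und u = src u"
    using u by (auto simp: Slice_def hom_def tgt)
  define \<alpha> where "\<alpha> = \<lparr>src = diag_span (src u), tgt = ispan M, und = und \<beta> \<cdot>\<^bsub>C\<^esub> und u\<rparr>"
  define \<phi> where "\<phi> = \<lparr>src = diag_span (src u), tgt = src \<beta>, und = und u\<rparr>"
  have span: "lleg (diag_span g) = g" for g :: 'm
    by (simp add: diag_span_def)
  have \<alpha>: "\<alpha> \<in> Obj (Conv C M)"
    unfolding Conv_obj_iff
    using f comp_hom[OF C t b(4)] comp_assoc[OF C t b(4) d] comp_assoc[OF C t b(4) c] b(5,6) eq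
    by (simp add: \<alpha>_def span)
  have \<phi>: "\<phi> \<in> hom S (src \<alpha>) (src \<beta>) \<and> \<beta> \<cdot>\<^bsub>S\<^esub> \<phi> = \<alpha>"
    unfolding Conv_hom_iff[OF \<alpha> \<beta>] using t eq by (simp add: \<alpha>_def \<phi>_def span)
  show "\<exists>!e. e \<in> Arr (Conv C M) \<and> Cod (Conv C M) e = \<beta> \<and> Far (slice_proj (Conv C M)) e = u"
  proof (rule ex1I)
    have "\<lparr>src = \<alpha>, tgt = \<beta>, und = \<phi>\<rparr> \<in> Arr (Conv C M)"
      unfolding Conv_arr_iff using \<alpha> \<beta> \<phi> by simp
    moreover have "Cod (Conv C M) e = tgt e" for e
      by (subst Conv_eq) simp
    ultimately show "\<lparr>src = \<alpha>, tgt = \<beta>, und = \<phi>\<rparr> \<in> Arr (Conv C M) \<and> Cod (Conv C M) \<lparr>src = \<alpha>, tgt = \<beta>, und = \<phi>\<rparr> = \<beta>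
        \<and> Far (slice_proj (Conv C M)) \<lparr>src = \<alpha>, tgt = \<beta>, und = \<phi>\<rparr> = u"
      by (simp add: slice_proj_Conv \<alpha>_def \<phi>_def span tgt)
  next
    fix e assume e: "e \<in> Arr (Conv C M) \<and> Cod (Conv C M) e = \<beta> \<and> Far (slice_proj (Conv C M)) e = u"
    have "Cod (Conv C M) e = tgt e"
      by (subst Conv_eq) simp
    with e have tgt_e: "tgt e = \<beta>"
      by simp
    have src_e: "src e \<in> Obj (Conv C M)" and hom_e: "und e \<in> hom S (src (src e)) (src \<beta>) \<and> \<beta> \<cdot>\<^bsub>S\<^esub> und e = src e"
      using e tgt_e unfolding Conv_arr_iff by auto
    have u_eq: "src u = lleg (src (src e))" "und u = und (und e)"
      using e by (auto simp: slice_proj_Conv)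
    have "und e = \<phi>"
      using hom_e[unfolded Conv_hom_iff[OF src_e \<beta>]] Conv_obj(2)[OF src_e] u_eq
      by (intro tagged_eqI) (simp_all add: \<phi>_def)
    then show "e = \<lparr>src = \<alpha>, tgt = \<beta>, und = \<phi>\<rparr>"
      using tgt_e hom_e \<phi> by (intro tagged_eqI) simp_all
  qed
qed

lemma locally_small_Slice:
  assumes small: "locally_small U C"
  shows "locally_small U (Slice C ob)"
  unfolding locally_small_def
proof (intro ballI)
  fix f g assume "f \<in> Obj (Slice C ob)" "g \<in> Obj (Slice C ob)"
  then have "f \<in> Arr C" "g \<in> Arr C"
    by (auto simp: Slice_def)
  then have "Dom C f \<in> Obj C" "Dom C g \<in> Obj C"
    using C unfolding is_category_def by auto
  then show "small U (hom (Slice C ob) f g)"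
    using small by (intro small_inj[of U "hom C (Dom C f) (Dom C g)" und])
      (auto simp: locally_small_def Slice_def intro!: inj_onI)
qed

lemma locally_small_Conv:
  assumes small: "locally_small U C"
  shows "locally_small U (Conv C M)"
  unfolding locally_small_def
proof (intro ballI)
  fix \<alpha> \<beta> assume \<alpha>: "\<alpha> \<in> Obj (Conv C M)" and \<beta>: "\<beta> \<in> Obj (Conv C M)"
  let ?H = "hom C (Dom C (lleg (src \<alpha>))) (Dom C (lleg (src \<beta>)))"
  have hom: "src t = \<alpha> \<and> tgt t = \<beta> \<and> src (und t) = src \<alpha> \<and> tgt (und t) = src \<beta> \<and> und (und t) \<in> ?H"
    if "t \<in> hom (Conv C M) \<alpha> \<beta>" for t
  proof -
    have "src t = \<alpha>" "tgt t = \<beta>" "und t \<in> hom S (src \<alpha>) (src \<beta>) \<and> \<beta> \<cdot>\<^bsub>S\<^esub> und t = \<alpha>"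
      using that by (subst (asm) Conv_eq, auto)+
    then show ?thesis
      using Conv_hom_iff[OF \<alpha> \<beta>, of "und t"] by blast
  qed
  show "small U (hom (Conv C M) \<alpha> \<beta>)"
  proof (rule small_inj)
    show "small U ?H"
      using small hom_obj(1)[OF C Conv_obj(1)[OF \<alpha>]] hom_obj(1)[OF C Conv_obj(1)[OF \<beta>]]
      unfolding locally_small_def by blast
    show "(\<lambda>t. und (und t)) ` hom (Conv C M) \<alpha> \<beta> \<subseteq> ?H"
      using hom by blast
    show "inj_on (\<lambda>t. und (und t)) (hom (Conv C M) \<alpha> \<beta>)"
    proof (rule inj_onI)
      fix s t assume "s \<in> hom (Conv C M) \<alpha> \<beta>" "t \<in> hom (Conv C M) \<alpha> \<beta>" "und (und s) = und (und t)"
      then show "s = t"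
        using hom[of s] hom[of t] by (intro tagged_eqI) simp_all
    qed
  qed
qed

lemma P_dfib_obj:
  assumes "locally_small U C"
  shows "P_dfib C M \<in> Obj (DFib U)"
  using discrete_fibration_Conv[OF assms] locally_small_Conv[OF assms] locally_small_Slice[OF assms]
  by (simp add: DFib_def P_dfib_def)

end

section \<open>The first functor\<close>

lemma IntCat_eq:
  "IntCat U = tagged_category (Obj (IntCat U))
     (\<lambda>X Y. {k. is_functor (amb X) (amb Y) (ifun k) \<and>
         preserves_finite_limits (amb X) (amb Y) (ifun k) \<and>
         internal_functor (amb Y) (image_icat (amb X) (amb Y) (ifun k) (icat X)) (icat Y)
           (iFo k) (iFm k)})
     (\<lambda>X. \<lparr>ifun = id_functor (amb X),
           iFo = Ident (amb X) (iobj (icat X)), iFm = Ident (amb X) (imor (icat X))\<rparr>)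
     (\<lambda>X Z l k. \<lparr>ifun = comp_functor (amb X) (ifun l) (ifun k),
           iFo = iFo l \<cdot>\<^bsub>amb Z\<^esub> Far (ifun l) (iFo k),
           iFm = iFm l \<cdot>\<^bsub>amb Z\<^esub> Far (ifun l) (iFm k)\<rparr>)"
  unfolding IntCat_def by simp

lemma IntCat_arr_iff:
  "k \<in> Arr (IntCat U) \<longleftrightarrow> src k \<in> Obj (IntCat U) \<and> tgt k \<in> Obj (IntCat U) \<and>
     is_functor (amb (src k)) (amb (tgt k)) (ifun (und k)) \<and>
     preserves_finite_limits (amb (src k)) (amb (tgt k)) (ifun (und k)) \<and>
     internal_functor (amb (tgt k))
       (image_icat (amb (src k)) (amb (tgt k)) (ifun (und k)) (icat (src k))) (icat (tgt k))
       (iFo (und k)) (iFm (und k))"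
  by (subst IntCat_eq) simp

lemma internal_graph_IntCat:
  assumes "X \<in> Obj (IntCat U)"
  shows "internal_graph (amb X) (icat X)"
  using IntCat_obj[OF assms] internal_category_homs(1,2)[of "amb X" "icat X"]
  by unfold_locales auto

lemma slice_map_eq:
  "slice_map k = tagged_functor (Slice (amb (src k)) (iobj (icat (src k)))) (slice_ob k)
     (\<lambda>t. Far (ifun (und k)) (und t))"
  by (simp add: slice_map_def tagged_functor_def Let_def)

lemma conv_map_eq:
  "conv_map k = tagged_functor (Conv (amb (src k)) (icat (src k))) (conv_ob k)
     (\<lambda>t. diag_cell_map k (und t))"
  by (simp add: conv_map_def tagged_functor_def Let_def)

text \<open>
  An arrow of \<open>IntCat\<close> maps internal graphs to internal graphs; since domain and codomain are
  respected, it maps generalized endomorphisms to generalized endomorphisms.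
\<close>

locale internal_graph_map =
  src: internal_graph "amb (src k)" "icat (src k)" + tgt: internal_graph "amb (tgt k)" "icat (tgt k)"
  for k :: "('o, 'm) int_arr" +
  assumes K: "is_functor (amb (src k)) (amb (tgt k)) (ifun (und k))"
    and Fo: "iFo (und k) \<in> hom (amb (tgt k)) (Fob (ifun (und k)) (iobj (icat (src k)))) (iobj (icat (tgt k)))"
    and Fm: "iFm (und k) \<in> hom (amb (tgt k)) (Fob (ifun (und k)) (imor (icat (src k)))) (imor (icat (tgt k)))"
    and Fd: "idom (icat (tgt k)) \<cdot>\<^bsub>amb (tgt k)\<^esub> iFm (und k)
      = iFo (und k) \<cdot>\<^bsub>amb (tgt k)\<^esub> Far (ifun (und k)) (idom (icat (src k)))"
    and Fc: "icod (icat (tgt k)) \<cdot>\<^bsub>amb (tgt k)\<^esub> iFm (und k)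
      = iFo (und k) \<cdot>\<^bsub>amb (tgt k)\<^esub> Far (ifun (und k)) (icod (icat (src k)))"
begin

abbreviation A :: "('o, 'm) category" where "A \<equiv> amb (src k)"
abbreviation B :: "('o, 'm) category" where "B \<equiv> amb (tgt k)"
abbreviation M :: "('o, 'm) internal_cat" where "M \<equiv> icat (src k)"
abbreviation N :: "('o, 'm) internal_cat" where "N \<equiv> icat (tgt k)"
abbreviation Kar :: "'m \<Rightarrow> 'm" where "Kar \<equiv> Far (ifun (und k))"

lemma slice_ob_hom:
  "f \<in> hom A a (iobj M) \<Longrightarrow> slice_ob k f \<in> hom B (Fob (ifun (und k)) a) (iobj N)"
  unfolding slice_ob_def using comp_hom[OF tgt.C functor_hom[OF K] Fo] .

lemma slice_ob_comp:
  assumes "t \<in> hom A a b" "g \<in> hom A b (iobj M)"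
  shows "slice_ob k g \<cdot>\<^bsub>B\<^esub> Kar t = slice_ob k (g \<cdot>\<^bsub>A\<^esub> t)"
  unfolding slice_ob_def functor_comp[OF K assms]
  by (rule comp_assoc[OF tgt.C functor_hom[OF K assms(1)] functor_hom[OF K assms(2)] Fo])

lemma slice_map_functor: "is_functor (Slice A (iobj M)) (Slice B (iobj N)) (slice_map k)"
  unfolding slice_map_eq
proof (rule tagged_functor[OF Slice_def Slice_def is_category_Slice[OF src.C] is_category_Slice[OF tgt.C]],
    goal_cases)
  case (1 f)
  then show ?case
    using slice_ob_hom[of f "Dom A f"] by (auto simp: hom_def)
next
  case (2 f g t)
  then have f: "f \<in> hom A (Dom A f) (iobj M)" and g: "g \<in> hom A (Dom A g) (iobj M)"
    and t: "t \<in> hom A (Dom A f) (Dom A g)" and eq: "g \<cdot>\<^bsub>A\<^esub> t = f"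
    by (auto simp: hom_def)
  show ?case
    using functor_hom[OF K t] slice_ob_comp[OF t g] eq
      hom_arr(2)[OF slice_ob_hom[OF f]] hom_arr(2)[OF slice_ob_hom[OF g]] by simp
next
  case (3 f)
  then have f: "f \<in> hom A (Dom A f) (iobj M)"
    by (auto simp: hom_def)
  show ?case
    using functor_ident[OF K hom_obj(1)[OF src.C f]] hom_arr(2)[OF slice_ob_hom[OF f]] by simp
next
  case (4 f g h s t)
  then show ?case
    by (auto intro: functor_comp[OF K])
qed

lemma conv_ob_obj:
  assumes \<alpha>: "\<alpha> \<in> Obj (Conv A M)"
  shows "conv_ob k \<alpha> \<in> Obj (Conv B N)"
proof -
  note a = src.Conv_obj[OF \<alpha>]
  note f = slice_ob_hom[OF a(1)] and Ka = functor_hom[OF K a(4)]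
  have "idom N \<cdot>\<^bsub>B\<^esub> (iFm (und k) \<cdot>\<^bsub>B\<^esub> Kar (und \<alpha>)) = slice_ob k (lleg (src \<alpha>))"
    using comp_assoc[OF tgt.C Ka Fm tgt.d] Fd slice_ob_comp[OF a(4) src.d] a(5)
    by (simp add: slice_ob_def)
  moreover have "icod N \<cdot>\<^bsub>B\<^esub> (iFm (und k) \<cdot>\<^bsub>B\<^esub> Kar (und \<alpha>)) = slice_ob k (lleg (src \<alpha>))"
    using comp_assoc[OF tgt.C Ka Fm tgt.c] Fc slice_ob_comp[OF a(4) src.c] a(6)
    by (simp add: slice_ob_def)
  ultimately show ?thesis
    unfolding tgt.Conv_obj_iff
    using f comp_hom[OF tgt.C Ka Fm] hom_arr(2)[OF f] by (simp add: conv_ob_def diag_span_def)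
qed

lemma conv_map_functor: "is_functor (Conv A M) (Conv B N) (conv_map k)"
  unfolding conv_map_eq
proof (rule tagged_functor[OF src.Conv_eq tgt.Conv_eq src.is_category_Conv tgt.is_category_Conv],
    goal_cases)
  case (1 \<alpha>)
  then show ?case
    by (rule conv_ob_obj)
next
  case (2 \<alpha> \<beta> \<phi>)
  note a = src.Conv_obj[OF 2(1)] and b = src.Conv_obj[OF 2(2)]
  have \<phi>: "src \<phi> = src \<alpha>" "tgt \<phi> = src \<beta>"
    "und \<phi> \<in> hom A (Dom A (lleg (src \<alpha>))) (Dom A (lleg (src \<beta>)))"
    "lleg (src \<beta>) \<cdot>\<^bsub>A\<^esub> und \<phi> = lleg (src \<alpha>)" "und \<beta> \<cdot>\<^bsub>A\<^esub> und \<phi> = und \<alpha>"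
    using src.Conv_hom_iff[OF 2(1,2), of \<phi>] 2(3) by auto
  have "(iFm (und k) \<cdot>\<^bsub>B\<^esub> Kar (und \<beta>)) \<cdot>\<^bsub>B\<^esub> Kar (und \<phi>) = iFm (und k) \<cdot>\<^bsub>B\<^esub> Kar (und \<alpha>)"
    using comp_assoc[OF tgt.C functor_hom[OF K \<phi>(3)] functor_hom[OF K b(4)] Fm]
      functor_comp[OF K \<phi>(3) b(4)] \<phi>(5) by simp
  then have "diag_cell_map k \<phi> \<in> hom tgt.S (src (conv_ob k \<alpha>)) (src (conv_ob k \<beta>)) \<and>
      conv_ob k \<beta> \<cdot>\<^bsub>tgt.S\<^esub> diag_cell_map k \<phi> = conv_ob k \<alpha>"
    unfolding tgt.Conv_hom_iff[OF conv_ob_obj[OF 2(1)] conv_ob_obj[OF 2(2)]]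
    using \<phi> functor_hom[OF K \<phi>(3)] slice_ob_comp[OF \<phi>(3) b(1)]
      hom_arr(2)[OF slice_ob_hom[OF a(1)]] hom_arr(2)[OF slice_ob_hom[OF b(1)]]
    by (simp add: diag_cell_map_def conv_ob_def diag_span_def)
  then show ?case
    by simp
next
  case (3 \<alpha>)
  note a = src.Conv_obj[OF 3]
  show ?case
    using functor_ident[OF K hom_obj(1)[OF src.C a(1)]] hom_arr(2)[OF slice_ob_hom[OF a(1)]]
    by (simp add: SpanCat_def diag_cell_map_def conv_ob_def diag_span_def)
next
  case (4 \<alpha> \<beta> \<gamma> \<phi> \<psi>)
  have \<phi>: "und \<phi> \<in> hom A (Dom A (lleg (src \<alpha>))) (Dom A (lleg (src \<beta>)))"
    using src.Conv_hom_iff[OF 4(1,2), of \<phi>] 4(4) by auto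
  have \<psi>: "und \<psi> \<in> hom A (Dom A (lleg (src \<beta>))) (Dom A (lleg (src \<gamma>)))"
    using src.Conv_hom_iff[OF 4(2,3), of \<psi>] 4(5) by auto
  show ?case
    using functor_comp[OF K \<phi> \<psi>] by (simp add: SpanCat_def diag_cell_map_def)
qed

lemma proj_conv_map:
  "comp_functor (Conv A M) (slice_proj (Conv B N)) (conv_map k)
    = comp_functor (Conv A M) (slice_map k) (slice_proj (Conv A M))"
proof (rule functor_eqI[OF comp_functor[OF conv_map_functor tgt.slice_proj_Conv_functor]
      comp_functor[OF src.slice_proj_Conv_functor slice_map_functor]])
  fix \<alpha> assume \<alpha>: "\<alpha> \<in> Obj (Conv A M)"
  show "Fob (comp_functor (Conv A M) (slice_proj (Conv B N)) (conv_map k)) \<alpha>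
      = Fob (comp_functor (Conv A M) (slice_map k) (slice_proj (Conv A M))) \<alpha>"
    using \<alpha> conv_ob_obj[OF \<alpha>] functor_ob[OF src.slice_proj_Conv_functor \<alpha>]
    by (simp add: conv_map_eq slice_map_eq src.slice_proj_Conv tgt.slice_proj_Conv conv_ob_def diag_span_def)
next
  fix t assume t: "t \<in> Arr (Conv A M)"
  show "Far (comp_functor (Conv A M) (slice_proj (Conv B N)) (conv_map k)) t
      = Far (comp_functor (Conv A M) (slice_map k) (slice_proj (Conv A M))) t"
    using t functor_arr[OF conv_map_functor t] functor_arr[OF src.slice_proj_Conv_functor t]
    by (simp add: conv_map_eq slice_map_eq src.slice_proj_Conv tgt.slice_proj_Conv conv_ob_def
        diag_cell_map_def diag_span_def)
qed

end

lemma internal_graph_map_IntCat: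
  assumes "k \<in> Arr (IntCat U)"
  shows "internal_graph_map k"
proof -
  have k: "src k \<in> Obj (IntCat U)" "tgt k \<in> Obj (IntCat U)"
    and K: "is_functor (amb (src k)) (amb (tgt k)) (ifun (und k))"
    and F: "internal_functor (amb (tgt k))
       (image_icat (amb (src k)) (amb (tgt k)) (ifun (und k)) (icat (src k))) (icat (tgt k))
       (iFo (und k)) (iFm (und k))"
    using assms unfolding IntCat_arr_iff by auto
  show ?thesis
    unfolding internal_graph_map_def internal_graph_map_axioms_def
    using internal_graph_IntCat[OF k(1)] internal_graph_IntCat[OF k(2)] K internal_functor_image_homs[OF F]
    by blast
qed

lemma slice_ob_Ident:
  assumes "X \<in> Obj (IntCat U)" "f \<in> hom (amb X) a (iobj (icat X))"
  shows "slice_ob (Ident (IntCat U) X) f = f"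
  using comp_ident(2)[OF IntCat_obj(2)[OF assms(1)] assms(2)] hom_arr(1)[OF assms(2)]
  by (simp add: IntCat_def slice_ob_def)

lemma slice_ob_comp_arr:
  assumes k: "k \<in> Arr (IntCat U)" and l: "l \<in> Arr (IntCat U)" and kl: "src l = tgt k"
    and f: "f \<in> hom (amb (src k)) a (iobj (icat (src k)))"
  shows "slice_ob (l \<cdot>\<^bsub>IntCat U\<^esub> k) f = slice_ob l (slice_ob k f)"
proof -
  interpret k: internal_graph_map k by (rule internal_graph_map_IntCat[OF k])
  interpret l: internal_graph_map l by (rule internal_graph_map_IntCat[OF l])
  show ?thesis
    using comp_functor_whisker[OF k.K l.K[unfolded kl] f k.Fo l.Fo[unfolded kl]]
    by (simp add: IntCat_def slice_ob_def)
qed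

lemma slice_map_Ident:
  assumes X: "X \<in> Obj (IntCat U)"
  shows "slice_map (Ident (IntCat U) X) = id_functor (Slice (amb X) (iobj (icat X)))"
proof -
  have i: "src (Ident (IntCat U) X) = X" "tgt (Ident (IntCat U) X) = X"
    "ifun (und (Ident (IntCat U) X)) = id_functor (amb X)"
    by (simp_all add: IntCat_def)
  have "slice_ob (Ident (IntCat U) X) f = f" if "f \<in> Arr (amb X)" "Cod (amb X) f = iobj (icat X)" for f
    using slice_ob_Ident[OF X, of f "Dom (amb X) f"] that by (simp add: hom_def)
  then show ?thesis
    unfolding slice_map_eq tagged_functor_def id_functor_def i
    by (auto intro!: restrict_ext tagged_eqI simp: Slice_def hom_def id_functor_def)
qed

lemma slice_map_comp:
  assumes k: "k \<in> Arr (IntCat U)" and l: "l \<in> Arr (IntCat U)" and kl: "src l = tgt k"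
    and lk: "l \<cdot>\<^bsub>IntCat U\<^esub> k \<in> Arr (IntCat U)"
  shows "slice_map (l \<cdot>\<^bsub>IntCat U\<^esub> k)
    = comp_functor (Slice (amb (src k)) (iobj (icat (src k)))) (slice_map l) (slice_map k)"
proof -
  interpret k: internal_graph_map k by (rule internal_graph_map_IntCat[OF k])
  interpret l: internal_graph_map l by (rule internal_graph_map_IntCat[OF l])
  interpret lk: internal_graph_map "l \<cdot>\<^bsub>IntCat U\<^esub> k" by (rule internal_graph_map_IntCat[OF lk])
  have i: "src (l \<cdot>\<^bsub>IntCat U\<^esub> k) = src k" "tgt (l \<cdot>\<^bsub>IntCat U\<^esub> k) = tgt l"
    "ifun (und (l \<cdot>\<^bsub>IntCat U\<^esub> k)) = comp_functor (amb (src k)) (ifun (und l)) (ifun (und k))"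
    by (simp_all add: IntCat_def)
  have ob: "slice_ob (l \<cdot>\<^bsub>IntCat U\<^esub> k) f = slice_ob l (slice_ob k f)"
    if "f \<in> Obj (Slice (amb (src k)) (iobj (icat (src k))))" for f
    using slice_ob_comp_arr[OF k l kl, of f "Dom (amb (src k)) f"] that by (simp add: Slice_def hom_def)
  show ?thesis
  proof (rule functor_eqI[OF lk.slice_map_functor[unfolded i]
        comp_functor[OF k.slice_map_functor l.slice_map_functor[unfolded kl]]])
    fix f assume f: "f \<in> Obj (Slice k.A (iobj k.M))"
    show "Fob (slice_map (l \<cdot>\<^bsub>IntCat U\<^esub> k)) f = Fob (comp_functor (Slice k.A (iobj k.M)) (slice_map l) (slice_map k)) f"
      using f functor_ob[OF k.slice_map_functor f] ob[OF f] by (simp add: slice_map_eq i kl)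
  next
    fix t assume t: "t \<in> Arr (Slice k.A (iobj k.M))"
    then have "src t \<in> Obj (Slice k.A (iobj k.M))" "tgt t \<in> Obj (Slice k.A (iobj k.M))" "und t \<in> Arr k.A"
      by (auto simp: Slice_def hom_def)
    then show "Far (slice_map (l \<cdot>\<^bsub>IntCat U\<^esub> k)) t = Far (comp_functor (Slice k.A (iobj k.M)) (slice_map l) (slice_map k)) t"
      using t functor_arr[OF k.slice_map_functor t] ob by (simp add: slice_map_eq i kl)
  qed
qed

lemma conv_map_Ident:
  assumes X: "X \<in> Obj (IntCat U)"
  shows "conv_map (Ident (IntCat U) X) = id_functor (Conv (amb X) (icat X))"
proof -
  interpret internal_graph "amb X" "icat X" by (rule internal_graph_IntCat[OF X])
  have i: "src (Ident (IntCat U) X) = X" "tgt (Ident (IntCat U) X) = X"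
    "ifun (und (Ident (IntCat U) X)) = id_functor (amb X)"
    "iFm (und (Ident (IntCat U) X)) = Ident (amb X) (imor (icat X))"
    by (simp_all add: IntCat_def)
  have ob: "conv_ob (Ident (IntCat U) X) \<alpha> = \<alpha>" if \<alpha>: "\<alpha> \<in> Obj (Conv (amb X) (icat X))" for \<alpha>
    using Conv_obj[OF \<alpha>] slice_ob_Ident[OF X Conv_obj(1)[OF \<alpha>]] comp_ident(2)[OF C Conv_obj(4)[OF \<alpha>]]
      hom_arr(1)[OF Conv_obj(4)[OF \<alpha>]]
    by (intro tagged_eqI) (simp_all add: conv_ob_def i)
  have "diag_cell_map (Ident (IntCat U) X) (und t) = und t" if t: "t \<in> Arr (Conv (amb X) (icat X))" for t
  proof -
    have st: "src t \<in> Obj (Conv (amb X) (icat X))" "tgt t \<in> Obj (Conv (amb X) (icat X))"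
      and hom: "und t \<in> hom S (src (src t)) (src (tgt t)) \<and> tgt t \<cdot>\<^bsub>S\<^esub> und t = src t"
      using t unfolding Conv_arr_iff by auto
    show ?thesis
      using hom[unfolded Conv_hom_iff[OF st]] Conv_obj(2)[OF st(1)] Conv_obj(2)[OF st(2)]
        slice_ob_Ident[OF X Conv_obj(1)[OF st(1)]] slice_ob_Ident[OF X Conv_obj(1)[OF st(2)]]
      by (intro tagged_eqI) (auto simp: diag_cell_map_def i hom_def)
  qed
  then show ?thesis
    unfolding conv_map_eq tagged_functor_def id_functor_def i
    by (auto intro!: restrict_ext tagged_eqI simp: ob Conv_arr_iff)
qed

lemma conv_ob_comp_arr:
  assumes k: "k \<in> Arr (IntCat U)" and l: "l \<in> Arr (IntCat U)" and kl: "src l = tgt k"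
    and \<alpha>: "\<alpha> \<in> Obj (Conv (amb (src k)) (icat (src k)))"
  shows "conv_ob (l \<cdot>\<^bsub>IntCat U\<^esub> k) \<alpha> = conv_ob l (conv_ob k \<alpha>)"
proof -
  interpret k: internal_graph_map k by (rule internal_graph_map_IntCat[OF k])
  interpret l: internal_graph_map l by (rule internal_graph_map_IntCat[OF l])
  have tgt: "tgt (l \<cdot>\<^bsub>IntCat U\<^esub> k) = tgt l"
    by (simp add: IntCat_def)
  have und: "iFm (und (l \<cdot>\<^bsub>IntCat U\<^esub> k)) \<cdot>\<^bsub>l.B\<^esub> Far (ifun (und (l \<cdot>\<^bsub>IntCat U\<^esub> k))) (und \<alpha>)
      = iFm (und l) \<cdot>\<^bsub>l.B\<^esub> Far (ifun (und l)) (iFm (und k) \<cdot>\<^bsub>k.B\<^esub> Far (ifun (und k)) (und \<alpha>))"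
    using comp_functor_whisker[OF k.K l.K[unfolded kl] k.src.Conv_obj(4)[OF \<alpha>] k.Fm l.Fm[unfolded kl]]
    by (simp add: IntCat_def)
  show ?thesis
    using und slice_ob_comp_arr[OF k l kl k.src.Conv_obj(1)[OF \<alpha>]]
    by (simp add: conv_ob_def tgt diag_span_def)
qed

lemma conv_map_comp:
  assumes k: "k \<in> Arr (IntCat U)" and l: "l \<in> Arr (IntCat U)" and kl: "src l = tgt k"
    and lk: "l \<cdot>\<^bsub>IntCat U\<^esub> k \<in> Arr (IntCat U)"
  shows "conv_map (l \<cdot>\<^bsub>IntCat U\<^esub> k)
    = comp_functor (Conv (amb (src k)) (icat (src k))) (conv_map l) (conv_map k)"
proof -
  interpret k: internal_graph_map k by (rule internal_graph_map_IntCat[OF k])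
  interpret l: internal_graph_map l by (rule internal_graph_map_IntCat[OF l])
  interpret lk: internal_graph_map "l \<cdot>\<^bsub>IntCat U\<^esub> k" by (rule internal_graph_map_IntCat[OF lk])
  have i: "src (l \<cdot>\<^bsub>IntCat U\<^esub> k) = src k" "tgt (l \<cdot>\<^bsub>IntCat U\<^esub> k) = tgt l"
    "ifun (und (l \<cdot>\<^bsub>IntCat U\<^esub> k)) = comp_functor (amb (src k)) (ifun (und l)) (ifun (und k))"
    by (simp_all add: IntCat_def)
  note ob = conv_ob_comp_arr[OF k l kl]
  show ?thesis
  proof (rule functor_eqI[OF lk.conv_map_functor[unfolded i]
        comp_functor[OF k.conv_map_functor l.conv_map_functor[unfolded kl]]])
    fix \<alpha> assume \<alpha>: "\<alpha> \<in> Obj (Conv k.A k.M)"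
    show "Fob (conv_map (l \<cdot>\<^bsub>IntCat U\<^esub> k)) \<alpha> = Fob (comp_functor (Conv k.A k.M) (conv_map l) (conv_map k)) \<alpha>"
      using \<alpha> k.conv_ob_obj[OF \<alpha>] ob[OF \<alpha>] by (simp add: conv_map_eq i kl)
  next
    fix t assume t: "t \<in> Arr (Conv k.A k.M)"
    then have st: "src t \<in> Obj (Conv k.A k.M)" "tgt t \<in> Obj (Conv k.A k.M)"
      and hom: "und t \<in> hom k.src.S (src (src t)) (src (tgt t)) \<and> tgt t \<cdot>\<^bsub>k.src.S\<^esub> und t = src t"
      unfolding k.src.Conv_arr_iff by auto
    note h = hom[unfolded k.src.Conv_hom_iff[OF st]]
    have "diag_cell_map (l \<cdot>\<^bsub>IntCat U\<^esub> k) (und t) = diag_cell_map l (diag_cell_map k (und t))"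
      using h slice_ob_comp_arr[OF k l kl k.src.Conv_obj(1)[OF st(1)]]
        slice_ob_comp_arr[OF k l kl k.src.Conv_obj(1)[OF st(2)]]
      by (auto simp: diag_cell_map_def i diag_span_def hom_def)
    then show "Far (conv_map (l \<cdot>\<^bsub>IntCat U\<^esub> k)) t = Far (comp_functor (Conv k.A k.M) (conv_map l) (conv_map k)) t"
      using t functor_arr[OF k.conv_map_functor t] ob[OF st(1)] ob[OF st(2)] by (simp add: conv_map_eq i kl)
  qed
qed

lemma P_functor_eq:
  "P_functor U = tagged_functor (IntCat U) (\<lambda>X. P_dfib (amb X) (icat X))
     (\<lambda>k. \<lparr>TotF = conv_map k, BaseF = slice_map k\<rparr>)"
  by (simp add: P_functor_def tagged_functor_def)

lemma P_functor_functor: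
  "is_functor (IntCat U :: (('o, 'm) int_obj, ('o, 'm) int_arr) category) (DFib U) (P_functor U)"
  unfolding P_functor_eq
proof (rule tagged_functor[OF IntCat_eq DFib_def is_category_IntCat is_category_DFib], goal_cases)
  case (1 X)
  interpret internal_graph "amb X" "icat X" by (rule internal_graph_IntCat[OF 1])
  show ?case
    using P_dfib_obj[OF IntCat_obj(3)[OF 1]] by (simp add: DFib_def)
next
  case (2 X Y u)
  let ?k = "\<lparr>src = X, tgt = Y, und = u\<rparr>"
  have "?k \<in> Arr (IntCat U)"
    unfolding IntCat_arr_iff using 2 by simp
  then interpret k: internal_graph_map ?k by (rule internal_graph_map_IntCat)
  show ?case
    using k.conv_map_functor k.slice_map_functor k.proj_conv_map by (simp add: P_dfib_def)
next
  case (3 X)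
  have "\<lparr>src = X, tgt = X, und = \<lparr>ifun = id_functor (amb X),
      iFo = Ident (amb X) (iobj (icat X)), iFm = Ident (amb X) (imor (icat X))\<rparr>\<rparr> = Ident (IntCat U) X"
    by (simp add: IntCat_def)
  then show ?case
    using conv_map_Ident[OF 3] slice_map_Ident[OF 3] by (simp add: P_dfib_def)
next
  case (4 X Y Z u v)
  let ?k = "\<lparr>src = X, tgt = Y, und = u\<rparr>" and ?l = "\<lparr>src = Y, tgt = Z, und = v\<rparr>"
  have k: "?k \<in> Arr (IntCat U)" and l: "?l \<in> Arr (IntCat U)"
    unfolding IntCat_arr_iff using 4 by simp_all
  have hom: "?k \<in> hom (IntCat U) X Y" "?l \<in> hom (IntCat U) Y Z"
    using k l by (simp_all add: hom_def IntCat_def)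
  have lk: "\<lparr>src = X, tgt = Z, und = \<lparr>ifun = comp_functor (amb X) (ifun v) (ifun u),
      iFo = iFo v \<cdot>\<^bsub>amb Z\<^esub> Far (ifun v) (iFo u), iFm = iFm v \<cdot>\<^bsub>amb Z\<^esub> Far (ifun v) (iFm u)\<rparr>\<rparr>
      = ?l \<cdot>\<^bsub>IntCat U\<^esub> ?k"
    by (simp add: IntCat_def)
  show ?case
    unfolding lk using conv_map_comp[OF k l] slice_map_comp[OF k l] hom_arr(1)[OF comp_hom[OF is_category_IntCat hom]]
    by (simp add: P_dfib_def)
qed

section \<open>The isomorphism of Conv with SpEnd\<close>

locale complete_internal_graph = internal_graph C M
  for C :: "('o, 'm) category" and M :: "('o, 'm) internal_cat" +
  assumes fc: "finitely_complete C"
begin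

text \<open>
  For \<open>f\<close> over the object of objects, \<open>tensor C (diag_span f) (ispan M)\<close> is the pullback of the
  codomain map along \<open>f\<close>; a 2-cell into it is determined by its two components.
\<close>

lemma tensor_pullback:
  assumes "f \<in> hom C a (iobj M)"
  shows "is_pullback C (icod M) f (pr1 C (icod M) f) (pr2 C (icod M) f)"
  by (rule pr_pullback[OF fc c assms])

lemma sp_cell_und:
  assumes \<alpha>: "\<alpha> \<in> Obj (Conv C M)"
  defines "f \<equiv> lleg (src \<alpha>)"
  shows "und (sp_cell C M \<alpha>) \<in> hom C (Dom C f) (Dom C (pr1 C (icod M) f))"
    "pr1 C (icod M) f \<cdot>\<^bsub>C\<^esub> und (sp_cell C M \<alpha>) = und \<alpha>"
    "pr2 C (icod M) f \<cdot>\<^bsub>C\<^esub> und (sp_cell C M \<alpha>) = Ident C (Dom C f)"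
proof -
  note a = Conv_obj[OF \<alpha>, folded f_def]
  note i = ident_hom[OF C hom_obj(1)[OF C a(1)]]
  have und: "und (sp_cell C M \<alpha>) = lift C (pr1 C (icod M) f) (pr2 C (icod M) f) (und \<alpha>) (Ident C (Dom C f))"
    by (simp add: sp_cell_def cell_pair_def pb_pair_def SpanCat_def a(3) f_def ispan_def)
  have "icod M \<cdot>\<^bsub>C\<^esub> und \<alpha> = f \<cdot>\<^bsub>C\<^esub> Ident C (Dom C f)"
    using a(6) comp_ident(1)[OF C a(1)] by simp
  note l = pullback_lift[OF tensor_pullback[OF a(1)] _ i this]
  show "und (sp_cell C M \<alpha>) \<in> hom C (Dom C f) (Dom C (pr1 C (icod M) f))"
    "pr1 C (icod M) f \<cdot>\<^bsub>C\<^esub> und (sp_cell C M \<alpha>) = und \<alpha>"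
    "pr2 C (icod M) f \<cdot>\<^bsub>C\<^esub> und (sp_cell C M \<alpha>) = Ident C (Dom C f)"
    unfolding und using l a(4) hom_arr(2)[OF c] by auto
qed

lemma sp_cell_ends:
  assumes "\<alpha> \<in> Obj (Conv C M)"
  shows "src (sp_cell C M \<alpha>) = src \<alpha>" "tgt (sp_cell C M \<alpha>) = tensor C (src \<alpha>) (ispan M)"
  using Conv_obj(3)[OF assms] by (simp_all add: sp_cell_def cell_pair_def SpanCat_def)

lemma sp_cell_inj:
  assumes \<alpha>: "\<alpha> \<in> Obj (Conv C M)" and \<beta>: "\<beta> \<in> Obj (Conv C M)" and eq: "sp_cell C M \<alpha> = sp_cell C M \<beta>"
  shows "\<alpha> = \<beta>"
proof -
  have src: "src \<alpha> = src \<beta>"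
    using sp_cell_ends(1)[OF \<alpha>] sp_cell_ends(1)[OF \<beta>] eq by simp
  show ?thesis
    using src sp_cell_und(2)[OF \<alpha>] sp_cell_und(2)[OF \<beta>] eq Conv_obj(3)[OF \<alpha>] Conv_obj(3)[OF \<beta>]
    by (intro tagged_eqI) simp_all
qed

text \<open>
  The square of a morphism \<open>(\<phi>, \<tau>)\<close> of \<open>SpEnd\<close> is an equation between maps into a pullback, so
  it splits into two components: the second projection gives \<open>\<phi> = \<tau>\<close>, and the first one, to \<open>M\<close>,
  gives \<open>\<beta> \<phi> = \<alpha>\<close>.
\<close>

lemma sp_square_iff:
  assumes \<alpha>: "\<alpha> \<in> Obj (Conv C M)" and \<beta>: "\<beta> \<in> Obj (Conv C M)"
    and \<phi>: "\<phi> \<in> hom S (src \<alpha>) (src \<beta>)"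
  shows "(\<exists>\<tau> \<in> hom S (src \<alpha>) (src \<beta>).
      sp_cell C M \<beta> \<cdot>\<^bsub>S\<^esub> \<phi> = tensor_cell C \<tau> (Ident S (ispan M)) \<cdot>\<^bsub>S\<^esub> sp_cell C M \<alpha>) \<longleftrightarrow>
    \<beta> \<cdot>\<^bsub>S\<^esub> \<phi> = \<alpha>"
proof -
  let ?f = "lleg (src \<alpha>)" and ?g = "lleg (src \<beta>)"
  let ?p = "pr1 C (icod M) ?f" and ?q = "pr2 C (icod M) ?f"
  let ?p' = "pr1 C (icod M) ?g" and ?q' = "pr2 C (icod M) ?g"
  note a = Conv_obj[OF \<alpha>] and b = Conv_obj[OF \<beta>]
  note sa = sp_cell_und[OF \<alpha>] and sb = sp_cell_und[OF \<beta>]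
  note pf = tensor_pullback[OF a(1)] and pg = tensor_pullback[OF b(1)]
  note hf = pullback_homs(1-3)[OF pf, unfolded hom_arr(2)[OF c]]
    and hg = pullback_homs(1-3)[OF pg, unfolded hom_arr(2)[OF c]]
  have rleg: "rleg (src \<alpha>) = ?f" "rleg (src \<beta>) = ?g"
    by (subst a(2) b(2), simp add: diag_span_def)+
  have cell: "src \<tau> = src \<alpha>" "tgt \<tau> = src \<beta>" "und \<tau> \<in> hom C (Dom C ?f) (Dom C ?g)" "?g \<cdot>\<^bsub>C\<^esub> und \<tau> = ?f"
    if "\<tau> \<in> hom S (src \<alpha>) (src \<beta>)" for \<tau>
    using that by (auto simp: SpanCat_def)
  have square: "sp_cell C M \<beta> \<cdot>\<^bsub>S\<^esub> \<phi> = tensor_cell C \<tau> (Ident S (ispan M)) \<cdot>\<^bsub>S\<^esub> sp_cell C M \<alpha> \<longleftrightarrow>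
      und \<beta> \<cdot>\<^bsub>C\<^esub> und \<phi> = und \<alpha> \<and> und \<phi> = und \<tau>" if \<tau>: "\<tau> \<in> hom S (src \<alpha>) (src \<beta>)" for \<tau>
  proof -
    note \<phi>' = cell[OF \<phi>] and \<tau>' = cell[OF \<tau>]
    let ?T = "und (tensor_cell C \<tau> (Ident S (ispan M)))"
    have T: "?T = lift C ?p' ?q' ?p (und \<tau> \<cdot>\<^bsub>C\<^esub> ?q)"
      using comp_ident(2)[OF C hf(1)] hom_arr(2)[OF d] \<tau>'
      by (simp add: tensor_cell_def pb_pair_def SpanCat_def ispan_def)
    have "icod M \<cdot>\<^bsub>C\<^esub> ?p = ?g \<cdot>\<^bsub>C\<^esub> (und \<tau> \<cdot>\<^bsub>C\<^esub> ?q)"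
      using hf(3) comp_assoc[OF C hf(2) \<tau>'(3) b(1)] \<tau>'(4) by simp
    note l = pullback_lift[OF pg _ comp_hom[OF C hf(2) \<tau>'(3)] this, unfolded hom_arr(2)[OF c], OF hf(1), folded T]
    have L: "und (sp_cell C M \<beta>) \<cdot>\<^bsub>C\<^esub> und \<phi> \<in> hom C (Dom C ?f) (Dom C ?p')"
      "?p' \<cdot>\<^bsub>C\<^esub> (und (sp_cell C M \<beta>) \<cdot>\<^bsub>C\<^esub> und \<phi>) = und \<beta> \<cdot>\<^bsub>C\<^esub> und \<phi>"
      "?q' \<cdot>\<^bsub>C\<^esub> (und (sp_cell C M \<beta>) \<cdot>\<^bsub>C\<^esub> und \<phi>) = und \<phi>"
      using comp_hom[OF C \<phi>'(3) sb(1)] comp_assoc[OF C \<phi>'(3) sb(1) hg(1)]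
        comp_assoc[OF C \<phi>'(3) sb(1) hg(2)] sb(2,3) comp_ident(2)[OF C \<phi>'(3)] by auto
    have "?q' \<cdot>\<^bsub>C\<^esub> (?T \<cdot>\<^bsub>C\<^esub> und (sp_cell C M \<alpha>)) = (und \<tau> \<cdot>\<^bsub>C\<^esub> ?q) \<cdot>\<^bsub>C\<^esub> und (sp_cell C M \<alpha>)"
      using comp_assoc[OF C sa(1) l(1) hg(2)] l(3) by simp
    also have "\<dots> = und \<tau>"
      using comp_assoc[OF C sa(1) hf(2) \<tau>'(3)] sa(3) comp_ident(1)[OF C \<tau>'(3)] by simp
    finally have R3: "?q' \<cdot>\<^bsub>C\<^esub> (?T \<cdot>\<^bsub>C\<^esub> und (sp_cell C M \<alpha>)) = und \<tau>" .
    have R: "?T \<cdot>\<^bsub>C\<^esub> und (sp_cell C M \<alpha>) \<in> hom C (Dom C ?f) (Dom C ?p')"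
      "?p' \<cdot>\<^bsub>C\<^esub> (?T \<cdot>\<^bsub>C\<^esub> und (sp_cell C M \<alpha>)) = und \<alpha>"
      using comp_hom[OF C sa(1) l(1)] comp_assoc[OF C sa(1) l(1) hg(1)] l(2) sa(2) by auto
    have "und (sp_cell C M \<beta>) \<cdot>\<^bsub>C\<^esub> und \<phi> = ?T \<cdot>\<^bsub>C\<^esub> und (sp_cell C M \<alpha>) \<longleftrightarrow>
        und \<beta> \<cdot>\<^bsub>C\<^esub> und \<phi> = und \<alpha> \<and> und \<phi> = und \<tau>" (is "?l = ?r \<longleftrightarrow> ?e \<and> ?e'")
    proof (intro iffI conjI)
      assume "?l = ?r"
      then have "?p' \<cdot>\<^bsub>C\<^esub> ?l = ?p' \<cdot>\<^bsub>C\<^esub> ?r" "?q' \<cdot>\<^bsub>C\<^esub> ?l = ?q' \<cdot>\<^bsub>C\<^esub> ?r"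
        by (rule arg_cong)+
      then show ?e ?e'
        unfolding L(2,3) R(2) R3 .
    next
      assume *: "?e \<and> ?e'"
      show "?l = ?r"
      proof (rule pullback_eqI[OF C pg L(1) R(1)])
        show "?p' \<cdot>\<^bsub>C\<^esub> ?l = ?p' \<cdot>\<^bsub>C\<^esub> ?r"
          unfolding L(2) R(2) using * by blast
        show "?q' \<cdot>\<^bsub>C\<^esub> ?l = ?q' \<cdot>\<^bsub>C\<^esub> ?r"
          unfolding L(3) R3 using * by blast
      qed
    qed
    moreover have "sp_cell C M \<beta> \<cdot>\<^bsub>S\<^esub> \<phi> = tensor_cell C \<tau> (Ident S (ispan M)) \<cdot>\<^bsub>S\<^esub> sp_cell C M \<alpha> \<longleftrightarrow>
        und (sp_cell C M \<beta>) \<cdot>\<^bsub>C\<^esub> und \<phi> = ?T \<cdot>\<^bsub>C\<^esub> und (sp_cell C M \<alpha>)"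
    proof -
      have comp: "s \<cdot>\<^bsub>S\<^esub> t = \<lparr>src = src t, tgt = tgt s, und = und s \<cdot>\<^bsub>C\<^esub> und t\<rparr>" for s t
        by (simp add: SpanCat_def)
      have "tgt (tensor_cell C \<tau> (Ident S (ispan M))) = tensor C (src \<beta>) (ispan M)"
        by (simp add: tensor_cell_def SpanCat_def \<tau>'(2))
      then show ?thesis
        unfolding comp sp_cell_ends(1)[OF \<alpha>] sp_cell_ends(2)[OF \<beta>] \<phi>'(1) by simp
    qed
    ultimately show ?thesis
      by simp
  qed
  have "\<beta> \<cdot>\<^bsub>S\<^esub> \<phi> = \<alpha> \<longleftrightarrow> und \<beta> \<cdot>\<^bsub>C\<^esub> und \<phi> = und \<alpha>"
    using Conv_hom_iff[OF \<alpha> \<beta>, of \<phi>] \<phi> cell[OF \<phi>] by auto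
  then show ?thesis
    using square \<phi> by auto
qed

lemma SpEnd_eq:
  "SpEnd C M = tagged_category (sp_cell C M ` Obj (Conv C M))
     (\<lambda>e e'. {\<sigma> \<in> hom S (src e) (src e'). \<exists>\<tau> \<in> hom S (src e) (src e').
        e' \<cdot>\<^bsub>S\<^esub> \<sigma> = tensor_cell C \<tau> (Ident S (ispan M)) \<cdot>\<^bsub>S\<^esub> e})
     (\<lambda>e. Ident S (src e)) (\<lambda>_ _ \<rho> \<sigma>. \<rho> \<cdot>\<^bsub>S\<^esub> \<sigma>)"
proof -
  have "{e. \<exists>f\<in>Obj (Slice C (iobj M)). \<exists>\<alpha>\<in>hom S (diag_span f) (ispan M). e = sp_cell C M \<alpha>}
      = sp_cell C M ` Obj (Conv C M)"
    by (auto simp: Conv_def Let_def)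
  then show ?thesis
    unfolding SpEnd_def Let_def by simp
qed

lemma SpEnd_hom_iff:
  assumes \<alpha>: "\<alpha> \<in> Obj (Conv C M)" and \<beta>: "\<beta> \<in> Obj (Conv C M)"
  shows "{\<sigma> \<in> hom S (src (sp_cell C M \<alpha>)) (src (sp_cell C M \<beta>)).
      \<exists>\<tau> \<in> hom S (src (sp_cell C M \<alpha>)) (src (sp_cell C M \<beta>)).
        sp_cell C M \<beta> \<cdot>\<^bsub>S\<^esub> \<sigma> = tensor_cell C \<tau> (Ident S (ispan M)) \<cdot>\<^bsub>S\<^esub> sp_cell C M \<alpha>}
    = {\<phi> \<in> hom S (src \<alpha>) (src \<beta>). \<beta> \<cdot>\<^bsub>S\<^esub> \<phi> = \<alpha>}"
  using sp_square_iff[OF \<alpha> \<beta>] unfolding sp_cell_ends(1)[OF \<alpha>] sp_cell_ends(1)[OF \<beta>] by blast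

lemma is_category_SpEnd: "is_category (SpEnd C M)"
proof (subst SpEnd_eq, rule is_category_over_sources[OF S], goal_cases)
  case (2 e)
  then obtain \<alpha> where \<alpha>: "\<alpha> \<in> Obj (Conv C M)" and e: "e = sp_cell C M \<alpha>"
    by blast
  have "Ident S (src \<alpha>) \<in> {\<phi> \<in> hom S (src \<alpha>) (src \<alpha>). \<alpha> \<cdot>\<^bsub>S\<^esub> \<phi> = \<alpha>}"
    using ident_hom[OF S Conv_obj_hom(2)[OF \<alpha>]] comp_ident(1)[OF S Conv_obj_hom(1)[OF \<alpha>]] by simp
  then show ?case
    unfolding e SpEnd_hom_iff[OF \<alpha> \<alpha>] unfolding sp_cell_ends(1)[OF \<alpha>] .
next
  case (3 e e' e'' \<sigma> \<rho>)
  then obtain \<alpha> \<beta> \<gamma> where \<alpha>: "\<alpha> \<in> Obj (Conv C M)" and \<beta>: "\<beta> \<in> Obj (Conv C M)" and \<gamma>: "\<gamma> \<in> Obj (Conv C M)"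
    and e: "e = sp_cell C M \<alpha>" "e' = sp_cell C M \<beta>" "e'' = sp_cell C M \<gamma>"
    by blast
  have \<sigma>: "\<sigma> \<in> hom S (src \<alpha>) (src \<beta>)" "\<beta> \<cdot>\<^bsub>S\<^esub> \<sigma> = \<alpha>" and \<rho>: "\<rho> \<in> hom S (src \<beta>) (src \<gamma>)" "\<gamma> \<cdot>\<^bsub>S\<^esub> \<rho> = \<beta>"
    using 3(4,5) unfolding e SpEnd_hom_iff[OF \<alpha> \<beta>] SpEnd_hom_iff[OF \<beta> \<gamma>] by auto
  have "\<rho> \<cdot>\<^bsub>S\<^esub> \<sigma> \<in> {\<phi> \<in> hom S (src \<alpha>) (src \<gamma>). \<gamma> \<cdot>\<^bsub>S\<^esub> \<phi> = \<alpha>}"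
    using comp_hom[OF S \<sigma>(1) \<rho>(1)] comp_assoc[OF S \<sigma>(1) \<rho>(1) Conv_obj_hom(1)[OF \<gamma>]] \<sigma>(2) \<rho>(2) by simp
  then show ?case
    unfolding e SpEnd_hom_iff[OF \<alpha> \<gamma>] .
qed auto

text \<open>
  The inverse of \<open>\<alpha> \<mapsto> \<langle>id, \<alpha>\<rangle>\<close>, given by the description that occurs in \<open>sp_end_ob\<close>; this makes
  \<open>sp_end_ob\<close> literally a conjugate of \<open>conv_ob\<close>.
\<close>

definition cell_of :: "'m cell \<Rightarrow> 'm cell" where
  "cell_of e = (THE \<alpha>. \<alpha> \<in> Obj (Conv C M) \<and> e = sp_cell C M \<alpha>)"

lemma cell_of_sp_cell:
  assumes "\<alpha> \<in> Obj (Conv C M)"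
  shows "cell_of (sp_cell C M \<alpha>) = \<alpha>"
  unfolding cell_of_def using assms sp_cell_inj by (intro the_equality) auto

lemma cell_of:
  assumes "e \<in> Obj (SpEnd C M)"
  shows "cell_of e \<in> Obj (Conv C M)" "sp_cell C M (cell_of e) = e" "src (cell_of e) = src e"
proof -
  obtain \<alpha> where "\<alpha> \<in> Obj (Conv C M)" "e = sp_cell C M \<alpha>"
    using assms by (subst (asm) SpEnd_eq) auto
  then show "cell_of e \<in> Obj (Conv C M)" "sp_cell C M (cell_of e) = e" "src (cell_of e) = src e"
    using cell_of_sp_cell sp_cell_ends(1) by auto
qed

definition to_SpEnd where "to_SpEnd = tagged_functor (Conv C M) (sp_cell C M) und"

definition of_SpEnd where "of_SpEnd = tagged_functor (SpEnd C M) cell_of und"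

lemma to_SpEnd: "is_functor (Conv C M) (SpEnd C M) to_SpEnd"
  unfolding to_SpEnd_def
proof (rule tagged_functor[OF Conv_eq SpEnd_eq is_category_Conv is_category_SpEnd], goal_cases)
  case (2 \<alpha> \<beta> \<phi>)
  then show ?case
    unfolding SpEnd_hom_iff[OF 2(1,2)] by simp
qed (simp_all add: sp_cell_ends(1))

lemma of_SpEnd: "is_functor (SpEnd C M) (Conv C M) of_SpEnd"
  unfolding of_SpEnd_def
proof (rule tagged_functor[OF SpEnd_eq Conv_eq is_category_SpEnd is_category_Conv], goal_cases)
  case (1 e)
  then show ?case
    using cell_of_sp_cell by auto
next
  case (2 e e' \<sigma>)
  then obtain \<alpha> \<beta> where \<alpha>: "\<alpha> \<in> Obj (Conv C M)" and \<beta>: "\<beta> \<in> Obj (Conv C M)"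
    and e: "e = sp_cell C M \<alpha>" "e' = sp_cell C M \<beta>"
    by blast
  show ?case
    using 2(3) unfolding e SpEnd_hom_iff[OF \<alpha> \<beta>] cell_of_sp_cell[OF \<alpha>] cell_of_sp_cell[OF \<beta>] by simp
next
  case (3 e)
  then show ?case
    by (auto simp: sp_cell_ends(1) cell_of_sp_cell)
qed simp_all

lemma SpEnd_arr_ends:
  "t \<in> Arr (SpEnd C M) \<Longrightarrow> src t \<in> Obj (SpEnd C M) \<and> tgt t \<in> Obj (SpEnd C M)
    \<and> src (und t) = src (src t) \<and> tgt (und t) = src (tgt t)"
  by (subst (asm) SpEnd_eq, subst (1 2) SpEnd_eq) (auto simp: SpanCat_def)

lemma of_to_SpEnd: "comp_functor (Conv C M) of_SpEnd to_SpEnd = id_functor (Conv C M)"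
proof (rule functor_eqI[OF comp_functor[OF to_SpEnd of_SpEnd] id_functor[OF is_category_Conv]])
  fix \<alpha> assume \<alpha>: "\<alpha> \<in> Obj (Conv C M)"
  show "Fob (comp_functor (Conv C M) of_SpEnd to_SpEnd) \<alpha> = Fob (id_functor (Conv C M)) \<alpha>"
    using functor_ob[OF to_SpEnd \<alpha>] \<alpha> by (simp add: to_SpEnd_def of_SpEnd_def cell_of_sp_cell)
next
  fix t assume t: "t \<in> Arr (Conv C M)"
  show "Far (comp_functor (Conv C M) of_SpEnd to_SpEnd) t = Far (id_functor (Conv C M)) t"
    using functor_arr[OF to_SpEnd t] t Conv_arr_iff[of t]
    by (simp add: to_SpEnd_def of_SpEnd_def cell_of_sp_cell)
qed

lemma to_of_SpEnd: "comp_functor (SpEnd C M) to_SpEnd of_SpEnd = id_functor (SpEnd C M)"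
proof (rule functor_eqI[OF comp_functor[OF of_SpEnd to_SpEnd] id_functor[OF is_category_SpEnd]])
  fix e assume e: "e \<in> Obj (SpEnd C M)"
  show "Fob (comp_functor (SpEnd C M) to_SpEnd of_SpEnd) e = Fob (id_functor (SpEnd C M)) e"
    using functor_ob[OF of_SpEnd e] e by (simp add: to_SpEnd_def of_SpEnd_def cell_of)
next
  fix t assume t: "t \<in> Arr (SpEnd C M)"
  show "Far (comp_functor (SpEnd C M) to_SpEnd of_SpEnd) t = Far (id_functor (SpEnd C M)) t"
    using functor_arr[OF of_SpEnd t] t SpEnd_arr_ends[OF t]
    by (simp add: to_SpEnd_def of_SpEnd_def cell_of)
qed

lemma slice_proj_SpEnd:
  "slice_proj (SpEnd C M) = comp_functor (SpEnd C M) (slice_proj (Conv C M)) of_SpEnd"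
proof -
  have "Fob (slice_proj (Conv C M)) (Fob of_SpEnd e) = lleg (src e)" if "e \<in> Obj (SpEnd C M)" for e
    using that functor_ob[OF of_SpEnd that] by (simp add: slice_proj_Conv of_SpEnd_def cell_of)
  moreover have "Far (slice_proj (Conv C M)) (Far of_SpEnd t)
      = \<lparr>src = lleg (src (und t)), tgt = lleg (tgt (und t)), und = und (und t)\<rparr>" if "t \<in> Arr (SpEnd C M)" for t
    using that functor_arr[OF of_SpEnd that] SpEnd_arr_ends[OF that]
    by (simp add: slice_proj_Conv of_SpEnd_def cell_of)
  ultimately show ?thesis
    unfolding slice_proj_def comp_functor_def compose_def by (auto intro!: restrict_ext)
qed

lemma slice_proj_to_SpEnd:
  "comp_functor (Conv C M) (slice_proj (SpEnd C M)) to_SpEnd = slice_proj (Conv C M)"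
  unfolding slice_proj_SpEnd comp_functor_assoc[OF to_SpEnd of_SpEnd slice_proj_Conv_functor] of_to_SpEnd
  by (rule comp_functor_id(1)[OF slice_proj_Conv_functor])

lemma Q_dfib_obj:
  assumes "locally_small U C"
  shows "Q_dfib C M \<in> Obj (DFib U)"
  using discrete_fibration_iso_total[OF discrete_fibration_Conv[OF assms] locally_small_Conv[OF assms]
      to_SpEnd of_SpEnd of_to_SpEnd to_of_SpEnd] locally_small_Slice[OF assms]
  by (simp add: DFib_def Q_dfib_def slice_proj_SpEnd)

definition P_to_Q :: "('m cell_dfib, 'm cell_dfib_mor) tagged" where
  "P_to_Q = \<lparr>src = P_dfib C M, tgt = Q_dfib C M,
     und = \<lparr>TotF = to_SpEnd, BaseF = id_functor (Slice C (iobj M))\<rparr>\<rparr>"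

definition Q_to_P :: "('m cell_dfib, 'm cell_dfib_mor) tagged" where
  "Q_to_P = \<lparr>src = Q_dfib C M, tgt = P_dfib C M,
     und = \<lparr>TotF = of_SpEnd, BaseF = id_functor (Slice C (iobj M))\<rparr>\<rparr>"

lemma P_to_Q:
  assumes U: "locally_small U C"
  shows "P_to_Q \<in> hom (DFib U) (P_dfib C M) (Q_dfib C M)"
    "Q_to_P \<in> hom (DFib U) (Q_dfib C M) (P_dfib C M)"
    "Q_to_P \<cdot>\<^bsub>DFib U\<^esub> P_to_Q = Ident (DFib U) (P_dfib C M)"
    "P_to_Q \<cdot>\<^bsub>DFib U\<^esub> Q_to_P = Ident (DFib U) (Q_dfib C M)"
proof -
  note id = id_functor[OF is_category_Slice[OF C], of "iobj M"]
  have projQ: "is_functor (SpEnd C M) (Slice C (iobj M)) (slice_proj (SpEnd C M))"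
    unfolding slice_proj_SpEnd by (rule comp_functor[OF of_SpEnd slice_proj_Conv_functor])
  show "P_to_Q \<in> hom (DFib U) (P_dfib C M) (Q_dfib C M)"
    "Q_to_P \<in> hom (DFib U) (Q_dfib C M) (P_dfib C M)"
    using P_dfib_obj[OF U] Q_dfib_obj[OF U] to_SpEnd of_SpEnd id slice_proj_to_SpEnd slice_proj_SpEnd[symmetric]
      comp_functor_id(2)[OF slice_proj_Conv_functor] comp_functor_id(2)[OF projQ]
    by (simp_all add: DFib_def P_to_Q_def Q_to_P_def, simp_all add: P_dfib_def Q_dfib_def)
  show "Q_to_P \<cdot>\<^bsub>DFib U\<^esub> P_to_Q = Ident (DFib U) (P_dfib C M)"
    "P_to_Q \<cdot>\<^bsub>DFib U\<^esub> Q_to_P = Ident (DFib U) (Q_dfib C M)"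
    using of_to_SpEnd to_of_SpEnd comp_functor_id(1)[OF id]
    by (simp_all add: DFib_def P_to_Q_def Q_to_P_def P_dfib_def Q_dfib_def)
qed

end

lemma complete_internal_graph_IntCat:
  assumes "X \<in> Obj (IntCat U)"
  shows "complete_internal_graph (amb X) (icat X)"
  using internal_graph_IntCat[OF assms] IntCat_obj(1)[OF assms]
  by (simp add: complete_internal_graph_def complete_internal_graph_axioms_def)

section \<open>The second functor and the natural isomorphism\<close>

text \<open>
  By definition \<open>sp_end_map k\<close> passes to the 2-cell, applies \<open>conv_map k\<close> and passes back, so it is
  the conjugate of \<open>conv_map k\<close> by the two comparison isomorphisms.
\<close>

lemma Q_functor_conjugate:
  assumes k: "k \<in> Arr (IntCat U)"
  shows "Far (Q_functor U) k
    = complete_internal_graph.P_to_Q (amb (tgt k)) (icat (tgt k)) \<cdot>\<^bsub>DFib U\<^esub>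
        (Far (P_functor U) k \<cdot>\<^bsub>DFib U\<^esub> complete_internal_graph.Q_to_P (amb (src k)) (icat (src k)))"
proof -
  have ob: "src k \<in> Obj (IntCat U)" "tgt k \<in> Obj (IntCat U)"
    using k unfolding IntCat_arr_iff by auto
  interpret k: internal_graph_map k by (rule internal_graph_map_IntCat[OF k])
  interpret A: complete_internal_graph k.A k.M by (rule complete_internal_graph_IntCat[OF ob(1)])
  interpret B: complete_internal_graph k.B k.N by (rule complete_internal_graph_IntCat[OF ob(2)])
  have sp_end_ob: "sp_end_ob k e = sp_cell k.B k.N (conv_ob k (A.cell_of e))" for e
    by (simp add: sp_end_ob_def A.cell_of_def)
  have tot: "sp_end_map k = comp_functor (SpEnd k.A k.M) B.to_SpEnd (comp_functor (SpEnd k.A k.M) (conv_map k) A.of_SpEnd)"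
    (is "_ = ?R")
  proof -
    have "Fob ?R e = sp_end_ob k e" if e: "e \<in> Obj (SpEnd k.A k.M)" for e
      using e A.cell_of(1)[OF e] k.conv_ob_obj[OF A.cell_of(1)[OF e]]
      by (simp add: A.of_SpEnd_def B.to_SpEnd_def conv_map_eq sp_end_ob)
    moreover have "Far ?R t = \<lparr>src = sp_end_ob k (src t), tgt = sp_end_ob k (tgt t), und = diag_cell_map k (und t)\<rparr>"
      if t: "t \<in> Arr (SpEnd k.A k.M)" for t
      using t functor_arr[OF A.of_SpEnd t] functor_arr[OF k.conv_map_functor functor_arr[OF A.of_SpEnd t]]
      by (simp add: A.of_SpEnd_def B.to_SpEnd_def conv_map_eq sp_end_ob)
    moreover have "Fob ?R \<in> extensional (Obj (SpEnd k.A k.M))" "Far ?R \<in> extensional (Arr (SpEnd k.A k.M))"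
      by (simp_all add: comp_functor_def)
    ultimately show ?thesis
      unfolding sp_end_map_def Let_def
      by (intro functr.equality) (auto simp: fun_eq_iff extensional_def)
  qed
  have base: "slice_map k = comp_functor (Slice k.A (iobj k.M)) (id_functor (Slice k.B (iobj k.N)))
      (comp_functor (Slice k.A (iobj k.M)) (slice_map k) (id_functor (Slice k.A (iobj k.M))))"
    unfolding comp_functor_id[OF k.slice_map_functor] ..
  show ?thesis
    using k tot base
    by (simp add: P_functor_def Q_functor_def DFib_def A.Q_to_P_def B.P_to_Q_def) (simp add: P_dfib_def Q_dfib_def)
qed

theorem mainTheorem3:
  fixes U :: "'u set"
  shows "is_functor (IntCat U :: (('o, 'm) int_obj, ('o, 'm) int_arr) category) (DFib U) (P_functor U) \<and>
         is_functor (IntCat U :: (('o, 'm) int_obj, ('o, 'm) int_arr) category) (DFib U) (Q_functor U) \<and>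
         naturally_isomorphic (IntCat U :: (('o, 'm) int_obj, ('o, 'm) int_arr) category) (DFib U)
           (P_functor U) (Q_functor U)"
proof -
  let ?I = "IntCat U :: (('o, 'm) int_obj, ('o, 'm) int_arr) category"
  let ?t = "\<lambda>X :: ('o, 'm) int_obj. complete_internal_graph.P_to_Q (amb X) (icat X)"
  let ?s = "\<lambda>X :: ('o, 'm) int_obj. complete_internal_graph.Q_to_P (amb X) (icat X)"
  have Pob: "Fob (P_functor U) X = P_dfib (amb X) (icat X)"
    and Qob: "Fob (Q_functor U) X = Q_dfib (amb X) (icat X)" if "X \<in> Obj ?I" for X
    using that by (simp_all add: P_functor_def Q_functor_def)
  note iso = complete_internal_graph.P_to_Q[OF complete_internal_graph_IntCat IntCat_obj(3)]
  have ext: "Fob (Q_functor U) \<in> extensional (Obj ?I)" "Far (Q_functor U) \<in> extensional (Arr ?I)"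
    by (simp_all add: Q_functor_def)
  have conj: "Far (Q_functor U) k = ?t (Cod ?I k) \<cdot>\<^bsub>DFib U\<^esub> (Far (P_functor U) k \<cdot>\<^bsub>DFib U\<^esub> ?s (Dom ?I k))"
    if "k \<in> Arr ?I" for k
  proof -
    have "Dom ?I k = src k" "Cod ?I k = tgt k"
      by (simp_all add: IntCat_def)
    then show ?thesis
      using Q_functor_conjugate[OF that] by simp
  qed
  have "?t X \<in> hom (DFib U) (Fob (P_functor U) X) (Fob (Q_functor U) X)"
    "?s X \<in> hom (DFib U) (Fob (Q_functor U) X) (Fob (P_functor U) X)"
    "?s X \<cdot>\<^bsub>DFib U\<^esub> ?t X = Ident (DFib U) (Fob (P_functor U) X)"
    "?t X \<cdot>\<^bsub>DFib U\<^esub> ?s X = Ident (DFib U) (Fob (Q_functor U) X)" if "X \<in> Obj ?I" for X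
    using iso[OF that that] unfolding Pob[OF that] Qob[OF that] by auto
  note Q = transported_functor[where t = ?t and s = ?s, OF P_functor_functor ext this conj]
  show ?thesis
    using P_functor_functor Q unfolding naturally_isomorphic_def by blast
qed

end
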